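(* Let all strings be over an alphabet of size $(\log n)^{\mathcal{O}(1)}$, where $n$ is the total length of the indexed string(s). On a word RAM, each of the following problems can be solved with a data structure of $\mathcal{O}(n)$ words of space and query time $\mathcal{O}(m)$, where $m$ is the total length of the query pattern(s): (1) Position-restricted substring counting: store a string $S$ of length $n$ so that, given a pattern $P$ and an interval $[i,j]$ with $1\le i\le j\le n$, one counts the occurrences of $P$ in $S$ starting at a position in $[i,j]$. (2) Counting version of indexing substrings with intervals: store $S$ of length $n$ and a set $\pi$ of intervals contained in $[1,n]$ so that, given $P$ and $[i,j]$, one counts the occurrences of $P$ in $S$ whose starting position lies in $[i,j]$ and in at least one interval of $\pi$. (3) Counting version of indexing substrings with gaps: given a fixed integer $d$, store $S$ of length $n$ so that, given patterns $P_1,P_2$, one counts the positions of $S$ at which an occurrence of $P_1$ is followed by exactly $d$ characters and then an occurrence of $P_2$. (4) Counting version of aligned pattern matching: store two strings $S_1,S_2$ of total length $n$ so that, given patterns $P_1,P_2$, one counts the positions $i$ such that $P_1$ occurs in $S_1$ starting at position $i$ and $P_2$ occurs in $S_2$ starting at position $i$.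
   Context: The model is the word RAM with word size $\Omega(\log n)$; space is measured in words. An occurrence of a pattern $P$ in a string $S$ starting at position $i$ means $S[i..i+|P|-1]=P$. *)

theory Defs
  imports Complex_Main "HOL-Library.Landau_Symbols"
begin

text \<open>
  A unit-cost word RAM with word size \<open>w\<close>. Words are naturals below \<open>2 ^ w\<close>, and all arithmetic is
  modulo \<open>2 ^ w\<close>. A program is a finite list of instructions and does not depend on \<open>w\<close> or on the
  input. It names a fixed finite set of registers.

  Memory is divided into segments, each addressed by a word. The segment number is a literal of
  the instruction, so a program uses only a constant number of segments. With \<open>2 ^ w\<close> barely above
  \<open>n\<close>, a single segment could not hold \<open>C * n\<close> words when \<open>C > 1\<close>. \<open>Static\<close> segments hold the
  stored data structure and \<open>Query\<close> segments the query patterns, one character per word; both are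
  read-only. \<open>Work\<close> segments are scratch memory, initially zero.
\<close>

datatype binop = Add | Sub | Mul | Div | Mod | BitAnd | BitOr | BitXor | ShiftL | ShiftR

datatype segment = Static nat | Query nat | Work nat

datatype instr =
    Const nat nat             \<comment> \<open>\<open>Const r c\<close>: \<open>r := c\<close>\<close>
  | Copy nat nat              \<comment> \<open>\<open>Copy r a\<close>: \<open>r := a\<close>\<close>
  | Arith binop nat nat nat   \<comment> \<open>\<open>Arith f r a b\<close>: \<open>r := f a b\<close>\<close>
  | Load nat segment nat      \<comment> \<open>\<open>Load r s a\<close>: \<open>r := s[a]\<close>\<close>
  | Store nat nat nat         \<comment> \<open>\<open>Store k a b\<close>: \<open>Work k [a] := b\<close>\<close>
  | Jump nat
  | JumpEq nat nat nat        \<comment> \<open>\<open>JumpEq a b l\<close>: if \<open>a = b\<close> go to \<open>l\<close>\<close>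
  | JumpLess nat nat nat      \<comment> \<open>\<open>JumpLess a b l\<close>: if \<open>a < b\<close> go to \<open>l\<close>\<close>

record config =
  pc :: nat
  regs :: "nat \<Rightarrow> nat"
  work :: "nat \<Rightarrow> nat \<Rightarrow> nat"

fun arith :: "nat \<Rightarrow> binop \<Rightarrow> nat \<Rightarrow> nat \<Rightarrow> nat" where
  "arith w Add x y = (x + y) mod 2 ^ w"
| "arith w Sub x y = (x + (2 ^ w - y)) mod 2 ^ w"
| "arith w Mul x y = (x * y) mod 2 ^ w"
| "arith w Div x y = x div y"
| "arith w Mod x y = x mod y"
| "arith w BitAnd x y = and x y"
| "arith w BitOr x y = or x y"
| "arith w BitXor x y = xor x y"
| "arith w ShiftL x y = push_bit y x mod 2 ^ w"
| "arith w ShiftR x y = drop_bit y x"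

definition cell :: "nat list list \<Rightarrow> nat \<Rightarrow> nat \<Rightarrow> nat" where
  "cell X k a = (if k < length X \<and> a < length (X ! k) then X ! k ! a else 0)"

fun fetch :: "nat list list \<Rightarrow> nat list list \<Rightarrow> config \<Rightarrow> segment \<Rightarrow> nat \<Rightarrow> nat" where
  "fetch D Q c (Static k) a = cell D k a"
| "fetch D Q c (Query k) a = cell Q k a"
| "fetch D Q c (Work k) a = work c k a"

definition set_reg :: "nat \<Rightarrow> nat \<Rightarrow> config \<Rightarrow> config" where
  "set_reg r v c = c\<lparr>pc := Suc (pc c), regs := (regs c)(r := v)\<rparr>"

fun exec :: "nat \<Rightarrow> nat list list \<Rightarrow> nat list list \<Rightarrow> instr \<Rightarrow> config \<Rightarrow> config" where
  "exec w D Q (Const r v) c = set_reg r (v mod 2 ^ w) c"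
| "exec w D Q (Copy r a) c = set_reg r (regs c a) c"
| "exec w D Q (Arith f r a b) c = set_reg r (arith w f (regs c a) (regs c b)) c"
| "exec w D Q (Load r s a) c = set_reg r (fetch D Q c s (regs c a)) c"
| "exec w D Q (Store k a b) c =
     c\<lparr>pc := Suc (pc c), work := (work c)(k := (work c k)(regs c a := regs c b))\<rparr>"
| "exec w D Q (Jump l) c = c\<lparr>pc := l\<rparr>"
| "exec w D Q (JumpEq a b l) c = c\<lparr>pc := if regs c a = regs c b then l else Suc (pc c)\<rparr>"
| "exec w D Q (JumpLess a b l) c = c\<lparr>pc := if regs c a < regs c b then l else Suc (pc c)\<rparr>"

text \<open>The machine halts when the program counter leaves the program.\<close>

definition step :: "instr list \<Rightarrow> nat \<Rightarrow> nat list list \<Rightarrow> nat list list \<Rightarrow> config \<Rightarrow> config" where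
  "step p w D Q c = (if pc c < length p then exec w D Q (p ! pc c) c else c)"

definition init :: "nat list \<Rightarrow> config" where
  "init args = \<lparr>pc = 0, regs = (\<lambda>r. if r < length args then args ! r else 0), work = (\<lambda>_ _. 0)\<rparr>"

text \<open>
  On data structure \<open>D\<close> and a query with scalar arguments \<open>args\<close> (in the first registers) and
  patterns \<open>Q\<close>, the program halts after at most \<open>t\<close> steps with \<open>v\<close> in register 0.
\<close>

definition answers ::
  "instr list \<Rightarrow> nat \<Rightarrow> nat list list \<Rightarrow> nat list \<Rightarrow> nat list list \<Rightarrow> nat \<Rightarrow> nat \<Rightarrow> bool" where
  "answers p w D args Q t v \<longleftrightarrow>
     (\<exists>t'\<le>t. let c = (step p w D Q ^^ t') (init args) in length p \<le> pc c \<and> regs c 0 = v)"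

definition data_structure :: "nat \<Rightarrow> nat \<Rightarrow> nat list list \<Rightarrow> bool" where
  "data_structure w s D \<longleftrightarrow> (\<forall>X\<in>set D. set X \<subseteq> {..<2 ^ w}) \<and> sum_list (map length D) \<le> s"

text \<open>Positions are numbered from 1: this says \<open>S[i..i+|P|-1] = P\<close>.\<close>

definition occurs_at :: "nat list \<Rightarrow> nat list \<Rightarrow> nat \<Rightarrow> bool" where
  "occurs_at P S i \<longleftrightarrow>
     1 \<le> i \<and> i + length P \<le> length S + 1 \<and> take (length P) (drop (i - 1) S) = P"

definition polylog :: "(nat \<Rightarrow> nat) \<Rightarrow> bool" where
  "polylog \<sigma> \<longleftrightarrow> (\<exists>c::nat. (\<lambda>n. real (\<sigma> n)) \<in> O(\<lambda>n. ln (real n) ^ c))"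

text \<open>
  A word can hold any number up to the input length \<open>n\<close> and any character of the alphabet
  \<open>{0..<s}\<close>; the first condition is \<open>w > log 2 n\<close>.
\<close>

definition word_size :: "nat \<Rightarrow> nat \<Rightarrow> nat \<Rightarrow> bool" where
  "word_size n s w \<longleftrightarrow> n < 2 ^ w \<and> s \<le> 2 ^ w"

end

theory Submission
  imports Defs "HOL-Library.Multiset" "HOL-Library.List_Lexorder"
begin

text \<open>
  Each problem asks for the number of points \<open>p\<close> of an interval \<open>[u, v)\<close> of a list whose attached text
  suffix starts with a pattern \<open>P\<close>. For aligned matching the list is the suffix array of \<open>S1\<close>, for
  gaps that of the reversed text, and backward search for the first pattern yields the interval; for
  intervals it is the list of admissible positions itself.

  Everything reduces to rank queries on sequences over a digit alphabet of size \<open>b\<close> with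
  \<open>b ^ 4 \<le> log n < 16 * b ^ 4\<close>; a character consists of a constant number \<open>K\<close> of digits. If \<open>P\<close> is shorter than
  \<open>T \<approx> log n / log b\<close>, one walks down a wavelet matrix whose levels are the digits of the first \<open>T\<close>
  characters of the suffixes. Otherwise backward search gives the suffix array interval of \<open>P\<close>, and the
  points are counted by a wavelet matrix on the \<open>T\<close> digits of their suffix ranks, in time
  \<open>O(T) = O(|P|)\<close>.

  A level of \<open>n\<close> digits fits into \<open>O(n / T)\<close> words with constant-time rank: absolute counts per
  superblock, relative counts of a block packed into one word, and a lookup table for packed pieces of
  a block. There are \<open>O(T)\<close> levels.
\<close>

section \<open>A structured language compiled to the word RAM\<close>

text \<open>The only guaranteed lower bound on the word range is \<open>n < 2 ^ w\<close>, so
  addresses, table entries and intermediate sums have to be bounded by \<open>n\<close>, and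
  constant factors of the space bound go into the number of segments. This shapes the choice of
  \<open>b\<close>: the \<open>b + 1\<close> relative counts of a block share one word and may take
  about \<open>b ^ 2\<close> bits, which must stay below \<open>log n\<close>, while a
  polylogarithmic character must still consist of O(1) digits; a fourth root of \<open>log n\<close>
  achieves both and leaves slack for the tables. A word holds only a fraction of the digits needed
  per block, hence a block is a constant number \<open>G\<close> of packed pieces, each with a
  lookup table of at most \<open>n\<close> entries. The split at \<open>T\<close> is forced from
  both sides: digits of more than O(T) characters would need more levels than linear space allows,
  and a query shorter than \<open>T\<close> cannot pay for the \<open>T\<close> digits of a rank.
  Below some constant the required inequalities may fail; as the program is the same for all
  \<open>n\<close>, a tag in the stored data then selects a table of precomputed answers.\<close>

datatype expr = N nat | V nat | Op binop expr expr | St nat expr | Qu nat expr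

fun ev :: "nat \<Rightarrow> nat list list \<Rightarrow> nat list list \<Rightarrow> (nat \<Rightarrow> nat) \<Rightarrow> expr \<Rightarrow> nat" where
  "ev w D Q s (N v) = v mod 2 ^ w"
| "ev w D Q s (V r) = s r"
| "ev w D Q s (Op f a b) = arith w f (ev w D Q s a) (ev w D Q s b)"
| "ev w D Q s (St k a) = cell D k (ev w D Q s a)"
| "ev w D Q s (Qu k a) = cell Q k (ev w D Q s a)"

text \<open>Registers from \<open>k\<close> upwards form an evaluation stack with the result left in
  \<open>k\<close>. Variables live below \<open>k\<close>, as \<open>expr_below\<close> demands, so
  evaluation never destroys them.\<close>

fun compile_expr :: "nat \<Rightarrow> expr \<Rightarrow> instr list" where
  "compile_expr k (N v) = [Const k v]"
| "compile_expr k (V r) = [Copy k r]"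
| "compile_expr k (Op f a b) = compile_expr k a @ compile_expr (Suc k) b @ [Arith f k k (Suc k)]"
| "compile_expr k (St j a) = compile_expr k a @ [Load k (Static j) k]"
| "compile_expr k (Qu j a) = compile_expr k a @ [Load k (Query j) k]"

fun expr_len :: "expr \<Rightarrow> nat" where
  "expr_len (N v) = 1"
| "expr_len (V r) = 1"
| "expr_len (Op f a b) = expr_len a + expr_len b + 1"
| "expr_len (St j a) = expr_len a + 1"
| "expr_len (Qu j a) = expr_len a + 1"

fun expr_below :: "nat \<Rightarrow> expr \<Rightarrow> bool" where
  "expr_below k (N v) = True"
| "expr_below k (V r) = (r < k)"
| "expr_below k (Op f a b) = (expr_below k a \<and> expr_below k b)"
| "expr_below k (St j a) = expr_below k a"
| "expr_below k (Qu j a) = expr_below k a"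

lemma length_compile_expr [simp]: "length (compile_expr k e) = expr_len e"
  by (induction e arbitrary: k) auto

lemma ev_cong: "expr_below k e \<Longrightarrow> (\<And>r. r < k \<Longrightarrow> s r = s' r) \<Longrightarrow> ev w D Q s e = ev w D Q s' e"
  by (induction e) auto

lemma expr_below_mono: "expr_below k e \<Longrightarrow> k \<le> k' \<Longrightarrow> expr_below k' e"
  by (induction e) auto

text \<open>Jump targets are absolute, so correctness speaks of a fragment that sits at address
  \<open>i\<close> of an arbitrary surrounding program.\<close>

definition located :: "'a list \<Rightarrow> nat \<Rightarrow> 'a list \<Rightarrow> bool" where
  "located p i xs \<longleftrightarrow> (\<exists>a z. p = a @ xs @ z \<and> length a = i)"

lemma located_append: "located p i (xs @ ys) \<longleftrightarrow> located p i xs \<and> located p (i + length xs) ys"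
proof
  assume "located p i (xs @ ys)"
  then obtain a z where "p = a @ (xs @ ys) @ z" "length a = i" by (auto simp: located_def)
  then have "p = a @ xs @ (ys @ z)" "p = (a @ xs) @ ys @ z" "length (a @ xs) = i + length xs" by auto
  then show "located p i xs \<and> located p (i + length xs) ys"
    unfolding located_def using \<open>length a = i\<close> by blast
next
  assume "located p i xs \<and> located p (i + length xs) ys"
  then obtain a z a' z' where *: "p = a @ xs @ z" "length a = i" "p = a' @ ys @ z'" "length a' = i + length xs"
    unfolding located_def by blast
  have "take (i + length xs) p = a'" by (subst *(3)) (use *(4) in simp)
  moreover have "take (i + length xs) p = a @ xs" by (subst *(1)) (use *(2) in simp)
  ultimately have "p = a @ (xs @ ys) @ z'" using *(3) by simp
  then show "located p i (xs @ ys)" unfolding located_def using *(2) by blast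
qed

lemma located_single: "located p i [x] \<longleftrightarrow> i < length p \<and> p ! i = x"
proof
  assume "i < length p \<and> p ! i = x"
  then have "p = take i p @ [x] @ drop (Suc i) p" "length (take i p) = i"
    by (auto simp: id_take_nth_drop[symmetric] min_def)
  then show "located p i [x]" unfolding located_def by blast
qed (auto simp: located_def)

lemma located_Nil: "located p i [] \<longleftrightarrow> i \<le> length p"
proof
  assume "i \<le> length p"
  then have "p = take i p @ [] @ drop i p \<and> length (take i p) = i" by simp
  then show "located p i []" unfolding located_def by blast
qed (auto simp: located_def)

lemma located_Cons: "located p i (x # xs) \<longleftrightarrow> i < length p \<and> p ! i = x \<and> located p (Suc i) xs"
  using located_append[of p i "[x]" xs] located_single[of p i x] by auto

lemma funpow_then: "(f ^^ a) x = y \<Longrightarrow> (f ^^ b) y = z \<Longrightarrow> (f ^^ (a + b)) x = z"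
  by (simp add: add.commute[of a b] funpow_add)

lemma funpow_then1: "(f ^^ a) x = y \<Longrightarrow> f y = z \<Longrightarrow> (f ^^ (Suc a)) x = z"
  by simp

lemma compile_expr_correct:
  assumes "located p (pc c) (compile_expr k e)" "expr_below k e"
  shows "\<exists>c'. (step p w D Q ^^ expr_len e) c = c' \<and> pc c' = pc c + expr_len e \<and>
     (\<forall>r<k. regs c' r = regs c r) \<and> regs c' k = ev w D Q (regs c) e"
  using assms
proof (induction e arbitrary: k c)
  case (Op f a b)
  have la: "located p (pc c) (compile_expr k a)"
    and lb: "located p (pc c + expr_len a) (compile_expr (Suc k) b)"
    and lc: "located p (pc c + expr_len a + expr_len b) [Arith f k k (Suc k)]"
    using Op.prems(1) by (auto simp: located_append)
  from Op.IH(1)[OF la] Op.prems(2) obtain c1 where c1: "(step p w D Q ^^ expr_len a) c = c1"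
    "pc c1 = pc c + expr_len a" "\<forall>r<k. regs c1 r = regs c r" "regs c1 k = ev w D Q (regs c) a" by auto
  have "expr_below (Suc k) b" using Op.prems(2) expr_below_mono by auto
  with Op.IH(2)[of c1 "Suc k"] lb c1(2) obtain c2 where c2: "(step p w D Q ^^ expr_len b) c1 = c2"
    "pc c2 = pc c1 + expr_len b" "\<forall>r<Suc k. regs c2 r = regs c1 r"
    "regs c2 (Suc k) = ev w D Q (regs c1) b" by auto
  have e: "ev w D Q (regs c1) b = ev w D Q (regs c) b"
    by (rule ev_cong[of k]) (use Op.prems(2) c1 in auto)
  have "step p w D Q c2 = exec w D Q (Arith f k k (Suc k)) c2"
    using lc c1 c2 by (auto simp: step_def located_Cons located_Nil add.assoc)
  then have "(step p w D Q ^^ Suc (expr_len a + expr_len b)) c = exec w D Q (Arith f k k (Suc k)) c2"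
    using funpow_then[OF c1(1) c2(1)] by (intro funpow_then1) auto
  then show ?case using c1 c2 e by (auto simp: set_reg_def)
next
  case (St j a)
  from St.IH[of c k] St.prems obtain c1 where c1: "(step p w D Q ^^ expr_len a) c = c1"
    "pc c1 = pc c + expr_len a" "\<forall>r<k. regs c1 r = regs c r" "regs c1 k = ev w D Q (regs c) a"
    by (auto simp: located_append)
  have "step p w D Q c1 = exec w D Q (Load k (Static j) k) c1"
    using St.prems c1 by (auto simp: step_def located_append located_Cons located_Nil add.assoc)
  then show ?case using c1 by (auto simp: set_reg_def)
next
  case (Qu j a)
  from Qu.IH[of c k] Qu.prems obtain c1 where c1: "(step p w D Q ^^ expr_len a) c = c1"
    "pc c1 = pc c + expr_len a" "\<forall>r<k. regs c1 r = regs c r" "regs c1 k = ev w D Q (regs c) a"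
    by (auto simp: located_append)
  have "step p w D Q c1 = exec w D Q (Load k (Query j) k) c1"
    using Qu.prems c1 by (auto simp: step_def located_append located_Cons located_Nil add.assoc)
  then show ?case using c1 by (auto simp: set_reg_def)
qed (auto simp: step_def located_Cons located_Nil set_reg_def)

section \<open>Structured commands and their compilation\<close>

datatype com =
    Skip
  | Set nat expr
  | Seq com com (infixr ";;" 60)
  | If expr expr com com
  | While expr expr com

text \<open>The condition of \<open>If a b\<close> and \<open>While a b\<close> is \<open>a < b\<close>. The index \<open>t\<close> of the big-step relation
  counts loop iterations only; the number of machine steps exceeds \<open>t + 1\<close> by at most the factor
  \<open>com_len\<close>, which depends on the program alone.\<close>

inductive big_step :: "nat \<Rightarrow> nat list list \<Rightarrow> nat list list \<Rightarrow> com \<Rightarrow> (nat \<Rightarrow> nat) \<Rightarrow> nat \<Rightarrow> (nat \<Rightarrow> nat) \<Rightarrow> bool"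
  for w D Q where
  Skip: "big_step w D Q Skip s 0 s"
| Set: "big_step w D Q (Set r e) s 0 (s(r := ev w D Q s e))"
| Seq: "big_step w D Q a s t s' \<Longrightarrow> big_step w D Q b s' t' s'' \<Longrightarrow> big_step w D Q (a ;; b) s (t + t') s''"
| IfT: "ev w D Q s e < ev w D Q s e' \<Longrightarrow> big_step w D Q a s t s' \<Longrightarrow> big_step w D Q (If e e' a b) s t s'"
| IfF: "\<not> ev w D Q s e < ev w D Q s e' \<Longrightarrow> big_step w D Q b s t s' \<Longrightarrow> big_step w D Q (If e e' a b) s t s'"
| WhileF: "\<not> ev w D Q s e < ev w D Q s e' \<Longrightarrow> big_step w D Q (While e e' a) s 0 s"
| WhileT: "ev w D Q s e < ev w D Q s e' \<Longrightarrow> big_step w D Q a s t s' \<Longrightarrow>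
    big_step w D Q (While e e' a) s' t' s'' \<Longrightarrow> big_step w D Q (While e e' a) s (Suc (t + t')) s''"

fun com_len :: "com \<Rightarrow> nat" where
  "com_len Skip = 0"
| "com_len (Set r e) = expr_len e + 1"
| "com_len (a ;; b) = com_len a + com_len b"
| "com_len (If e e' a b) = expr_len e + expr_len e' + com_len a + com_len b + 2"
| "com_len (While e e' a) = expr_len e + expr_len e' + com_len a + 3"

text \<open>The argument \<open>i\<close> is the address of the code. \<open>JumpLess\<close> is
  taken when the test succeeds, so the \<open>b\<close> branch of \<open>If\<close> is laid out
  first, and \<open>While\<close> exits through the plain jump behind the test.\<close>

fun compile :: "nat \<Rightarrow> nat \<Rightarrow> com \<Rightarrow> instr list" where
  "compile k i Skip = []"
| "compile k i (Set r e) = compile_expr k e @ [Copy r k]"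
| "compile k i (a ;; b) = compile k i a @ compile k (i + com_len a) b"
| "compile k i (If e e' a b) =
    (let j = i + expr_len e + expr_len e' in
     compile_expr k e @ compile_expr (Suc k) e' @ [JumpLess k (Suc k) (j + com_len b + 2)] @
     compile k (j + 1) b @ [Jump (j + com_len b + 2 + com_len a)] @ compile k (j + com_len b + 2) a)"
| "compile k i (While e e' a) =
    (let j = i + expr_len e + expr_len e' in
     compile_expr k e @ compile_expr (Suc k) e' @ [JumpLess k (Suc k) (j + 2)] @
     [Jump (j + 3 + com_len a)] @ compile k (j + 2) a @ [Jump i])"

fun com_below :: "nat \<Rightarrow> com \<Rightarrow> bool" where
  "com_below k Skip = True"
| "com_below k (Set r e) = (r < k \<and> expr_below k e)"
| "com_below k (a ;; b) = (com_below k a \<and> com_below k b)"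
| "com_below k (If e e' a b) = (expr_below k e \<and> expr_below k e' \<and> com_below k a \<and> com_below k b)"
| "com_below k (While e e' a) = (expr_below k e \<and> expr_below k e' \<and> com_below k a)"

lemma length_compile [simp]: "length (compile k i c) = com_len c"
  by (induction c arbitrary: i) (auto simp: Let_def)

lemma compile_cond_correct:
  assumes "located p (pc c) (compile_expr k e @ compile_expr (Suc k) e' @ [JumpLess k (Suc k) l])"
    and "expr_below k e" "expr_below k e'" "\<forall>r<k. regs c r = s r"
  shows "\<exists>c'. (step p w D Q ^^ (expr_len e + expr_len e' + 1)) c = c' \<and>
     pc c' = (if ev w D Q s e < ev w D Q s e' then l else pc c + expr_len e + expr_len e' + 1) \<and>
     (\<forall>r<k. regs c' r = s r)"
proof -
  have la: "located p (pc c) (compile_expr k e)"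
    and lb: "located p (pc c + expr_len e) (compile_expr (Suc k) e')"
    and lc: "located p (pc c + expr_len e + expr_len e') [JumpLess k (Suc k) l]"
    using assms(1) by (auto simp: located_append)
  from compile_expr_correct[OF la assms(2), of w D Q] obtain c1 where
    c1: "(step p w D Q ^^ expr_len e) c = c1"
    "pc c1 = pc c + expr_len e" "\<forall>r<k. regs c1 r = regs c r" "regs c1 k = ev w D Q (regs c) e" by auto
  have "expr_below (Suc k) e'" using assms(3) expr_below_mono by auto
  with compile_expr_correct[of p c1 "Suc k" e' w D Q] lb c1(2) obtain c2 where
    c2: "(step p w D Q ^^ expr_len e') c1 = c2"
    "pc c2 = pc c1 + expr_len e'" "\<forall>r<Suc k. regs c2 r = regs c1 r"
    "regs c2 (Suc k) = ev w D Q (regs c1) e'" by auto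
  have e: "ev w D Q (regs c1) e' = ev w D Q s e'" "ev w D Q (regs c) e = ev w D Q s e"
    by (rule ev_cong[of k]; use assms c1 in auto)+
  have "step p w D Q c2 = exec w D Q (JumpLess k (Suc k) l) c2"
    using lc c1 c2 by (auto simp: step_def located_Cons located_Nil add.assoc)
  then have "(step p w D Q ^^ Suc (expr_len e + expr_len e')) c = exec w D Q (JumpLess k (Suc k) l) c2"
    using funpow_then[OF c1(1) c2(1)] by (intro funpow_then1) auto
  then show ?thesis using c1 c2 e assms(4) by auto
qed

text \<open>Without loops each instruction runs at most once, which costs at most
  \<open>com_len c\<close>. A further iteration costs at most one more pass, paid by the unit that
  \<open>WhileT\<close> adds: the factors \<open>t + 1\<close> and \<open>t' + 1\<close> sum to
  \<open>Suc (t + t') + 1\<close>.\<close>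

lemma compile_correct:
  assumes "big_step w D Q c s t s'" "com_below k c" "located p i (compile k i c)" "pc cf = i"
    "\<forall>r<k. regs cf r = s r"
  shows "\<exists>M cf'. M \<le> com_len c * (t + 1) \<and> (step p w D Q ^^ M) cf = cf' \<and> pc cf' = i + com_len c \<and>
    (\<forall>r<k. regs cf' r = s' r)"
  using assms
proof (induction arbitrary: i cf rule: big_step.induct)
  case (Skip s)
  then show ?case by (auto intro!: exI[of _ 0])
next
  case (Set r e s)
  from compile_expr_correct[of p cf k e w D Q] Set.prems obtain c1 where
    c1: "(step p w D Q ^^ expr_len e) cf = c1"
    "pc c1 = pc cf + expr_len e" "\<forall>r<k. regs c1 r = regs cf r" "regs c1 k = ev w D Q (regs cf) e"
    by (auto simp: located_append)
  have e: "ev w D Q (regs cf) e = ev w D Q s e"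
    by (rule ev_cong[of k]; use Set.prems c1 in auto)
  have "step p w D Q c1 = exec w D Q (Copy r k) c1"
    using Set.prems c1 by (auto simp: step_def located_append located_Cons located_Nil add.assoc)
  then have "(step p w D Q ^^ Suc (expr_len e)) cf = exec w D Q (Copy r k) c1"
    using c1(1) by (intro funpow_then1) auto
  then show ?case using c1 e Set.prems by (auto intro!: exI[of _ "Suc (expr_len e)"] simp: set_reg_def)
next
  case (Seq a s t s' b t' s'')
  from Seq.IH(1)[of i cf] Seq.prems obtain M1 c1 where
    c1: "M1 \<le> com_len a * (t + 1)" "(step p w D Q ^^ M1) cf = c1" "pc c1 = i + com_len a" "\<forall>r<k. regs c1 r = s' r"
    by (auto simp: located_append)
  from Seq.IH(2)[of "i + com_len a" c1] Seq.prems c1 obtain M2 c2 where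
    c2: "M2 \<le> com_len b * (t' + 1)" "(step p w D Q ^^ M2) c1 = c2" "pc c2 = i + com_len a + com_len b"
     "\<forall>r<k. regs c2 r = s'' r"
    by (auto simp: located_append)
  have "M1 + M2 \<le> com_len (a ;; b) * (t + t' + 1)"
    using c1(1) c2(1) by (simp add: algebra_simps)
  with funpow_then[OF c1(2) c2(2)] c2 show ?case by (intro exI[of _ "M1 + M2"] exI[of _ c2]) auto
next
  case (IfT s e e' a t s' b)
  let ?j = "i + expr_len e + expr_len e'"
  have la: "located p (pc cf) (compile_expr k e @ compile_expr (Suc k) e' @ [JumpLess k (Suc k) (?j + com_len b + 2)])"
    and lb: "located p (?j + com_len b + 2) (compile k (?j + com_len b + 2) a)"
    using IfT.prems by (auto simp: located_append located_Cons located_Nil Let_def add_ac)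
  from compile_cond_correct[OF la, of s w D Q] IfT.prems IfT.hyps obtain c1 where
    c1: "(step p w D Q ^^ (expr_len e + expr_len e' + 1)) cf = c1"
    "pc c1 = ?j + com_len b + 2" "\<forall>r<k. regs c1 r = s r"
    by auto
  from IfT.IH[OF _ lb c1(2,3)] IfT.prems obtain M2 c2 where
    c2: "M2 \<le> com_len a * (t + 1)" "(step p w D Q ^^ M2) c1 = c2" "pc c2 = ?j + com_len b + 2 + com_len a"
     "\<forall>r<k. regs c2 r = s' r" by auto
  have "expr_len e + expr_len e' + 1 + M2 \<le> com_len (If e e' a b) * (t + 1)"
    using c2(1) by (simp add: algebra_simps)
  with funpow_then[OF c1(1) c2(2)] c2 show ?case
    by (intro exI[of _ "expr_len e + expr_len e' + 1 + M2"] exI[of _ c2]) auto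
next
  case (IfF s e e' b t s' a)
  let ?j = "i + expr_len e + expr_len e'"
  have la: "located p (pc cf) (compile_expr k e @ compile_expr (Suc k) e' @ [JumpLess k (Suc k) (?j + com_len b + 2)])"
    and lb: "located p (?j + 1) (compile k (?j + 1) b)"
    and lc: "located p (?j + 1 + com_len b) [Jump (?j + com_len b + 2 + com_len a)]"
    using IfF.prems by (auto simp: located_append located_Cons located_Nil Let_def add_ac)
  from compile_cond_correct[OF la, of s w D Q] IfF.prems IfF.hyps obtain c1 where
    c1: "(step p w D Q ^^ (expr_len e + expr_len e' + 1)) cf = c1"
    "pc c1 = ?j + 1" "\<forall>r<k. regs c1 r = s r"
    by auto
  from IfF.IH[OF _ lb c1(2,3)] IfF.prems obtain M2 c2 where
    c2: "M2 \<le> com_len b * (t + 1)" "(step p w D Q ^^ M2) c1 = c2" "pc c2 = ?j + 1 + com_len b"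
     "\<forall>r<k. regs c2 r = s' r" by auto
  have "step p w D Q c2 = exec w D Q (Jump (?j + com_len b + 2 + com_len a)) c2"
    using lc c2 by (auto simp: step_def located_Cons located_Nil)
  then have s: "(step p w D Q ^^ Suc (expr_len e + expr_len e' + 1 + M2)) cf = c2\<lparr>pc := ?j + com_len b + 2 + com_len a\<rparr>"
    using funpow_then[OF c1(1) c2(2)] by (intro funpow_then1) auto
  have "Suc (expr_len e + expr_len e' + 1 + M2) \<le> com_len (If e e' a b) * (t + 1)"
    using c2(1) by (simp add: algebra_simps)
  with s c2 show ?case
    by (intro exI[of _ "Suc (expr_len e + expr_len e' + 1 + M2)"] exI) auto
next
  case (WhileF s e e' a)
  let ?j = "i + expr_len e + expr_len e'"
  have la: "located p (pc cf) (compile_expr k e @ compile_expr (Suc k) e' @ [JumpLess k (Suc k) (?j + 2)])"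
    and lc: "located p (?j + 1) [Jump (?j + 3 + com_len a)]"
    using WhileF.prems by (auto simp: located_append Let_def located_Cons located_Nil add_ac)
  from compile_cond_correct[OF la, of s w D Q] WhileF.prems WhileF.hyps obtain c1 where
    c1: "(step p w D Q ^^ (expr_len e + expr_len e' + 1)) cf = c1"
    "pc c1 = ?j + 1" "\<forall>r<k. regs c1 r = s r"
    by auto
  have "step p w D Q c1 = exec w D Q (Jump (?j + 3 + com_len a)) c1"
    using lc c1 by (auto simp: step_def located_Cons located_Nil)
  then have s: "(step p w D Q ^^ Suc (expr_len e + expr_len e' + 1)) cf = c1\<lparr>pc := ?j + 3 + com_len a\<rparr>"
    using c1(1) by (intro funpow_then1) auto
  then show ?case using c1
    by (intro exI[of _ "Suc (expr_len e + expr_len e' + 1)"] exI) auto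
next
  case (WhileT s e e' a t s' t' s'')
  let ?j = "i + expr_len e + expr_len e'"
  have la: "located p (pc cf) (compile_expr k e @ compile_expr (Suc k) e' @ [JumpLess k (Suc k) (?j + 2)])"
    and lb: "located p (?j + 2) (compile k (?j + 2) a)"
    and lc: "located p (?j + 2 + com_len a) [Jump i]"
    using WhileT.prems by (auto simp: located_append Let_def located_Cons located_Nil add_ac)
  from compile_cond_correct[OF la, of s w D Q] WhileT.prems WhileT.hyps obtain c1 where
    c1: "(step p w D Q ^^ (expr_len e + expr_len e' + 1)) cf = c1"
    "pc c1 = ?j + 2" "\<forall>r<k. regs c1 r = s r"
    by auto
  from WhileT.IH(1)[OF _ lb c1(2,3)] WhileT.prems obtain M2 c2 where
    c2: "M2 \<le> com_len a * (t + 1)" "(step p w D Q ^^ M2) c1 = c2" "pc c2 = ?j + 2 + com_len a"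
     "\<forall>r<k. regs c2 r = s' r" by auto
  have "step p w D Q c2 = exec w D Q (Jump i) c2"
    using lc c2 by (auto simp: step_def located_Cons located_Nil)
  then have s: "(step p w D Q ^^ Suc (expr_len e + expr_len e' + 1 + M2)) cf = c2\<lparr>pc := i\<rparr>"
    using funpow_then[OF c1(1) c2(2)] by (intro funpow_then1) auto
  from WhileT.IH(2)[of i "c2\<lparr>pc := i\<rparr>"] WhileT.prems c2 obtain M3 c3 where
    c3: "M3 \<le> com_len (While e e' a) * (t' + 1)" "(step p w D Q ^^ M3) (c2\<lparr>pc := i\<rparr>) = c3"
    "pc c3 = i + com_len (While e e' a)" "\<forall>r<k. regs c3 r = s'' r" by auto
  have "Suc (expr_len e + expr_len e' + 1 + M2) \<le> com_len (While e e' a) * (t + 1)"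
    using c2(1) by (simp add: algebra_simps)
  then have "Suc (expr_len e + expr_len e' + 1 + M2) + M3 \<le> com_len (While e e' a) * (Suc (t + t') + 1)"
    using c3(1) by (simp add: algebra_simps)
  with funpow_then[OF s c3(2)] c3(3,4) show ?case by blast
qed

section \<open>Total correctness triples with a budget of loop iterations\<close>

definition hoare :: "nat \<Rightarrow> nat list list \<Rightarrow> nat list list \<Rightarrow> ((nat \<Rightarrow> nat) \<Rightarrow> bool) \<Rightarrow> com \<Rightarrow> nat \<Rightarrow> ((nat \<Rightarrow> nat) \<Rightarrow> bool) \<Rightarrow> bool" where
  "hoare w D Q P c t R \<longleftrightarrow> (\<forall>s. P s \<longrightarrow> (\<exists>s' t'. t' \<le> t \<and> big_step w D Q c s t' s' \<and> R s'))"

abbreviation computes :: "nat \<Rightarrow> nat list list \<Rightarrow> nat list list \<Rightarrow> nat list \<Rightarrow> com \<Rightarrow> nat \<Rightarrow> nat \<Rightarrow> bool" where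
  "computes w D Q args c t v \<equiv> hoare w D Q (\<lambda>s. s = regs (init args)) c t (\<lambda>s. s 0 = v)"

lemma hoare_Skip: "(\<And>s. P s \<Longrightarrow> R s) \<Longrightarrow> hoare w D Q P Skip t R"
  unfolding hoare_def by (blast intro: big_step.Skip)

lemma hoare_Set: "(\<And>s. P s \<Longrightarrow> R (s(r := ev w D Q s e))) \<Longrightarrow> hoare w D Q P (Set r e) t R"
  unfolding hoare_def by (blast intro: big_step.Set)

lemma hoare_Seq:
  assumes "hoare w D Q P a t1 R" "hoare w D Q R b t2 R'" "t1 + t2 \<le> t"
  shows "hoare w D Q P (a ;; b) t R'"
  unfolding hoare_def
proof (intro allI impI)
  fix s assume "P s"
  then obtain s1 u1 where 1: "u1 \<le> t1" "big_step w D Q a s u1 s1" "R s1" using assms(1) unfolding hoare_def by blast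
  then obtain s2 u2 where 2: "u2 \<le> t2" "big_step w D Q b s1 u2 s2" "R' s2" using assms(2) unfolding hoare_def by blast
  show "\<exists>s' t'. t' \<le> t \<and> big_step w D Q (a ;; b) s t' s' \<and> R' s'"
    using big_step.Seq[OF 1(2) 2(2)] 1 2 assms(3) by (intro exI conjI) auto
qed

lemma hoare_Set_Seq:
  assumes "hoare w D Q R b t R'" "\<And>s. P s \<Longrightarrow> R (s(r := ev w D Q s e))"
  shows "hoare w D Q P (Set r e ;; b) t R'"
  by (rule hoare_Seq[OF hoare_Set[where t = 0] assms(1)]) (use assms(2) in auto)

lemma hoare_If:
  assumes "hoare w D Q (\<lambda>s. P s \<and> ev w D Q s e < ev w D Q s e') a t R"
    "hoare w D Q (\<lambda>s. P s \<and> \<not> ev w D Q s e < ev w D Q s e') b t R"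
  shows "hoare w D Q P (If e e' a b) t R"
  using assms unfolding hoare_def by (blast intro: big_step.IfT big_step.IfF)

lemma hoare_conseq:
  assumes "hoare w D Q P c t R" "\<And>s. P' s \<Longrightarrow> P s" "\<And>s. R s \<Longrightarrow> R' s" "t \<le> t'"
  shows "hoare w D Q P' c t' R'"
  using assms unfolding hoare_def by (meson le_trans)

text \<open>All loops here run a number of times known in advance, so the invariant is indexed by
  the number of completed rounds and no separate variant is needed.\<close>

lemma hoare_While:
  assumes body: "\<And>i. i < m \<Longrightarrow> hoare w D Q (I i) a t (I (Suc i))"
    and cond: "\<And>i s. i \<le> m \<Longrightarrow> I i s \<Longrightarrow> ev w D Q s e < ev w D Q s e' \<longleftrightarrow> i < m"
    and t': "m * Suc t \<le> t'"
  shows "hoare w D Q (I 0) (While e e' a) t' (I m)"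
proof -
  \<comment> \<open>Induction on the number \<open>j\<close> of rounds still to come.\<close>
  have "\<exists>s' u. u \<le> j * Suc t \<and> big_step w D Q (While e e' a) s u s' \<and> I m s'"
    if "j \<le> m" "I (m - j) s" for j s
    using that
  proof (induction j arbitrary: s)
    case 0
    then have "\<not> ev w D Q s e < ev w D Q s e'" using cond[of m s] by auto
    from big_step.WhileF[OF this] show ?case using 0 by auto
  next
    case (Suc j)
    then have c: "ev w D Q s e < ev w D Q s e'" using cond[of "m - Suc j" s] by auto
    from body[of "m - Suc j"] Suc.prems obtain s1 u1 where
      1: "u1 \<le> t" "big_step w D Q a s u1 s1" "I (Suc (m - Suc j)) s1" unfolding hoare_def by auto
    have "Suc (m - Suc j) = m - j" using Suc.prems by auto
    with 1 Suc.IH[of s1] Suc.prems obtain s2 u2 where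
      2: "u2 \<le> j * Suc t" "big_step w D Q (While e e' a) s1 u2 s2" "I m s2" by auto
    from big_step.WhileT[OF c 1(2) 2(2)] 1(1) 2(1,3) show ?case
      by (intro exI conjI) auto
  qed
  from this[of m] t' show ?thesis unfolding hoare_def by (metis diff_self_eq_0 le_refl le_trans)
qed

lemma answers_if_computes:
  assumes "computes w D Q args c t v" "com_below k c" "0 < k"
    "com_len c * (t + 1) \<le> t'"
  shows "answers (compile k 0 c) w D args Q t' v"
proof -
  obtain s' u where su: "u \<le> t" "big_step w D Q c (regs (init args)) u s'" "s' 0 = v"
    using assms(1) unfolding hoare_def by blast
  have "located (compile k 0 c) 0 (compile k 0 c)" unfolding located_def by auto
  from compile_correct[OF su(2) assms(2) this, of "init args"] obtain M cf' where
    *: "M \<le> com_len c * (u + 1)" "(step (compile k 0 c) w D Q ^^ M) (init args) = cf'"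
    "pc cf' = com_len c" "\<forall>r<k. regs cf' r = s' r" by (auto simp: init_def)
  have "com_len c * (u + 1) \<le> com_len c * (t + 1)" using su(1) by (intro mult_le_mono2) auto
  then have "M \<le> t'" using *(1) assms(4) by linarith
  then show ?thesis unfolding answers_def Let_def using * assms(3) su(3) by (intro exI[of _ M]) auto
qed

section \<open>Wavelet matrices and backward search\<close>

text \<open>Stable sorting by one digit after the other is least-significant-first radix sort;
  keeping all intermediate lists gives the wavelet matrix.\<close>

fun wavelet_level :: "(nat \<Rightarrow> 'a \<Rightarrow> nat) \<Rightarrow> 'a list \<Rightarrow> nat \<Rightarrow> 'a list" where
  "wavelet_level d A 0 = A"
| "wavelet_level d A (Suc s) = sort_key (d s) (wavelet_level d A s)"

text \<open>The place to which stable sorting by \<open>f\<close> sends the boundary in front of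
  position \<open>i\<close>, seen from digit \<open>x\<close>. On the Burrows-Wheeler transform this
  is the LF mapping.\<close>

definition rank_step :: "('a \<Rightarrow> nat) \<Rightarrow> 'a list \<Rightarrow> nat \<Rightarrow> nat \<Rightarrow> nat" where
  "rank_step f A i x = length (filter (\<lambda>a. f a < x) A) + length (filter (\<lambda>a. f a = x) (take i A))"

fun walk :: "(nat \<Rightarrow> 'a \<Rightarrow> nat) \<Rightarrow> 'a list \<Rightarrow> (nat \<Rightarrow> nat) \<Rightarrow> nat \<Rightarrow> nat \<Rightarrow> nat" where
  "walk d A x 0 i = i"
| "walk d A x (Suc s) i = rank_step (d s) (wavelet_level d A s) (walk d A x s i) (x s)"

text \<open>The order of radix sort: the digit processed last is the most significant one.\<close>

fun digits_below :: "(nat \<Rightarrow> 'a \<Rightarrow> nat) \<Rightarrow> (nat \<Rightarrow> nat) \<Rightarrow> nat \<Rightarrow> 'a \<Rightarrow> bool" where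
  "digits_below d x 0 a = False"
| "digits_below d x (Suc s) a = (d s a < x s \<or> d s a = x s \<and> digits_below d x s a)"

definition digits_same :: "(nat \<Rightarrow> 'a \<Rightarrow> nat) \<Rightarrow> (nat \<Rightarrow> nat) \<Rightarrow> nat \<Rightarrow> 'a \<Rightarrow> bool" where
  "digits_same d x s a \<longleftrightarrow> (\<forall>u<s. d u a = x u)"

lemma mset_wavelet_level [simp]: "mset (wavelet_level d A s) = mset A"
  by (induction s) auto

lemma length_wavelet_level [simp]: "length (wavelet_level d A s) = length A"
  by (metis mset_wavelet_level size_mset)

text \<open>By stability, the elements with key \<open>x\<close> form a contiguous block of the
  sorted list and keep their original order.\<close>

lemma sort_key_split:
  "sort_key f A = sort_key f (filter (\<lambda>a. f a < x) A) @ filter (\<lambda>a. f a = x) A @ sort_key f (filter (\<lambda>a. f a > x) A)"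
  (is "_ = ?R") for x :: "'b::linorder"
proof (rule properties_for_sort_key)
  have "mset A = filter_mset (\<lambda>a. f a < x) (mset A) + (filter_mset (\<lambda>a. f a = x) (mset A) + filter_mset (\<lambda>a. f a > x) (mset A))"
    by (rule multiset_eqI) (auto simp: not_less)
  then show "mset ?R = mset A" by simp
next
  fix k assume "k \<in> set ?R"
  have s: "filter (\<lambda>y. f k = f y) (sort_key f ys) = filter (\<lambda>y. f k = f y) ys" for ys
    using sort_key_stable[of f "f k" ys] by (simp only: eq_commute)
  consider "f k < x" | "f k = x" | "f k > x" by (rule linorder_cases)
  then show "filter (\<lambda>y. f k = f y) ?R = filter (\<lambda>y. f k = f y) A"
  proof cases
    case 1
    have "filter (\<lambda>y. f k = f y) (filter (\<lambda>a. f a < x) A) = filter (\<lambda>y. f k = f y) A"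
      using 1 by (auto simp: filter_filter intro!: filter_cong)
    moreover have "filter (\<lambda>y. f k = f y) (filter (\<lambda>a. f a = x) A) = []"
      using 1 by (auto simp: filter_empty_conv)
    moreover have "filter (\<lambda>y. f k = f y) (filter (\<lambda>a. f a > x) A) = []"
      using 1 by (auto simp: filter_empty_conv)
    ultimately show ?thesis by (simp only: filter_append s append_Nil append_Nil2)
  next
    case 2
    have "filter (\<lambda>y. f k = f y) (filter (\<lambda>a. f a < x) A) = []"
      using 2 by (auto simp: filter_empty_conv)
    moreover have "filter (\<lambda>y. f k = f y) (filter (\<lambda>a. f a = x) A) = filter (\<lambda>y. f k = f y) A"
      using 2 by (auto simp: filter_filter intro!: filter_cong)
    moreover have "filter (\<lambda>y. f k = f y) (filter (\<lambda>a. f a > x) A) = []"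
      using 2 by (auto simp: filter_empty_conv)
    ultimately show ?thesis by (simp only: filter_append s append_Nil append_Nil2)
  next
    case 3
    have "filter (\<lambda>y. f k = f y) (filter (\<lambda>a. f a < x) A) = []"
      using 3 by (auto simp: filter_empty_conv)
    moreover have "filter (\<lambda>y. f k = f y) (filter (\<lambda>a. f a = x) A) = []"
      using 3 by (auto simp: filter_empty_conv)
    moreover have "filter (\<lambda>y. f k = f y) (filter (\<lambda>a. f a > x) A) = filter (\<lambda>y. f k = f y) A"
      using 3 by (auto simp: filter_filter intro!: filter_cong)
    ultimately show ?thesis by (simp only: filter_append s append_Nil append_Nil2)
  qed
next
  have "sorted (map f (filter (\<lambda>a. f a = x) A))" by (induction A) auto
  then show "sorted (map f ?R)" by (force simp: sorted_append)
qed

lemma take_filter_take: "take (length (filter P (take i A))) (filter P A) = filter P (take i A)"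
proof -
  have "filter P A = filter P (take i A) @ filter P (drop i A)"
    by (metis append_take_drop_id filter_append)
  then show ?thesis by (metis append_eq_conv_conj)
qed

lemma take_rank_step:
  "take (rank_step f A i x) (sort_key f A) = sort_key f (filter (\<lambda>a. f a < x) A) @ filter (\<lambda>a. f a = x) (take i A)"
proof -
  have "length (filter (\<lambda>a. f a = x) (take i A)) \<le> length (filter (\<lambda>a. f a = x) A)"
    by (metis take_filter_take length_take min.cobounded1)
  then show ?thesis
    by (subst sort_key_split[of f A x]) (simp add: rank_step_def take_filter_take)
qed

text \<open>The block \<open>B\<close> of smaller digit strings does not depend on \<open>i\<close>,
  and stability leaves the matching elements behind it in their original order. So two walks differ
  by exactly the matching elements between their starting points.\<close>

lemma walk_structure:
  "\<exists>B. mset B = mset (filter (digits_below d x s) A) \<and>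
     (\<forall>i\<le>length A. take (walk d A x s i) (wavelet_level d A s) = B @ filter (digits_same d x s) (take i A) \<and>
          walk d A x s i = length B + length (filter (digits_same d x s) (take i A)))"
proof (induction s)
  case 0
  show ?case by (intro exI[of _ "[]"]) (auto simp: digits_same_def)
next
  case (Suc s)
  then obtain B where B: "mset B = mset (filter (digits_below d x s) A)"
    "\<And>i. i \<le> length A \<Longrightarrow> take (walk d A x s i) (wavelet_level d A s) = B @ filter (digits_same d x s) (take i A)"
    by blast
  let ?W = "wavelet_level d A s"
  \<comment> \<open>Smaller now are the elements with a smaller current digit, and those of the old
    \<open>B\<close> that tie on it.\<close>
  let ?B = "sort_key (d s) (filter (\<lambda>a. d s a < x s) ?W) @ filter (\<lambda>a. d s a = x s) B"
  have 1: "mset ?B = mset (filter (digits_below d x (Suc s)) A)"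
    by (rule multiset_eqI) (simp add: B(1))
  have same: "filter (\<lambda>a. d s a = x s) (filter (digits_same d x s) ys) = filter (digits_same d x (Suc s)) ys" for ys
    by (auto simp: digits_same_def less_Suc_eq intro!: filter_cong)
  have 2: "take (walk d A x (Suc s) i) (wavelet_level d A (Suc s)) = ?B @ filter (digits_same d x (Suc s)) (take i A)"
    "walk d A x (Suc s) i = length ?B + length (filter (digits_same d x (Suc s)) (take i A))"
    if "i \<le> length A" for i
  proof -
    show "take (walk d A x (Suc s) i) (wavelet_level d A (Suc s)) = ?B @ filter (digits_same d x (Suc s)) (take i A)"
      unfolding walk.simps wavelet_level.simps take_rank_step B(2)[OF that] filter_append same by simp
    show "walk d A x (Suc s) i = length ?B + length (filter (digits_same d x (Suc s)) (take i A))"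
      unfolding walk.simps rank_step_def B(2)[OF that] filter_append same by simp
  qed
  from 1 2 show ?case by blast
qed

lemma walk_eq:
  assumes "i \<le> length A"
  shows "walk d A x s i = length (filter (digits_below d x s) A) + length (filter (digits_same d x s) (take i A))"
proof -
  obtain B where "mset B = mset (filter (digits_below d x s) A)" "walk d A x s i = length B + length (filter (digits_same d x s) (take i A))"
    using walk_structure[of d x s A] assms by blast
  then show ?thesis by (metis size_mset)
qed

lemma filter_take_le: "i \<le> j \<Longrightarrow> filter P (take j A) = filter P (take i A) @ filter P (drop i (take j A))"
  by (metis append_take_drop_id filter_append min.absorb1 take_take)

lemma walk_mono: "i \<le> j \<Longrightarrow> j \<le> length A \<Longrightarrow> walk d A x s i \<le> walk d A x s j"
  by (simp add: walk_eq filter_take_le[of i j])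

lemma walk_diff:
  assumes "i \<le> j" "j \<le> length A"
  shows "walk d A x s j - walk d A x s i = length (filter (digits_same d x s) (drop i (take j A)))"
  using assms by (simp add: walk_eq filter_take_le[OF assms(1)])

lemma digits_disjoint: "digits_below d x s a \<Longrightarrow> \<not> digits_same d x s a"
  by (induction s) (auto simp: digits_same_def less_Suc_eq)

lemma walk_le: "i \<le> length A \<Longrightarrow> walk d A x s i \<le> length A"
proof -
  assume i: "i \<le> length A"
  have "length (filter (digits_same d x s) (take i A)) \<le> length (filter (digits_same d x s) A)"
    by (metis take_filter_take length_take min.cobounded1)
  also have "\<dots> \<le> length (filter (\<lambda>a. \<not> digits_below d x s a) A)"
    using digits_disjoint[of d x s] by (induction A) auto
  finally show ?thesis
    using sum_length_filter_compl[of "digits_below d x s" A] by (simp add: walk_eq i)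
qed

text \<open>For comparison with a threshold: among the elements that agree with it so far, those
  with a smaller next digit can be counted before stepping on.\<close>

lemma walk_less_diff:
  assumes "i \<le> j" "j \<le> length A"
  shows "length (filter (\<lambda>a. d s a < y) (take (walk d A x s j) (wavelet_level d A s)))
       - length (filter (\<lambda>a. d s a < y) (take (walk d A x s i) (wavelet_level d A s)))
       = length (filter (\<lambda>a. digits_same d x s a \<and> d s a < y) (drop i (take j A)))"
proof -
  obtain B where B: "\<And>i. i \<le> length A \<Longrightarrow> take (walk d A x s i) (wavelet_level d A s) = B @ filter (digits_same d x s) (take i A)"
    using walk_structure[of d x s A] by blast
  show ?thesis using assms by (simp add: B filter_take_le[OF assms(1)] conj_commute)
qed

text \<open>Columns beyond the end of \<open>A\<close> carry the digit \<open>b\<close>, which is never below a query digit.\<close>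

definition level_row :: "nat \<Rightarrow> (nat \<Rightarrow> 'a \<Rightarrow> nat) \<Rightarrow> 'a list \<Rightarrow> nat \<Rightarrow> nat \<Rightarrow> nat" where
  "level_row b d A s p = (if p < length A then d s (wavelet_level d A s ! p) else b)"

definition count_less :: "(nat \<Rightarrow> nat) \<Rightarrow> nat \<Rightarrow> nat \<Rightarrow> nat" where
  "count_less r i x = card {p. p < i \<and> r p < x}"

lemma count_less_le: "count_less r i x \<le> i"
  unfolding count_less_def by (rule order_trans[OF card_mono[of "{..<i}"]]) auto

lemma count_less_mono: "x \<le> y \<Longrightarrow> count_less r i x \<le> count_less r i y"
  unfolding count_less_def by (intro card_mono) auto

lemma count_less_level_row:
  assumes "x \<le> b"
  shows "count_less (level_row b d A s) i x = length (filter (\<lambda>a. d s a < x) (take i (wavelet_level d A s)))"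
  unfolding count_less_def length_filter_conv_card
  by (rule arg_cong[where f = card]) (use assms in \<open>auto simp: level_row_def split: if_splits\<close>)

lemma length_filter_less_Suc:
  "length (filter (\<lambda>a. f a < Suc x) A) = length (filter (\<lambda>a. f a < x) A) + length (filter (\<lambda>a. f a = x) A)"
  for f :: "'a \<Rightarrow> nat"
  by (induction A) auto

text \<open>Equal digits are counted as a difference of two strict counts. Since
  \<open>x + 1 \<le> b\<close>, the padding digit \<open>b\<close> enters none of the three
  counts.\<close>

lemma rank_step_count_less:
  assumes "x < b" "length A \<le> n"
  shows "rank_step (d s) (wavelet_level d A s) i x = count_less (level_row b d A s) n x +
    (count_less (level_row b d A s) i (x + 1) - count_less (level_row b d A s) i x)"
  using assms by (simp add: count_less_level_row rank_step_def length_filter_less_Suc)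

text \<open>Base \<open>b\<close>, least significant digit first. Values from \<open>b ^ K\<close>
  on act as a sentinel, all of whose digits are the extra digit \<open>b\<close>.\<close>

definition digit :: "nat \<Rightarrow> nat \<Rightarrow> nat \<Rightarrow> nat \<Rightarrow> nat" where
  "digit b K s v = (if v < b ^ K then (v div b ^ s) mod b else b)"

lemma mod_power_Suc: "v mod b ^ Suc s = b ^ s * (v div b ^ s mod b) + v mod b ^ s" for v :: nat
  using mod_mult2_eq[of v "b ^ s" b] by (simp add: mult.commute)

lemma digit_less: "v < b ^ K \<Longrightarrow> 0 < b \<Longrightarrow> digit b K s v < b"
  by (simp add: digit_def)

lemma digit_le: "0 < b \<Longrightarrow> digit b K s v \<le> b"
  by (simp add: digit_def less_imp_le)

lemma lex_pair_nat: 
  fixes q r q' r' b :: nat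
  assumes "r < b" "r' < b"
  shows "b * q + r < b * q' + r' \<longleftrightarrow> q < q' \<or> q = q' \<and> r < r'" "b * q + r = b * q' + r' \<longleftrightarrow> q = q' \<and> r = r'"
proof -
  have *: "b * q + r < b * q' + r'" if "q < q'" "r < b" for q q' r r' :: nat
  proof -
    have "b * q + r < b * Suc q" using that by simp
    also have "\<dots> \<le> b * q'" using that by (intro mult_le_mono2) auto
    finally show ?thesis by simp
  qed
  show "b * q + r < b * q' + r' \<longleftrightarrow> q < q' \<or> q = q' \<and> r < r'"
    using *[of q q' r r'] *[of q' q r' r] assms by (cases q q' rule: linorder_cases) auto
  show "b * q + r = b * q' + r' \<longleftrightarrow> q = q' \<and> r = r'"
    using *[of q q' r r'] *[of q' q r' r] assms by (cases q q' rule: linorder_cases) auto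
qed

lemma digits_mod:
  assumes "0 < b" "c < b ^ K" "v < b ^ K"
  shows "(\<forall>u<s. digit b K u v = digit b K u c) \<longleftrightarrow> v mod b ^ s = c mod b ^ s"
proof (induction s)
  case (Suc s)
  have "v mod b ^ Suc s = c mod b ^ Suc s \<longleftrightarrow> v div b ^ s mod b = c div b ^ s mod b \<and> v mod b ^ s = c mod b ^ s"
    unfolding mod_power_Suc using assms(1) by (intro lex_pair_nat(2)) auto
  then show ?case using Suc assms by (auto simp: less_Suc_eq digit_def)
qed simp

text \<open>A sentinel differs from \<open>c\<close> already in digit 0, which exists because
  \<open>0 < K\<close>.\<close>

lemma digits_same_digit:
  assumes "0 < b" "0 < K" "c < b ^ K"
  shows "(\<forall>u<K. digit b K u v = digit b K u c) \<longleftrightarrow> v = c"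
proof (cases "v < b ^ K")
  case True
  then show ?thesis using digits_mod[OF assms(1,3) True, of K] assms by simp
next
  case False
  then have "digit b K 0 v \<noteq> digit b K 0 c" using digit_less[OF assms(3,1), of 0] by (simp add: digit_def)
  then show ?thesis using False assms by auto
qed

text \<open>The digit processed last has the highest weight, so radix order is numerical order; a
  sentinel shows the digit \<open>b\<close> everywhere and is below no \<open>c\<close>.\<close>

lemma digits_below_digit:
  assumes "0 < b" "0 < K" "c < b ^ K"
  shows "digits_below (\<lambda>s a. digit b K s (f a)) (\<lambda>s. digit b K s c) K a \<longleftrightarrow> f a < c"
proof (cases "f a < b ^ K")
  case True
  have "digits_below (\<lambda>s a. digit b K s (f a)) (\<lambda>s. digit b K s c) s a \<longleftrightarrow> f a mod b ^ s < c mod b ^ s" for s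
  proof (induction s)
    case (Suc s)
    have "f a mod b ^ Suc s < c mod b ^ Suc s \<longleftrightarrow>
        f a div b ^ s mod b < c div b ^ s mod b \<or> f a div b ^ s mod b = c div b ^ s mod b \<and> f a mod b ^ s < c mod b ^ s"
      unfolding mod_power_Suc using assms(1) by (intro lex_pair_nat(1)) auto
    then show ?case using Suc assms True by (auto simp: digit_def)
  qed simp
  from this[of K] show ?thesis using True assms by simp
next
  case False
  have "digit b K s (f a) = b" "digit b K s c < b" for s
    using False digit_less[OF assms(3,1)] by (auto simp: digit_def)
  then have "\<not> digits_below (\<lambda>s a. digit b K s (f a)) (\<lambda>s. digit b K s c) s a" for s
    by (induction s) (auto dest: less_asym simp: less_not_refl2)
  then show ?thesis using False assms by auto
qed

text \<open>\<open>K\<close> steps on digits do the work of one LF step on whole characters, which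
  reduces backward search to rank over a small alphabet.\<close>

lemma walk_digits:
  assumes "0 < b" "0 < K" "c < b ^ K" "i \<le> length A"
  shows "walk (\<lambda>s a. digit b K s (f a)) A (\<lambda>s. digit b K s c) K i =
    length (filter (\<lambda>a. f a < c) A) + length (filter (\<lambda>a. f a = c) (take i A))"
proof -
  have same: "digits_same (\<lambda>s a. digit b K s (f a)) (\<lambda>s. digit b K s c) K = (\<lambda>a. f a = c)"
    unfolding digits_same_def by (rule ext) (rule digits_same_digit[OF assms(1-3)])
  have below: "digits_below (\<lambda>s a. digit b K s (f a)) (\<lambda>s. digit b K s c) K = (\<lambda>a. f a < c)"
    by (rule ext) (rule digits_below_digit[OF assms(1-3)])
  show ?thesis unfolding walk_eq[OF assms(4)] same below ..
qed

section \<open>Suffix arrays and the interval of a pattern\<close>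

definition suffix_array :: "nat list \<Rightarrow> nat list" where
  "suffix_array T = sort_key (\<lambda>k. drop k T) [0..<length T]"

definition is_prefix :: "nat list \<Rightarrow> nat list \<Rightarrow> bool" where
  "is_prefix P y \<longleftrightarrow> take (length P) y = P"

text \<open>The suffixes before or among the extensions of \<open>P\<close>. This property is
  downward closed, so it cuts off an initial segment of the suffix array, ending where the suffixes
  that start with \<open>P\<close> end.\<close>

definition not_above :: "nat list \<Rightarrow> nat list \<Rightarrow> bool" where
  "not_above P y \<longleftrightarrow> y < P \<or> is_prefix P y"

definition sa_low :: "nat list \<Rightarrow> nat list \<Rightarrow> nat" where
  "sa_low T P = card {k. k < length T \<and> drop k T < P}"

definition sa_high :: "nat list \<Rightarrow> nat list \<Rightarrow> nat" where
  "sa_high T P = card {k. k < length T \<and> not_above P (drop k T)}"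

lemma is_prefix_Nil [simp]: "is_prefix [] y" "is_prefix (c # P) [] = False"
  by (auto simp: is_prefix_def)

lemma is_prefix_Cons [simp]: "is_prefix (c # P) (a # y) \<longleftrightarrow> a = c \<and> is_prefix P y"
  by (auto simp: is_prefix_def)

lemma not_above_simps [simp]: "not_above P []" "not_above [] y"
  "not_above (c # P) (a # y) \<longleftrightarrow> a < c \<or> a = c \<and> not_above P y"
  by (cases P; auto simp: not_above_def)+

lemma not_above_down: "not_above P z \<Longrightarrow> y \<le> z \<Longrightarrow> not_above P y"
proof (induction P arbitrary: y z)
  case (Cons c P)
  show ?case
  proof (cases y)
    case (Cons a y')
    then obtain a' z' where "z = a' # z'" using Cons.prems(2) by (cases z) auto
    then show ?thesis using Cons.prems Cons.IH[of z' y'] Cons by auto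
  qed simp
qed simp

lemma not_is_prefix_if_less: "y < P \<Longrightarrow> \<not> is_prefix P y"
proof (induction P arbitrary: y)
  case (Cons c P) then show ?case by (cases y) auto
qed simp

lemma sa_low_high: "sa_low T P \<le> sa_high T P" "sa_high T P \<le> length T"
  unfolding sa_low_def sa_high_def
  by (intro card_mono; auto simp: not_above_def)
     (rule order_trans[OF card_mono[of "{..<length T}"]]; auto)

lemma length_suffix_array [simp]: "length (suffix_array T) = length T"
  by (simp add: suffix_array_def)

lemma set_suffix_array [simp]: "set (suffix_array T) = {..<length T}"
  by (auto simp: suffix_array_def)

lemma distinct_suffix_array: "distinct (suffix_array T)"
  by (simp add: suffix_array_def)

lemma take_filter_down_closed:
  assumes "sorted_wrt R xs" "\<And>x y. R x y \<Longrightarrow> P y \<Longrightarrow> P x"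
  shows "take (length (filter P xs)) xs = filter P xs"
  using assms
proof (induction xs)
  case (Cons x xs)
  show ?case
  proof (cases "P x")
    case False
    then have "filter P xs = []" using Cons.prems by (auto simp: filter_empty_conv)
    then show ?thesis using False by simp
  qed (use Cons in auto)
qed simp

lemma card_suffix_array: "card {k. k < length T \<and> P k} = length (filter P (suffix_array T))"
proof -
  have "{k. k < length T \<and> P k} = set (filter P (suffix_array T))" by auto
  then show ?thesis by (simp only: distinct_card distinct_filter distinct_suffix_array)
qed

text \<open>In a sorted list a downward closed property holds on an initial segment, whose length is
  the number of elements with it.\<close>

lemma take_suffix_array:
  assumes "\<And>y z. P z \<Longrightarrow> y \<le> z \<Longrightarrow> P y"
  shows "take (card {k. k < length T \<and> P (drop k T)}) (suffix_array T) = filter (\<lambda>k. P (drop k T)) (suffix_array T)"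
proof -
  have "sorted_wrt (\<lambda>x y. drop x T \<le> drop y T) (suffix_array T)"
    using sorted_sort_key[of "\<lambda>k. drop k T" "[0..<length T]"] unfolding suffix_array_def by (simp add: sorted_wrt_map)
  then show ?thesis unfolding card_suffix_array by (rule take_filter_down_closed) (use assms in blast)
qed

text \<open>The suffix at 0 has no preceding character and gets \<open>z\<close>. In use,
  \<open>z\<close> is the sentinel \<open>b ^ K\<close>, which no pattern character equals.\<close>

definition bwt :: "nat \<Rightarrow> nat list \<Rightarrow> nat \<Rightarrow> nat" where
  "bwt z T j = (if j = 0 then z else T ! (j - 1))"

text \<open>The contribution of the empty suffix, whose preceding character is
  \<open>last T\<close>.\<close>

definition last_adjust :: "nat list \<Rightarrow> nat \<Rightarrow> nat" where
  "last_adjust T c = (if T \<noteq> [] \<and> last T < c then 1 else 0)"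

text \<open>Passes from the suffix at \<open>k\<close> to the one at \<open>j = k + 1\<close>. The
  last \<open>k\<close> leads to the empty suffix, which has no row and becomes the separate
  summand.\<close>

lemma card_shift:
  fixes m :: nat
  assumes "0 < m"
  shows "card {k. k < m \<and> P k} = card {j. j < m \<and> 0 < j \<and> P (j - 1)} + (if P (m - 1) then 1 else 0)"
proof -
  have "{k. k < m \<and> P k} = (\<lambda>j. j - 1) ` {j. j < m \<and> 0 < j \<and> P (j - 1)} \<union> (if P (m - 1) then {m - 1} else {})"
  proof (intro equalityI subsetI)
    fix k assume k: "k \<in> {k. k < m \<and> P k}"
    show "k \<in> (\<lambda>j. j - 1) ` {j. j < m \<and> 0 < j \<and> P (j - 1)} \<union> (if P (m - 1) then {m - 1} else {})"
    proof (cases "k = m - 1")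
      case False
      then have "Suc k \<in> {j. j < m \<and> 0 < j \<and> P (j - 1)}" using k by auto
      then have "k \<in> (\<lambda>j. j - 1) ` {j. j < m \<and> 0 < j \<and> P (j - 1)}" by (rule rev_image_eqI) simp
      then show ?thesis by (rule UnI1)
    qed (use k in auto)
  qed (use assms in \<open>auto split: if_splits\<close>)
  moreover have "inj_on (\<lambda>j. j - 1) {j. j < m \<and> 0 < j \<and> P (j - 1)}" by (auto simp: inj_on_def)
  moreover have "(\<lambda>j. j - 1) ` {j. j < m \<and> 0 < j \<and> P (j - 1)} \<inter> {m - 1} = {}" by auto
  ultimately show ?thesis by (auto simp: card_image card_Un_disjoint)
qed

text \<open>Backward search. The row of the empty suffix is left out, so that row numbers stay at most
  \<open>length T\<close>; \<open>last_adjust\<close> accounts for it.\<close>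

lemma sa_step:
  fixes R :: "nat list \<Rightarrow> bool"
  assumes down: "\<And>y z. R z \<Longrightarrow> y \<le> z \<Longrightarrow> R y" and c: "c < z"
  shows "card {k. k < length T \<and> (T ! k < c \<or> T ! k = c \<and> R (drop (Suc k) T))} =
    length (filter (\<lambda>j. bwt z T j < c) (suffix_array T)) +
    length (filter (\<lambda>j. bwt z T j = c) (take (card {k. k < length T \<and> R (drop k T)}) (suffix_array T))) +
    last_adjust T (if R [] then Suc c else c)"
proof (cases "T = []")
  case False
  then have l: "0 < length T" by simp
  \<comment> \<open>Suffixes are now classified by the character in front of them;
    \<open>c < z\<close> keeps \<open>j = 0\<close> out of both sets on the right.\<close>
  have e: "{j. j < length T \<and> 0 < j \<and> (T ! (j - 1) < c \<or> T ! (j - 1) = c \<and> R (drop (Suc (j - 1)) T))}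
    = {j. j < length T \<and> bwt z T j < c} \<union> {j. j < length T \<and> (bwt z T j = c \<and> R (drop j T))}"
    using c by (auto simp: bwt_def)
  have "card {k. k < length T \<and> (T ! k < c \<or> T ! k = c \<and> R (drop (Suc k) T))} =
    card {j. j < length T \<and> bwt z T j < c} + card {j. j < length T \<and> (bwt z T j = c \<and> R (drop j T))} +
    last_adjust T (if R [] then Suc c else c)"
  proof -
    have "card ({j. j < length T \<and> bwt z T j < c} \<union> {j. j < length T \<and> (bwt z T j = c \<and> R (drop j T))}) =
      card {j. j < length T \<and> bwt z T j < c} + card {j. j < length T \<and> (bwt z T j = c \<and> R (drop j T))}"
      by (rule card_Un_disjoint) auto
    moreover have "(if T ! (length T - 1) < c \<or> T ! (length T - 1) = c \<and> R (drop (Suc (length T - 1)) T) then 1 else 0)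
      = last_adjust T (if R [] then Suc c else c)"
      using False by (auto simp: last_adjust_def last_conv_nth less_Suc_eq)
    ultimately show ?thesis
      using card_shift[OF l, of "\<lambda>k. T ! k < c \<or> T ! k = c \<and> R (drop (Suc k) T)"] unfolding e by linarith
  qed
  then show ?thesis
    using take_suffix_array[of R T, OF down] by (simp add: card_suffix_array conj_commute)
qed (simp_all add: suffix_array_def last_adjust_def)

lemma drop_less_Cons: "k < length T \<Longrightarrow> drop k T = T ! k # drop (Suc k) T"
  by (rule Cons_nth_drop_Suc[symmetric])

text \<open>The empty suffix is below \<open>P\<close> unless \<open>P = []\<close>, so the
  adjustment is taken at \<open>c + 1\<close> except for the first character read. Register 6 of the
  programs records this.\<close>

lemma sa_low_Cons:
  assumes "c < z"
  shows "sa_low T (c # P) = length (filter (\<lambda>j. bwt z T j < c) (suffix_array T)) +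
    length (filter (\<lambda>j. bwt z T j = c) (take (sa_low T P) (suffix_array T))) +
    last_adjust T (c + (if P = [] then 0 else 1))"
proof -
  have *: "sa_low T (c # P) = card {k. k < length T \<and> (T ! k < c \<or> T ! k = c \<and> drop (Suc k) T < P)}"
    unfolding sa_low_def by (rule arg_cong[where f = card]) (auto simp: drop_less_Cons)
  show ?thesis unfolding * using sa_step[of "\<lambda>y. y < P" c z T] assms
    by (cases P) (auto simp: sa_low_def)
qed

text \<open>The empty suffix is \<open>not_above\<close> every \<open>P\<close>, hence
  \<open>c + 1\<close> in all cases.\<close>

lemma sa_high_Cons:
  assumes "c < z"
  shows "sa_high T (c # P) = length (filter (\<lambda>j. bwt z T j < c) (suffix_array T)) +
    length (filter (\<lambda>j. bwt z T j = c) (take (sa_high T P) (suffix_array T))) +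
    last_adjust T (c + 1)"
proof -
  have *: "sa_high T (c # P) = card {k. k < length T \<and> (T ! k < c \<or> T ! k = c \<and> not_above P (drop (Suc k) T))}"
    unfolding sa_high_def by (rule arg_cong[where f = card]) (auto simp: drop_less_Cons)
  show ?thesis unfolding * using sa_step[of "not_above P" c z T] not_above_down assms
    by (auto simp: sa_high_def)
qed

lemma sa_low_Nil [simp]: "sa_low T [] = 0"
  by (simp add: sa_low_def)

lemma sa_high_Nil [simp]: "sa_high T [] = length T"
  by (simp add: sa_high_def)

text \<open>For \<open>y < length T\<close> this is the inverse permutation of the suffix
  array.\<close>

definition suffix_rank :: "nat list \<Rightarrow> nat \<Rightarrow> nat" where
  "suffix_rank T y = card {k. k < length T \<and> drop k T < drop y T}"

text \<open>An initial segment of the suffix order is a threshold on ranks, so starting with a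
  pattern becomes two numerical comparisons.\<close>

lemma suffix_rank_less:
  assumes down: "\<And>y z. R z \<Longrightarrow> y \<le> z \<Longrightarrow> R y" and y: "y < length T"
  shows "suffix_rank T y < card {k. k < length T \<and> R (drop k T)} \<longleftrightarrow> R (drop y T)"
proof
  assume R: "R (drop y T)"
  have "{k. k < length T \<and> drop k T < drop y T} \<subset> {k. k < length T \<and> R (drop k T)}"
    using R down[OF R] y by (auto simp: less_imp_le)
  then show "suffix_rank T y < card {k. k < length T \<and> R (drop k T)}"
    unfolding suffix_rank_def by (intro psubset_card_mono) auto
next
  assume less: "suffix_rank T y < card {k. k < length T \<and> R (drop k T)}"
  show "R (drop y T)"
  proof (rule ccontr)
    assume "\<not> R (drop y T)"
    then have "drop k T < drop y T" if "R (drop k T)" for k using down[OF that] by (meson not_less)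
    then have "card {k. k < length T \<and> R (drop k T)} \<le> suffix_rank T y"
      unfolding suffix_rank_def by (intro card_mono) auto
    then show False using less by simp
  qed
qed

lemma suffix_rank_high: "y < length T \<Longrightarrow> suffix_rank T y < sa_high T P \<longleftrightarrow> not_above P (drop y T)"
  unfolding sa_high_def by (rule suffix_rank_less) (use not_above_down in auto)

lemma suffix_rank_low: "y < length T \<Longrightarrow> suffix_rank T y < sa_low T P \<longleftrightarrow> drop y T < P"
  unfolding sa_low_def by (rule suffix_rank_less) auto

lemma suffix_rank_le: "suffix_rank T y \<le> length T"
  unfolding suffix_rank_def by (rule order_trans[OF card_mono[of "{..<length T}"]]) auto

text \<open>Both bounds belong to initial segments, so removing the suffixes below \<open>P\<close>
  from those not above it is a \<open>drop\<close>; what remains are the suffixes that start with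
  \<open>P\<close>.\<close>

lemma suffix_array_slice:
  "drop (sa_low T P) (take (sa_high T P) (suffix_array T)) = filter (\<lambda>k. is_prefix P (drop k T)) (suffix_array T)"
proof -
  let ?L = "filter (\<lambda>k. drop k T < P) (suffix_array T)"
  let ?H = "filter (\<lambda>k. not_above P (drop k T)) (suffix_array T)"
  have h: "take (sa_high T P) (suffix_array T) = ?H"
    unfolding sa_high_def by (rule take_suffix_array) (use not_above_down in blast)
  have l: "take (sa_low T P) (suffix_array T) = ?L"
    unfolding sa_low_def by (rule take_suffix_array) auto
  have tl: "take (sa_low T P) ?H = ?L"
    using h l sa_low_high(1)[of T P] by (metis min.absorb1 take_take)
  have D: "?H = ?L @ drop (sa_low T P) ?H" using tl by (metis append_take_drop_id)
  have "filter (\<lambda>k. \<not> drop k T < P) ?H = drop (sa_low T P) ?H"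
  proof -
    have dist: "distinct (?L @ drop (sa_low T P) ?H)" using D distinct_suffix_array distinct_filter by metis
    have "\<forall>k\<in>set (drop (sa_low T P) ?H). \<not> drop k T < P"
    proof
      fix k assume k: "k \<in> set (drop (sa_low T P) ?H)"
      then have "k \<in> set (suffix_array T)" using in_set_dropD by fastforce
      moreover have "k \<notin> set ?L" using dist k by auto
      ultimately show "\<not> drop k T < P" by auto
    qed
    then show ?thesis by (subst D) auto
  qed
  moreover have "filter (\<lambda>k. \<not> drop k T < P) ?H = filter (\<lambda>k. is_prefix P (drop k T)) (suffix_array T)"
    by (auto simp: not_above_def intro!: filter_cong dest: not_is_prefix_if_less)
  ultimately show ?thesis by (simp add: h)
qed

section \<open>Constant-time rank on matrices of small digits\<close>

lemma digit_sum_less: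
  fixes f :: "nat \<Rightarrow> nat"
  assumes "\<And>u. u < m \<Longrightarrow> f u < q"
  shows "(\<Sum>u<m. f u * q ^ u) < q ^ m"
  using assms
proof (induction m)
  case (Suc m)
  have "(\<Sum>u<m. f u * q ^ u) < q ^ m" using Suc by simp
  moreover have "f m * q ^ m + q ^ m \<le> q * q ^ m"
    using Suc.prems[of m] mult_le_mono1[of "Suc (f m)" q "q ^ m"] by simp
  ultimately show ?case by simp
qed simp

lemma digit_sum_nth:
  fixes f :: "nat \<Rightarrow> nat"
  assumes "\<And>u. u < m \<Longrightarrow> f u < q" "x < m"
  shows "(\<Sum>u<m. f u * q ^ u) div q ^ x mod q = f x"
  using assms
proof (induction m arbitrary: x f)
  case (Suc m)
  have q: "0 < q" using Suc.prems(1)[of 0] by simp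
  have e: "(\<Sum>u<Suc m. f u * q ^ u) = f 0 + q * (\<Sum>u<m. f (Suc u) * q ^ u)"
    by (subst sum.lessThan_Suc_shift) (simp add: sum_distrib_left mult_ac)
  show ?case
  proof (cases x)
    case 0
    then show ?thesis unfolding e using Suc.prems(1)[of 0] by simp
  next
    case (Suc y)
    have "(f 0 + q * (\<Sum>u<m. f (Suc u) * q ^ u)) div q ^ x =
        (f 0 + q * (\<Sum>u<m. f (Suc u) * q ^ u)) div q div q ^ y"
      by (simp add: Suc div_mult2_eq)
    also have "\<dots> = (\<Sum>u<m. f (Suc u) * q ^ u) div q ^ y" using q Suc.prems(1)[of 0] by simp
    finally show ?thesis unfolding e using Suc.IH[of "\<lambda>u. f (Suc u)" y] Suc.prems Suc by simp
  qed
qed simp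

lemma count_less_split:
  assumes "j \<le> i"
  shows "count_less r i x = count_less r j x + card {p. p < i - j \<and> r (j + p) < x}"
proof -
  have e: "{p. p < i \<and> r p < x} = {p. p < j \<and> r p < x} \<union> (\<lambda>p. j + p) ` {p. p < i - j \<and> r (j + p) < x}"
  proof (intro equalityI subsetI)
    fix p assume p: "p \<in> {p. p < i \<and> r p < x}"
    show "p \<in> {p. p < j \<and> r p < x} \<union> (\<lambda>p. j + p) ` {p. p < i - j \<and> r (j + p) < x}"
    proof (cases "p < j")
      case False
      then show ?thesis using p by (intro UnI2 rev_image_eqI[of "p - j"]) auto
    qed (use p in auto)
  qed (use assms in auto)
  show ?thesis unfolding count_less_def e
    by (subst card_Un_disjoint) (auto simp: card_image)
qed

lemma card_blocks:
  "card {t. t < o' \<and> t < g * B \<and> P t} = (\<Sum>r<g. card {u. u < B \<and> r * B + u < o' \<and> P (r * B + u)})" for B :: nat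
proof (induction g)
  case (Suc g)
  have e: "{t. t < o' \<and> t < Suc g * B \<and> P t} = {t. t < o' \<and> t < g * B \<and> P t} \<union>
      (\<lambda>u. g * B + u) ` {u. u < B \<and> g * B + u < o' \<and> P (g * B + u)}"
  proof (intro equalityI subsetI)
    fix t assume t: "t \<in> {t. t < o' \<and> t < Suc g * B \<and> P t}"
    show "t \<in> {t. t < o' \<and> t < g * B \<and> P t} \<union> (\<lambda>u. g * B + u) ` {u. u < B \<and> g * B + u < o' \<and> P (g * B + u)}"
    proof (cases "t < g * B")
      case False
      then show ?thesis using t by (intro UnI2 rev_image_eqI[of "t - g * B"]) auto
    qed (use t in auto)
  qed auto
  have "card {t. t < o' \<and> t < Suc g * B \<and> P t} =
     card {t. t < o' \<and> t < g * B \<and> P t} + card ((\<lambda>u. g * B + u) ` {u. u < B \<and> g * B + u < o' \<and> P (g * B + u)})"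
    unfolding e by (rule card_Un_disjoint) auto
  then show ?case using Suc by (simp add: card_image)
qed simp

fun sum_expr :: "nat \<Rightarrow> (nat \<Rightarrow> expr) \<Rightarrow> expr" where
  "sum_expr 0 f = N 0"
| "sum_expr (Suc g) f = Op Add (sum_expr g f) (f g)"

text \<open>A bound on the full sum bounds all partial sums, so no addition wraps around.\<close>

lemma ev_sum_expr:
  "(\<Sum>r<g. ev w D Q s (f r)) < 2 ^ w \<Longrightarrow> ev w D Q s (sum_expr g f) = (\<Sum>r<g. ev w D Q s (f r))"
  by (induction g) auto

lemma expr_below_sum_expr: "(\<And>r. r < g \<Longrightarrow> expr_below k (f r)) \<Longrightarrow> expr_below k (sum_expr g f)"
  by (induction g) auto

abbreviation sc :: "nat \<Rightarrow> expr" where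
  "sc j \<equiv> St 0 (N j)"

text \<open>Scalars (segment 0): 0 tells this index (0) from the table used for small \<open>n\<close> (1), 1 block length,
  2 blocks per level, 3 superblocks per level, 4 blocks per superblock, 5 base of the packed relative
  counts, 6 \<open>n\<close>, 7 \<open>b\<close>, 8 \<open>T\<close>, 9 and 10 text lengths, 11 first level of the character digits, 12 the
  correction \<open>\<delta>\<close> for two empty patterns with a gap. Segments: 1 superblock counts, 2 packed relative
  counts, 3 powers of their base, 4 and 5 digit weights, 6 and 7 \<open>last_adjust\<close>, 8 and 9 translations of
  suffix array positions, from 10 on packed block pieces and then their lookup tables.\<close>

definition less_expr :: "nat \<Rightarrow> expr \<Rightarrow> expr \<Rightarrow> expr \<Rightarrow> expr" where
  "less_expr G l i x =
    (let q = Op Div i (sc 1); a = Op Add (Op Mul l (sc 2)) q in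
     Op Add
       (Op Add
         (St 1 (Op Add (Op Mul (Op Add (Op Mul l (sc 3)) (Op Div q (sc 4))) (sc 4)) x))
         (Op Mod (Op Div (St 2 a) (St 3 x)) (sc 5)))
       (sum_expr G (\<lambda>r. St (10 + G + r)
          (Op Add (Op Mul (Op Add (Op Mul (St (10 + r) a) (sc 1)) (Op Mod i (sc 1))) (sc 4)) x))))"

definition step_expr :: "nat \<Rightarrow> expr \<Rightarrow> expr \<Rightarrow> expr \<Rightarrow> expr" where
  "step_expr G l i x = Op Add (less_expr G l (sc 6) x)
     (Op Sub (less_expr G l i (Op Add x (N 1))) (less_expr G l i x))"

lemma expr_below_less_expr:
  "expr_below k l \<Longrightarrow> expr_below k i \<Longrightarrow> expr_below k x \<Longrightarrow> expr_below k (less_expr G l i x)"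
  by (auto simp: less_expr_def Let_def intro: expr_below_sum_expr)

lemma expr_below_step_expr:
  "expr_below k l \<Longrightarrow> expr_below k i \<Longrightarrow> expr_below k x \<Longrightarrow> expr_below k (step_expr G l i x)"
  by (auto simp: step_expr_def intro: expr_below_less_expr)

text \<open>\<open>b1\<close> plays four roles: number of digit values including the extra digit
  \<open>b\<close>, base of the packed pieces, number of counts per block, and blocks per
  superblock. \<open>H\<close> is the block length, and \<open>q0\<close> exceeds every count within
  a superblock. The levels are \<open>2 * K\<close> for the two transforms, \<open>T\<close> for
  ranks and \<open>K * T\<close> for text characters. The last four inequalities bound table sizes
  and packed words by \<open>n\<close>.\<close>

locale params =
  fixes n w \<sigma> b K T B G :: nat
    and b1 H nb nsb q0 levels :: nat
  assumes n_w: "n < 2 ^ w" and n_big: "16 \<le> n"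
    and b_ge: "2 \<le> b" and K_pos: "0 < K" and T_pos: "0 < T" and B_pos: "0 < B" and G_pos: "0 < G"
    and sigma_b: "\<sigma> \<le> b ^ K" and sigma_n: "\<sigma> < n" and b_K: "b ^ K \<le> n"
    and n_T: "n < b ^ T" and b_T: "b ^ (T - 1) \<le> n"
    and b1_def: "b1 = Suc b" and H_def: "H = G * B" and nb_def: "nb = n div H + 1"
    and nsb_def: "nsb = nb div b1 + 1" and q0_def: "q0 = b1 * H + 1"
    and levels_def: "levels = 2 * K + T + K * T"
    and sup_size: "levels * nsb * b1 \<le> n" and rel_size: "levels * nb \<le> n"
    and pow_size: "q0 ^ b1 \<le> n" and tab_size: "b1 ^ B * H * b1 \<le> n"
begin

lemma H_pos: "0 < H" using B_pos G_pos by (simp add: H_def)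
lemma b1_pos: "0 < b1" by (simp add: b1_def)
lemma nb_pos: "0 < nb" by (simp add: nb_def)
lemma nsb_pos: "0 < nsb" by (simp add: nsb_def)
lemma levels_pos: "0 < levels" using K_pos by (simp add: levels_def)

lemma le_prod: "0 < (y::nat) \<Longrightarrow> x \<le> x * y" "0 < y \<Longrightarrow> x \<le> y * x"
  by (cases y; simp)+

lemma scalars_le: "H \<le> n" "nb \<le> n" "nsb \<le> n" "b1 \<le> n" "q0 \<le> n" "b \<le> n" "levels \<le> n" "T \<le> n" "2 * K + T \<le> n" "K \<le> n"
proof -
  have q1: "q0 \<le> q0 ^ b1" using self_le_power[of q0 b1] b1_pos by (simp add: q0_def)
  then show q: "q0 \<le> n" using pow_size by simp
  show "H \<le> n" using q le_prod(2)[OF b1_pos, of H] unfolding q0_def by linarith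
  show "b1 \<le> n" using q le_prod(1)[OF H_pos, of b1] unfolding q0_def by linarith
  then show "b \<le> n" by (simp add: b1_def)
  show "nb \<le> n" using le_prod(2)[OF levels_pos, of nb] rel_size by linarith
  show "levels \<le> n" using le_prod(1)[OF nb_pos, of levels] rel_size by linarith
  then show "T \<le> n" "2 * K + T \<le> n" "K \<le> n" by (auto simp: levels_def)
  show "nsb \<le> n" using le_prod(2)[OF levels_pos, of nsb] le_prod(1)[OF b1_pos, of "levels * nsb"] sup_size by linarith
qed

end

locale rank_matrix = params +
  fixes M :: "nat \<Rightarrow> nat \<Rightarrow> nat"
  assumes M_le: "M l p \<le> b"
begin

text \<open>Addresses have the form \<open>(l * nsb + superblock) * b1 + x\<close>. The last
  superblock may start beyond \<open>n\<close>; the cap keeps its count a word.\<close>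

definition sup_cell :: "nat \<Rightarrow> nat" where
  "sup_cell a = count_less (M (a div b1 div nsb)) (min n ((a div b1 mod nsb) * (b1 * H))) (a mod b1)"

definition rel_count :: "nat \<Rightarrow> nat \<Rightarrow> nat \<Rightarrow> nat" where
  "rel_count l q x = count_less (M l) (q * H) x - count_less (M l) (q div b1 * (b1 * H)) x"

definition rel_cell :: "nat \<Rightarrow> nat" where
  "rel_cell a = (\<Sum>x<b1. rel_count (a div nb) (a mod nb) x * q0 ^ x)"

definition cont_cell :: "nat \<Rightarrow> nat \<Rightarrow> nat" where
  "cont_cell r a = (\<Sum>u<B. M (a div nb) (a mod nb * H + (r * B + u)) * b1 ^ u)"

text \<open>Addresses have the form \<open>(content * H + offset) * b1 + x\<close>. The offset
  refers to the whole block, and where piece \<open>r\<close> starts in it depends on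
  \<open>r\<close>; hence one table per piece.\<close>

definition tab_cell :: "nat \<Rightarrow> nat \<Rightarrow> nat" where
  "tab_cell r a = card {u. u < B \<and> r * B + u < a div b1 mod H \<and> (a div b1 div H) div b1 ^ u mod b1 < a mod b1}"

definition sup_seg where "sup_seg = map sup_cell [0..<levels * nsb * b1]"
definition rel_seg where "rel_seg = map rel_cell [0..<levels * nb]"
definition pow_seg where "pow_seg = map (\<lambda>x. q0 ^ x) [0..<b1]"
definition cont_seg where "cont_seg r = map (cont_cell r) [0..<levels * nb]"
definition tab_seg where "tab_seg r = map (tab_cell r) [0..<b1 ^ B * H * b1]"

lemma block_start: "q div b1 * (b1 * H) \<le> q * H" "q * H - q div b1 * (b1 * H) < b1 * H"
proof -
  have e: "q * H = q div b1 * (b1 * H) + q mod b1 * H"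
    by (metis add_mult_distrib div_mult_mod_eq mult.assoc)
  then show "q div b1 * (b1 * H) \<le> q * H" by simp
  have "q mod b1 * H < b1 * H" using b1_pos H_pos by simp
  then show "q * H - q div b1 * (b1 * H) < b1 * H" using e by simp
qed

lemma rel_count_eq:
  "count_less (M l) (q * H) x = count_less (M l) (q div b1 * (b1 * H)) x + rel_count l q x"
  "rel_count l q x < q0"
proof -
  have s: "count_less (M l) (q * H) x = count_less (M l) (q div b1 * (b1 * H)) x +
      card {p. p < q * H - q div b1 * (b1 * H) \<and> M l (q div b1 * (b1 * H) + p) < x}"
    by (rule count_less_split[OF block_start(1)])
  have "card {p. p < q * H - q div b1 * (b1 * H) \<and> M l (q div b1 * (b1 * H) + p) < x} \<le> card {..<b1 * H}"
    using block_start(2)[of q] by (intro card_mono) auto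
  then show "count_less (M l) (q * H) x = count_less (M l) (q div b1 * (b1 * H)) x + rel_count l q x"
    "rel_count l q x < q0" using s by (auto simp: rel_count_def q0_def)
qed

lemma sup_seg_words: "set sup_seg \<subseteq> {..<2 ^ w}"
proof -
  have "sup_cell a \<le> n" for a
    unfolding sup_cell_def using count_less_le order_trans min.cobounded1 by blast
  then have "sup_cell a < 2 ^ w" for a using n_w le_less_trans by blast
  then show ?thesis by (auto simp: sup_seg_def)
qed

lemma rel_seg_words: "set rel_seg \<subseteq> {..<2 ^ w}"
proof -
  have "rel_cell a < q0 ^ b1" for a
    unfolding rel_cell_def by (rule digit_sum_less) (rule rel_count_eq(2))
  then have "rel_cell a < 2 ^ w" for a using n_w pow_size by (meson less_le_trans less_trans)
  then show ?thesis by (auto simp: rel_seg_def)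
qed

lemma pow_le: "x \<le> b \<Longrightarrow> q0 ^ x \<le> n"
  using power_increasing[of x b1 q0] pow_size by (simp add: b1_def q0_def)

lemma pow_seg_words: "set pow_seg \<subseteq> {..<2 ^ w}"
proof -
  have "q0 ^ x < 2 ^ w" if "x < b1" for x
    using pow_le[of x] n_w that unfolding b1_def by linarith
  then show ?thesis unfolding pow_seg_def by auto
qed

lemma cont_cell_less: "cont_cell r a < b1 ^ B"
  unfolding cont_cell_def by (rule digit_sum_less) (use M_le in \<open>auto simp: b1_def less_Suc_eq_le\<close>)

lemma b1_B_le: "b1 ^ B \<le> n"
proof -
  have "b1 ^ B \<le> b1 ^ B * H" "b1 ^ B * H \<le> b1 ^ B * H * b1"
    using le_prod(1)[OF H_pos] le_prod(1)[OF b1_pos] by blast+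
  then show ?thesis using tab_size by linarith
qed

lemma cont_seg_words: "set (cont_seg r) \<subseteq> {..<2 ^ w}"
proof -
  have "cont_cell r a < 2 ^ w" for a
    using cont_cell_less[of r a] b1_B_le n_w by linarith
  then show ?thesis by (auto simp: cont_seg_def)
qed

lemma tab_seg_words: "set (tab_seg r) \<subseteq> {..<2 ^ w}"
proof -
  have "B \<le> n" using scalars_le(1) le_prod(2)[OF G_pos, of B] unfolding H_def by linarith
  moreover have "tab_cell r a \<le> card {..<B}" for a unfolding tab_cell_def by (rule card_mono) auto
  ultimately have "tab_cell r a < 2 ^ w" for a using n_w by (metis card_lessThan le_less_trans order_trans)
  then show ?thesis by (auto simp: tab_seg_def)
qed

lemma addr_less: "l < L \<Longrightarrow> q < m \<Longrightarrow> l * m + q < L * m" for l q m L :: nat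
  using mult_le_mono1[of "Suc l" L m] by simp

text \<open>Three-level rank: count before the superblock, count from there to the block, and table
  lookups inside the block, where the offset decides how much of each piece counts.\<close>

lemma count_less_decomp:
  assumes "l < levels" "i \<le> n" "x \<le> b"
  defines "q \<equiv> i div H"
  shows "count_less (M l) i x = sup_cell ((l * nsb + q div b1) * b1 + x) +
     rel_cell (l * nb + q) div q0 ^ x mod q0 +
     (\<Sum>r<G. tab_cell r ((cont_cell r (l * nb + q) * H + i mod H) * b1 + x))"
proof -
  have x: "x < b1" using assms by (simp add: b1_def)
  have q: "q < nb" using assms by (simp add: nb_def less_Suc_eq_le div_le_mono)
  have i: "i = q * H + i mod H" by (simp add: q_def)
  have sq: "q div b1 < nsb" using q by (simp add: nsb_def less_Suc_eq_le div_le_mono)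
  \<comment> \<open>The superblock of \<open>i\<close> starts no later than \<open>i\<close>, so the
    cap in \<open>sup_cell\<close> has no effect.\<close>
  have le: "q div b1 * (b1 * H) \<le> n" using block_start(1)[of q] i assms(2) by linarith
  have 1: "sup_cell ((l * nsb + q div b1) * b1 + x) = count_less (M l) (q div b1 * (b1 * H)) x"
    using x sq le nsb_pos b1_pos by (simp add: sup_cell_def)
  have "rel_cell (l * nb + q) = (\<Sum>x<b1. rel_count l q x * q0 ^ x)"
    using q by (simp add: rel_cell_def)
  then have 2: "rel_cell (l * nb + q) div q0 ^ x mod q0 = rel_count l q x"
    using digit_sum_nth[of b1 "rel_count l q" q0 x] rel_count_eq(2) x by simp
  have 3: "tab_cell r ((cont_cell r (l * nb + q) * H + i mod H) * b1 + x) =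
      card {u. u < B \<and> r * B + u < i mod H \<and> M l (q * H + (r * B + u)) < x}" for r
  proof -
    have c: "cont_cell r (l * nb + q) = (\<Sum>u<B. M l (q * H + (r * B + u)) * b1 ^ u)"
      using q by (simp add: cont_cell_def)
    have "cont_cell r (l * nb + q) div b1 ^ u mod b1 = M l (q * H + (r * B + u))" if "u < B" for u
      unfolding c using digit_sum_nth[of B "\<lambda>u. M l (q * H + (r * B + u))" b1 u] M_le that
      by (simp add: b1_def less_Suc_eq_le)
    then show ?thesis using x H_pos by (auto simp: tab_cell_def intro!: arg_cong[where f = card])
  qed
  \<comment> \<open>The offset is below the block length \<open>G * B\<close>; adding that bound
    brings the set into the form of \<open>card_blocks\<close>.\<close>
  have "card {p. p < i - q * H \<and> M l (q * H + p) < x} = card {t. t < i mod H \<and> t < G * B \<and> M l (q * H + t) < x}"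
  proof -
    have "i - q * H = i mod H" using i by simp
    moreover have "i mod H < G * B" using H_pos mod_less_divisor[of H i] by (simp add: H_def)
    ultimately show ?thesis by (intro arg_cong[where f = card]) auto
  qed
  also have "\<dots> = (\<Sum>r<G. card {u. u < B \<and> r * B + u < i mod H \<and> M l (q * H + (r * B + u)) < x})"
    by (rule card_blocks)
  finally have 4: "card {p. p < i - q * H \<and> M l (q * H + p) < x} =
      (\<Sum>r<G. card {u. u < B \<and> r * B + u < i mod H \<and> M l (q * H + (r * B + u)) < x})" .
  have "count_less (M l) i x = count_less (M l) (q * H) x + card {p. p < i - q * H \<and> M l (q * H + p) < x}"
    by (rule count_less_split) (use i in linarith)
  then show ?thesis unfolding 1 2 3 4 by (simp add: rel_count_eq(1))
qed

end

lemma cell_eq: "k < length D \<Longrightarrow> D ! k = X \<Longrightarrow> a < length X \<Longrightarrow> cell D k a = X ! a"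
  by (auto simp: cell_def)

locale rank_matrix_data = rank_matrix +
  fixes D :: "nat list list" and tx ty \<delta> :: nat
  assumes len_D: "length D = 10 + 2 * G"
    and D_0: "D ! 0 = [0, H, nb, nsb, b1, q0, n, b, T, tx, ty, 2 * K + T, \<delta>]"
    and D_1: "D ! 1 = sup_seg" and D_2: "D ! 2 = rel_seg" and D_3: "D ! 3 = pow_seg"
    and D_cont: "r < G \<Longrightarrow> D ! (10 + r) = cont_seg r"
    and D_tab: "r < G \<Longrightarrow> D ! (10 + G + r) = tab_seg r"
begin

lemma word_const: "j \<le> n \<Longrightarrow> ev w D Q s (N j) = j"
  using n_w by simp

lemma ev_sc:
  "ev w D Q s (sc 0) = 0"
  "ev w D Q s (sc 1) = H" "ev w D Q s (sc 2) = nb" "ev w D Q s (sc 3) = nsb" "ev w D Q s (sc 4) = b1"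
  "ev w D Q s (sc 5) = q0" "ev w D Q s (sc 6) = n" "ev w D Q s (sc 7) = b" "ev w D Q s (sc 8) = T"
  "ev w D Q s (sc 9) = tx" "ev w D Q s (sc 10) = ty" "ev w D Q s (sc 11) = 2 * K + T" "ev w D Q s (sc 12) = \<delta>"
proof -
  have "ev w D Q s (sc j) = D ! 0 ! j" if "j < 13" for j
    using that n_big word_const[of j Q s] len_D D_0 by (simp add: cell_def del: ev.simps(1))
  then show "ev w D Q s (sc 0) = 0"
  "ev w D Q s (sc 1) = H" "ev w D Q s (sc 2) = nb" "ev w D Q s (sc 3) = nsb" "ev w D Q s (sc 4) = b1"
  "ev w D Q s (sc 5) = q0" "ev w D Q s (sc 6) = n" "ev w D Q s (sc 7) = b" "ev w D Q s (sc 8) = T"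
  "ev w D Q s (sc 9) = tx" "ev w D Q s (sc 10) = ty" "ev w D Q s (sc 11) = 2 * K + T" "ev w D Q s (sc 12) = \<delta>"
    by (simp_all add: D_0 del: ev.simps)
qed

lemma ev_Add: "ev w D Q s a + ev w D Q s e \<le> n \<Longrightarrow> ev w D Q s (Op Add a e) = ev w D Q s a + ev w D Q s e"
  using n_w by simp

lemma ev_Add_eq: "ev w D Q s a = x \<Longrightarrow> ev w D Q s e = y \<Longrightarrow> x + y \<le> n \<Longrightarrow> ev w D Q s (Op Add a e) = x + y"
  using n_w by simp

lemma ev_Mul: "ev w D Q s a * ev w D Q s e \<le> n \<Longrightarrow> ev w D Q s (Op Mul a e) = ev w D Q s a * ev w D Q s e"
  using n_w by simp

lemma ev_Sub:
  assumes "ev w D Q s e \<le> ev w D Q s a" "ev w D Q s a < 2 ^ w"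
  shows "ev w D Q s (Op Sub a e) = ev w D Q s a - ev w D Q s e"
proof -
  have "ev w D Q s a + (2 ^ w - ev w D Q s e) = (ev w D Q s a - ev w D Q s e) + 2 ^ w"
    using assms by simp
  then show ?thesis using assms by (simp only: ev.simps arith.simps mod_add_self2) (simp add: mod_less)
qed

text \<open>Evaluation proceeds from the inside out, with a bound by \<open>n\<close> for each
  product and sum, because only such a bound excludes wraparound.\<close>

lemma ev_less_expr:
  assumes l: "ev w D Q s l < levels" and i: "ev w D Q s i \<le> n" and x: "ev w D Q s x \<le> b"
  shows "ev w D Q s (less_expr G l i x) = count_less (M (ev w D Q s l)) (ev w D Q s i) (ev w D Q s x)"
proof -
  define lv iv xv where v: "lv = ev w D Q s l" "iv = ev w D Q s i" "xv = ev w D Q s x"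
  define q where "q = iv div H"
  define a where "a = lv * nb + q"
  have xv: "xv < b1" using x by (simp add: b1_def v)
  have q: "q < nb" using i by (simp add: nb_def less_Suc_eq_le div_le_mono q_def v)
  have sq: "q div b1 < nsb" using q by (simp add: nsb_def less_Suc_eq_le div_le_mono)
  have a: "a < levels * nb" unfolding a_def using l q v by (intro addr_less) auto
  have evq: "ev w D Q s (Op Div i (sc 1)) = q" by (simp only: ev.simps(3) arith.simps ev_sc q_def v)
  have evm: "ev w D Q s (Op Mod i (sc 1)) = iv mod H" by (simp only: ev.simps(3) arith.simps ev_sc v)
  have ma: "lv * nb \<le> n" using a rel_size by (simp add: a_def)
  have "ev w D Q s (Op Mul l (sc 2)) = lv * nb"
    using ev_Mul[of Q s l "sc 2"] ma by (simp only: ev_sc v)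
  then have eva: "ev w D Q s (Op Add (Op Mul l (sc 2)) (Op Div i (sc 1))) = a"
    using ev_Add[of Q s "Op Mul l (sc 2)" "Op Div i (sc 1)"] a rel_size unfolding evq by (simp only: a_def)
  have c: "lv * nsb + q div b1 < levels * nsb" using l sq v by (intro addr_less) auto
  then have d: "(lv * nsb + q div b1) * b1 + xv < levels * nsb * b1" using xv by (rule addr_less)
  have d1: "(lv * nsb + q div b1) * b1 \<le> n" using d sup_size by linarith
  then have d2: "lv * nsb + q div b1 \<le> n" using le_prod(1)[OF b1_pos] order_trans by blast
  have "ev w D Q s (Op Mul l (sc 3)) = lv * nsb"
    using ev_Mul[of Q s l "sc 3"] d2 by (simp only: ev_sc v)
  moreover have "ev w D Q s (Op Div (Op Div i (sc 1)) (sc 4)) = q div b1"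
    by (simp only: ev.simps(3)[of _ _ _ _ _ "Op Div i (sc 1)"] arith.simps ev_sc evq)
  ultimately have "ev w D Q s (Op Add (Op Mul l (sc 3)) (Op Div (Op Div i (sc 1)) (sc 4))) = lv * nsb + q div b1"
    using ev_Add[of Q s "Op Mul l (sc 3)" "Op Div (Op Div i (sc 1)) (sc 4)"] d2 by (simp only:)
  then have "ev w D Q s (Op Mul (Op Add (Op Mul l (sc 3)) (Op Div (Op Div i (sc 1)) (sc 4))) (sc 4)) = (lv * nsb + q div b1) * b1"
    using ev_Mul[of Q s "Op Add (Op Mul l (sc 3)) (Op Div (Op Div i (sc 1)) (sc 4))" "sc 4"] d1 by (simp only: ev_sc)
  then have "ev w D Q s (Op Add (Op Mul (Op Add (Op Mul l (sc 3)) (Op Div (Op Div i (sc 1)) (sc 4))) (sc 4)) x) =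
      (lv * nsb + q div b1) * b1 + xv"
    using ev_Add[of Q s "Op Mul (Op Add (Op Mul l (sc 3)) (Op Div (Op Div i (sc 1)) (sc 4))) (sc 4)" x] d sup_size
    by (simp only: v)
  then have S: "ev w D Q s (St 1 (Op Add (Op Mul (Op Add (Op Mul l (sc 3)) (Op Div (Op Div i (sc 1)) (sc 4))) (sc 4)) x)) =
      sup_cell ((lv * nsb + q div b1) * b1 + xv)"
    using cell_eq[of 1 D sup_seg] len_D D_1 d by (simp add: sup_seg_def del: ev.simps(3))
  have R: "ev w D Q s (Op Mod (Op Div (St 2 (Op Add (Op Mul l (sc 2)) (Op Div i (sc 1)))) (St 3 x)) (sc 5)) =
      rel_cell a div q0 ^ xv mod q0"
  proof -
    have "ev w D Q s (St 2 (Op Add (Op Mul l (sc 2)) (Op Div i (sc 1)))) = rel_cell a"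
      using cell_eq[of 2 D rel_seg a] len_D D_2 a eva by (simp add: rel_seg_def del: ev.simps(3))
    moreover have "ev w D Q s (St 3 x) = q0 ^ xv"
      using cell_eq[of 3 D pow_seg xv] len_D D_3 xv v by (simp add: pow_seg_def)
    ultimately show ?thesis by (simp only: ev.simps(3) arith.simps ev_sc)
  qed
  have Tb: "ev w D Q s (St (10 + G + r) (Op Add (Op Mul (Op Add (Op Mul (St (10 + r) (Op Add (Op Mul l (sc 2)) (Op Div i (sc 1)))) (sc 1))
       (Op Mod i (sc 1))) (sc 4)) x)) = tab_cell r ((cont_cell r a * H + iv mod H) * b1 + xv)" if r: "r < G" for r
  proof -
    let ?a = "Op Add (Op Mul l (sc 2)) (Op Div i (sc 1))"
    have C: "ev w D Q s (St (10 + r) ?a) = cont_cell r a"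
      using cell_eq[of "10 + r" D "cont_seg r" a] len_D D_cont[OF r] r a eva by (simp add: cont_seg_def del: ev.simps(3))
    have e: "cont_cell r a * H + iv mod H < b1 ^ B * H" using H_pos by (intro addr_less cont_cell_less) auto
    then have f: "(cont_cell r a * H + iv mod H) * b1 + xv < b1 ^ B * H * b1" using xv by (rule addr_less)
    have f1: "(cont_cell r a * H + iv mod H) * b1 \<le> n" using f tab_size by linarith
    then have f2: "cont_cell r a * H + iv mod H \<le> n" using le_prod(1)[OF b1_pos] order_trans by blast
    have "ev w D Q s (Op Mul (St (10 + r) ?a) (sc 1)) = cont_cell r a * H"
      using ev_Mul[of Q s "St (10 + r) ?a" "sc 1"] f2 by (simp only: ev_sc C)
    then have "ev w D Q s (Op Add (Op Mul (St (10 + r) ?a) (sc 1)) (Op Mod i (sc 1))) = cont_cell r a * H + iv mod H"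
      using ev_Add[of Q s "Op Mul (St (10 + r) ?a) (sc 1)" "Op Mod i (sc 1)"] f2 by (simp only: evm)
    then have "ev w D Q s (Op Mul (Op Add (Op Mul (St (10 + r) ?a) (sc 1)) (Op Mod i (sc 1))) (sc 4)) = (cont_cell r a * H + iv mod H) * b1"
      using ev_Mul[of Q s "Op Add (Op Mul (St (10 + r) ?a) (sc 1)) (Op Mod i (sc 1))" "sc 4"] f1 by (simp only: ev_sc)
    then have "ev w D Q s (Op Add (Op Mul (Op Add (Op Mul (St (10 + r) ?a) (sc 1)) (Op Mod i (sc 1))) (sc 4)) x) =
        (cont_cell r a * H + iv mod H) * b1 + xv"
      using ev_Add[of Q s "Op Mul (Op Add (Op Mul (St (10 + r) ?a) (sc 1)) (Op Mod i (sc 1))) (sc 4)" x] f tab_size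
      by (simp only: v)
    then show ?thesis
      using cell_eq[of "10 + G + r" D "tab_seg r"] len_D D_tab[OF r] r f by (simp add: tab_seg_def del: ev.simps(3))
  qed
  have dec: "count_less (M lv) iv xv = sup_cell ((lv * nsb + q div b1) * b1 + xv) + rel_cell a div q0 ^ xv mod q0 +
     (\<Sum>r<G. tab_cell r ((cont_cell r a * H + iv mod H) * b1 + xv))"
    unfolding q_def a_def by (rule count_less_decomp) (use l i x v in auto)
  \<comment> \<open>The final count dominates every partial sum of the expression, which makes its
    additions exact.\<close>
  have le: "count_less (M lv) iv xv \<le> n" using count_less_le i v order_trans by blast
  let ?S = "St 1 (Op Add (Op Mul (Op Add (Op Mul l (sc 3)) (Op Div (Op Div i (sc 1)) (sc 4))) (sc 4)) x)"
  let ?R = "Op Mod (Op Div (St 2 (Op Add (Op Mul l (sc 2)) (Op Div i (sc 1)))) (St 3 x)) (sc 5)"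
  let ?T = "\<lambda>r. St (10 + G + r) (Op Add (Op Mul (Op Add (Op Mul (St (10 + r) (Op Add (Op Mul l (sc 2)) (Op Div i (sc 1)))) (sc 1))
       (Op Mod i (sc 1))) (sc 4)) x)"
  have sumT: "(\<Sum>r<G. ev w D Q s (?T r)) = (\<Sum>r<G. tab_cell r ((cont_cell r a * H + iv mod H) * b1 + xv))"
    by (intro sum.cong refl Tb) (simp only: lessThan_iff)
  have evT: "ev w D Q s (sum_expr G ?T) = (\<Sum>r<G. tab_cell r ((cont_cell r a * H + iv mod H) * b1 + xv))"
    unfolding sumT[symmetric] by (rule ev_sum_expr) (unfold sumT, use dec le n_w in linarith)
  have "ev w D Q s (Op Add (Op Add ?S ?R) (sum_expr G ?T)) = count_less (M lv) iv xv"
    unfolding dec by (intro ev_Add_eq S R evT) (use dec le in linarith)+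
  then show ?thesis by (simp only: less_expr_def Let_def v)
qed

lemma ev_step_expr:
  assumes l: "ev w D Q s l < levels" and i: "ev w D Q s i \<le> n" and x: "ev w D Q s x < b"
    and le: "count_less (M (ev w D Q s l)) n (ev w D Q s x) + (count_less (M (ev w D Q s l)) (ev w D Q s i) (ev w D Q s x + 1)
      - count_less (M (ev w D Q s l)) (ev w D Q s i) (ev w D Q s x)) \<le> n"
  shows "ev w D Q s (step_expr G l i x) = count_less (M (ev w D Q s l)) n (ev w D Q s x) +
    (count_less (M (ev w D Q s l)) (ev w D Q s i) (ev w D Q s x + 1)
      - count_less (M (ev w D Q s l)) (ev w D Q s i) (ev w D Q s x))"
proof -
  have x1: "ev w D Q s (Op Add x (N 1)) = ev w D Q s x + 1"
  proof -
    have "ev w D Q s (N 1) = 1" using word_const[of 1] n_big by simp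
    then show ?thesis using ev_Add[of Q s x "N 1"] x scalars_le(6) by linarith
  qed
  have 1: "ev w D Q s (less_expr G l (sc 6) x) = count_less (M (ev w D Q s l)) n (ev w D Q s x)"
    using ev_less_expr[of Q s l "sc 6" x] l x ev_sc by simp
  have 2: "ev w D Q s (less_expr G l i (Op Add x (N 1))) = count_less (M (ev w D Q s l)) (ev w D Q s i) (ev w D Q s x + 1)"
    using ev_less_expr[of Q s l i "Op Add x (N 1)"] l i x unfolding x1 by simp
  have 3: "ev w D Q s (less_expr G l i x) = count_less (M (ev w D Q s l)) (ev w D Q s i) (ev w D Q s x)"
    using ev_less_expr[of Q s l i x] l i x by simp
  have 4: "ev w D Q s (Op Sub (less_expr G l i (Op Add x (N 1))) (less_expr G l i x)) =
    count_less (M (ev w D Q s l)) (ev w D Q s i) (ev w D Q s x + 1) - count_less (M (ev w D Q s l)) (ev w D Q s i) (ev w D Q s x)"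
    using ev_Sub[of Q s "less_expr G l i x" "less_expr G l i (Op Add x (N 1))"]
    unfolding 2 3 using count_less_mono[of "ev w D Q s x" "ev w D Q s x + 1"]
      count_less_le[of "M (ev w D Q s l)" "ev w D Q s i" "ev w D Q s x + 1"] i n_w by simp
  show ?thesis unfolding step_expr_def
    using ev_Add[of Q s "less_expr G l (sc 6) x" "Op Sub (less_expr G l i (Op Add x (N 1))) (less_expr G l i x)"] le
    unfolding 1 4 by simp
qed

end

section \<open>Search and counting programs\<close>

definition lf_digit :: "nat \<Rightarrow> nat \<Rightarrow> nat list \<Rightarrow> nat \<Rightarrow> nat \<Rightarrow> nat" where
  "lf_digit b K X s j = digit b K s (bwt (b ^ K) X j)"

text \<open>Level \<open>l\<close> belongs to digit \<open>l mod K\<close> of the character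
  \<open>l div K\<close> places after \<open>y\<close>. Past the end the sentinel makes every
  comparison with a pattern character fail.\<close>

definition text_digit :: "nat \<Rightarrow> nat \<Rightarrow> nat list \<Rightarrow> nat \<Rightarrow> nat \<Rightarrow> nat" where
  "text_digit b K X l y = digit b K (l mod K) (if y + l div K < length X then X ! (y + l div K) else b ^ K)"

text \<open>A point may be the empty suffix, which has no row; with \<open>length X \<le> n\<close>
  its value \<open>n\<close> is not below any \<open>sa_high\<close>.\<close>

definition point_rank :: "nat \<Rightarrow> nat list \<Rightarrow> nat \<Rightarrow> nat" where
  "point_rank n X y = (if y < length X then suffix_rank X y else n)"

text \<open>Most significant digit first, in contrast to \<open>digit\<close>: comparison with a
  threshold is decided at the first digit that differs.\<close>

definition rank_digit :: "nat \<Rightarrow> nat \<Rightarrow> nat \<Rightarrow> nat list \<Rightarrow> nat \<Rightarrow> nat \<Rightarrow> nat" where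
  "rank_digit b T n X l y = point_rank n X y div b ^ (T - 1 - l) mod b"

text \<open>All digit sequences are rows of one matrix, so that one set of tables and one rank
  expression serve backward search in both texts and both ways of counting points.\<close>

definition index_matrix :: "nat \<Rightarrow> nat \<Rightarrow> nat \<Rightarrow> nat \<Rightarrow> nat list \<Rightarrow> nat list \<Rightarrow> nat list \<Rightarrow> nat \<Rightarrow> nat \<Rightarrow> nat" where
  "index_matrix b K T n X Y pts l =
    (if l < K then level_row b (lf_digit b K X) (suffix_array X) l
     else if l < 2 * K then level_row b (lf_digit b K Y) (suffix_array Y) (l - K)
     else if l < 2 * K + T then level_row b (rank_digit b T n Y) pts (l - 2 * K)
     else level_row b (text_digit b K Y) pts (l - (2 * K + T)))"

lemma index_matrix_le: "0 < b \<Longrightarrow> index_matrix b K T n X Y pts l p \<le> b"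
  by (auto simp: index_matrix_def level_row_def lf_digit_def text_digit_def rank_digit_def digit_le less_imp_le)

definition inc :: "nat \<Rightarrow> com" where
  "inc r = Set r (Op Add (V r) (N 1))"

text \<open>Registers: 3 loop counter, 4 digit counter, 5 character, 6 flag (some character has been read),
  7--10 suffix array intervals, 11--12 interval of points, 13--14 rank counts, 15 digit,
  16--17 interval at the current level, 18 level.\<close>

definition char_com :: "nat \<Rightarrow> nat \<Rightarrow> nat \<Rightarrow> nat \<Rightarrow> com" where
  "char_com G K r1 r2 =
    Set 4 (N 0) ;;
    While (V 4) (N K)
     (Set 15 (Op Mod (Op Div (V 5) (St 4 (V 4))) (sc 7)) ;;
      Set r1 (step_expr G (Op Add (V 18) (V 4)) (V r1) (V 15)) ;;
      Set r2 (step_expr G (Op Add (V 18) (V 4)) (V r2) (V 15)) ;;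
      inc 4)"

text \<open>\<open>base\<close> is the first level of the transform searched, \<open>adj\<close> the
  segment with its adjustments, \<open>m\<close> the register with the pattern length. The reading
  order is left to \<open>idx\<close>, because a pattern is read forwards when searched in a
  reversed text.\<close>

definition search_com :: "nat \<Rightarrow> nat \<Rightarrow> nat \<Rightarrow> nat \<Rightarrow> nat \<Rightarrow> nat \<Rightarrow> expr \<Rightarrow> nat \<Rightarrow> nat \<Rightarrow> nat \<Rightarrow> com" where
  "search_com G K base q adj m idx len lo hi =
    Set 18 (N base) ;; Set 3 (N 0) ;; Set 6 (N 0) ;; Set lo (N 0) ;; Set hi (sc len) ;;
    While (V 3) (V m)
     (Set 5 (Qu q idx) ;;
      char_com G K lo hi ;;
      Set lo (Op Add (V lo) (St adj (Op Add (V 5) (V 6)))) ;;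
      Set hi (Op Add (V hi) (St adj (Op Add (V 5) (N 1)))) ;;
      Set 6 (N 1) ;; inc 3)"

definition short_com :: "nat \<Rightarrow> nat \<Rightarrow> nat \<Rightarrow> nat \<Rightarrow> com" where
  "short_com G K q m =
    Set 3 (N 0) ;;
    While (V 3) (V m)
     (Set 5 (Qu q (V 3)) ;;
      Set 18 (Op Add (sc 11) (Op Mul (N K) (V 3))) ;;
      char_com G K 11 12 ;; inc 3) ;;
    Set 0 (Op Sub (V 12) (V 11))"

text \<open>Works on copies 16 and 17 of the point interval, since it is run twice, once for each
  end of the suffix array interval.\<close>

definition rank_com :: "nat \<Rightarrow> nat \<Rightarrow> nat \<Rightarrow> nat \<Rightarrow> com" where
  "rank_com G K z acc =
    Set 16 (V 11) ;; Set 17 (V 12) ;; Set acc (N 0) ;; Set 3 (N 0) ;;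
    While (V 3) (sc 8)
     (Set 15 (Op Mod (Op Div (V z) (St 5 (V 3))) (sc 7)) ;;
      Set 18 (Op Add (N (2 * K)) (V 3)) ;;
      Set acc (Op Add (V acc) (Op Sub (less_expr G (V 18) (V 17) (V 15)) (less_expr G (V 18) (V 16) (V 15)))) ;;
      Set 16 (step_expr G (V 18) (V 16) (V 15)) ;;
      Set 17 (step_expr G (V 18) (V 17) (V 15)) ;; inc 3)"

definition count_com :: "nat \<Rightarrow> nat \<Rightarrow> nat \<Rightarrow> nat \<Rightarrow> com" where
  "count_com G K q m =
    If (V m) (sc 8) (short_com G K q m)
      (rank_com G K 9 13 ;; rank_com G K 10 14 ;; Set 0 (Op Sub (V 14) (V 13)))"

abbreviation same_outside :: "nat set \<Rightarrow> (nat \<Rightarrow> nat) \<Rightarrow> (nat \<Rightarrow> nat) \<Rightarrow> bool" where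
  "same_outside X s0 s \<equiv> \<forall>r. r \<notin> X \<longrightarrow> s r = s0 r"

text \<open>\<open>X\<close> is searched for the first pattern and \<open>Y\<close> for the last
  one; points are suffix positions of \<open>Y\<close>. \<open>vm\<close> turns interval ends into
  point indices, and \<open>wv\<close> serves the gap problem with an empty first pattern.\<close>

locale index = rank_matrix_data n w \<sigma> b K T B G b1 H nb nsb q0 levels "index_matrix b K T n X Y pts" D "length X" "length Y" \<delta>
  for n w \<sigma> b K T B G b1 H nb nsb q0 levels X Y pts D \<delta> +
  fixes vm wv :: "nat list"
  assumes X_chars: "X \<in> lists {..<\<sigma>}" and Y_chars: "Y \<in> lists {..<\<sigma>}"
    and X_len: "length X \<le> n" and Y_len: "length Y \<le> n"
    and pts_len: "length pts \<le> n" and pts_le: "\<And>y. y \<in> set pts \<Longrightarrow> y \<le> length Y"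
    and D_4: "D ! 4 = map (\<lambda>s. b ^ s) [0..<K]"
    and D_5: "D ! 5 = map (\<lambda>t. b ^ (T - 1 - t)) [0..<T]"
    and D_6: "D ! 6 = map (last_adjust X) [0..<Suc \<sigma>]"
    and D_7: "D ! 7 = map (last_adjust Y) [0..<Suc \<sigma>]"
    and D_8: "D ! 8 = vm" and D_9: "D ! 9 = wv"
begin

abbreviation "M \<equiv> index_matrix b K T n X Y pts"

lemma b_pos: "0 < b" using b_ge by simp

lemma ev_step_walk:
  assumes "ev w D Q s l = lv" "lv < levels" "M lv = level_row b d A k" "length A \<le> n"
    and "ev w D Q s x = xx k" "xx k < b" "ev w D Q s i = walk d A xx k i0" "i0 \<le> length A"
  shows "ev w D Q s (step_expr G l i x) = walk d A xx (Suc k) i0"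
proof -
  have e: "walk d A xx (Suc k) i0 = count_less (M lv) n (xx k) + (count_less (M lv) (walk d A xx k i0) (xx k + 1)
      - count_less (M lv) (walk d A xx k i0) (xx k))"
    unfolding assms(3) using rank_step_count_less[OF assms(6,4)] by simp
  have "walk d A xx (Suc k) i0 \<le> n" "walk d A xx k i0 \<le> n"
    using walk_le[OF assms(8)] assms(4) order_trans by blast+
  then show ?thesis using ev_step_expr[of Q s l i x] assms(1,2,5,6,7) e by simp
qed

lemma ev_less_walk:
  assumes "ev w D Q s l = lv" "lv < levels" "M lv = level_row b d A k" "length A \<le> n"
    and "ev w D Q s x = y" "y < b" "ev w D Q s i = walk d A xx k i0" "i0 \<le> length A"
  shows "ev w D Q s (less_expr G l i x) = length (filter (\<lambda>a. d k a < y) (take (walk d A xx k i0) (wavelet_level d A k)))"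
proof -
  have "walk d A xx k i0 \<le> n" using walk_le[OF assms(8)] assms(4) order_trans by blast
  then have "ev w D Q s (less_expr G l i x) = count_less (M lv) (walk d A xx k i0) y"
    using ev_less_expr[of Q s l i x] assms by simp
  then show ?thesis unfolding assms(3) using count_less_level_row[of y b d A k] assms(6) by simp
qed

lemma ev_Add_lt: "ev w D Q s a = x \<Longrightarrow> ev w D Q s e = y \<Longrightarrow> x + y < 2 ^ w \<Longrightarrow> ev w D Q s (Op Add a e) = x + y"
  by simp

lemma ev_N1: "ev w D Q s (N 1) = 1"
  using word_const[of 1] n_big by simp

lemma ev_N0: "ev w D Q s (N 0) = 0"
  by simp

lemma ev_N_K: "ev w D Q s (N K) = K"
  using word_const scalars_le by simp

lemma hoare_inc:
  assumes "\<And>s. P s \<Longrightarrow> s r + 1 < 2 ^ w \<and> R (s(r := s r + 1))"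
  shows "hoare w D Q P (inc r) t R"
  unfolding inc_def
proof (rule hoare_Set)
  fix s assume "P s"
  then have "ev w D Q s (Op Add (V r) (N 1)) = s r + 1" using assms ev_N1
    by (intro ev_Add_lt) auto
  then show "R (s(r := ev w D Q s (Op Add (V r) (N 1))))" using assms \<open>P s\<close> by simp
qed

lemma ev_digit:
  assumes "s 5 = c" "c < b ^ K" "s 4 = k" "k < K"
  shows "ev w D Q s (Op Mod (Op Div (V 5) (St 4 (V 4))) (sc 7)) = digit b K k c"
proof -
  have "cell D 4 k = b ^ k" using cell_eq[of 4 D _ k] D_4 len_D assms by simp
  then show ?thesis using assms by (simp add: digit_def ev_sc del: ev.simps(4)) (simp add: assms(1,3))
qed

text \<open>The offset \<open>l0\<close> is 0 in backward search, where every character starts a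
  fresh walk on the transform, and \<open>K * t\<close> in the text walk, which continues from
  character to character.\<close>

lemma char_com_correct:
  assumes lev: "\<And>k. k < K \<Longrightarrow> M (base + k) = level_row b d A (l0 + k)" "base + K \<le> levels"
    and A: "length A \<le> n" "i \<le> length A" "j \<le> length A"
    and x: "\<And>k. k < K \<Longrightarrow> xx (l0 + k) = digit b K k c" "c < b ^ K"
    and r: "r1 \<noteq> r2" "r1 \<notin> {4, 5, 15, 18}" "r2 \<notin> {4, 5, 15, 18}"
    and s0: "s0 5 = c" "s0 18 = base"
  shows "hoare w D Q (\<lambda>s. s r1 = walk d A xx l0 i \<and> s r2 = walk d A xx l0 j \<and> same_outside {4, 15, r1, r2} s0 s)
     (char_com G K r1 r2) K
     (\<lambda>s. s r1 = walk d A xx (l0 + K) i \<and> s r2 = walk d A xx (l0 + K) j \<and> same_outside {4, 15, r1, r2} s0 s)"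
proof -
  define I where "I k s \<longleftrightarrow> s 4 = k \<and> s r1 = walk d A xx (l0 + k) i \<and> s r2 = walk d A xx (l0 + k) j \<and>
    same_outside {4, 15, r1, r2} s0 s" for k and s :: "nat \<Rightarrow> nat"
  have body: "hoare w D Q (I k) (Set 15 (Op Mod (Op Div (V 5) (St 4 (V 4))) (sc 7)) ;;
      Set r1 (step_expr G (Op Add (V 18) (V 4)) (V r1) (V 15)) ;;
      Set r2 (step_expr G (Op Add (V 18) (V 4)) (V r2) (V 15)) ;; inc 4) 0 (I (Suc k))" if k: "k < K" for k
  proof -
    define R1 where "R1 s \<longleftrightarrow> I k s \<and> s 15 = xx (l0 + k)" for s
    define R2 where "R2 s \<longleftrightarrow> s 4 = k \<and> s 15 = xx (l0 + k) \<and> s r1 = walk d A xx (Suc (l0 + k)) i \<and> s r2 = walk d A xx (l0 + k) j \<and>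
      same_outside {4, 15, r1, r2} s0 s" for s :: "nat \<Rightarrow> nat"
    define R3 where "R3 s \<longleftrightarrow> s 4 = k \<and> s r1 = walk d A xx (Suc (l0 + k)) i \<and> s r2 = walk d A xx (Suc (l0 + k)) j \<and>
      same_outside {4, 15, r1, r2} s0 s" for s :: "nat \<Rightarrow> nat"
    have xb: "xx (l0 + k) < b" using x k digit_less[OF x(2) b_pos] by simp
    have lv: "ev w D Q s (Op Add (V 18) (V 4)) = base + k" if "s 4 = k" "same_outside {4, 15, r1, r2} s0 s" for s
    proof -
      have "s 18 = base" using that(2) r s0(2) by auto
      then show ?thesis using that(1) lev(2) k scalars_le(7) by (intro ev_Add_eq) auto
    qed
    have lvl: "base + k < levels" using lev(2) k by simp
    have 1: "R1 (s(15 := ev w D Q s (Op Mod (Op Div (V 5) (St 4 (V 4))) (sc 7))))" if "I k s" for s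
    proof -
      have "ev w D Q s (Op Mod (Op Div (V 5) (St 4 (V 4))) (sc 7)) = xx (l0 + k)"
        unfolding x(1)[OF k] by (rule ev_digit) (use that r s0 x(2) k in \<open>auto simp: I_def\<close>)
      then show ?thesis using that r by (auto simp: R1_def I_def simp del: ev.simps)
    qed
    have 2: "R2 (s(r1 := ev w D Q s (step_expr G (Op Add (V 18) (V 4)) (V r1) (V 15))))" if "R1 s" for s
    proof -
      have "ev w D Q s (step_expr G (Op Add (V 18) (V 4)) (V r1) (V 15)) = walk d A xx (Suc (l0 + k)) i"
        by (rule ev_step_walk[where xx = xx, OF lv lvl lev(1)[OF k] A(1) _ xb _ A(2)]) (use that in \<open>auto simp: R1_def I_def\<close>)
      then show ?thesis using that r by (auto simp: R1_def R2_def I_def simp del: ev.simps walk.simps)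
    qed
    have 3: "R3 (s(r2 := ev w D Q s (step_expr G (Op Add (V 18) (V 4)) (V r2) (V 15))))" if "R2 s" for s
    proof -
      have "ev w D Q s (step_expr G (Op Add (V 18) (V 4)) (V r2) (V 15)) = walk d A xx (Suc (l0 + k)) j"
        by (rule ev_step_walk[where xx = xx, OF lv lvl lev(1)[OF k] A(1) _ xb _ A(3)]) (use that in \<open>auto simp: R2_def\<close>)
      then show ?thesis using that r by (auto simp: R2_def R3_def simp del: ev.simps walk.simps)
    qed
    have 4: "hoare w D Q R3 (inc 4) 0 (I (Suc k))"
      by (rule hoare_inc) (use k scalars_le(10) n_w r in \<open>auto simp: R3_def I_def simp del: walk.simps\<close>)
    show ?thesis
      by (rule hoare_Set_Seq[where R = R1, OF hoare_Set_Seq[where R = R2, OF hoare_Set_Seq[where R = R3, OF 4]]])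
        (use 1 2 3 in blast)+
  qed
  have "hoare w D Q (I 0) (While (V 4) (N K) (Set 15 (Op Mod (Op Div (V 5) (St 4 (V 4))) (sc 7)) ;;
      Set r1 (step_expr G (Op Add (V 18) (V 4)) (V r1) (V 15)) ;;
      Set r2 (step_expr G (Op Add (V 18) (V 4)) (V r2) (V 15)) ;; inc 4)) K (I K)"
    by (rule hoare_While[where I = I, OF body]) (auto simp: I_def ev_N_K simp del: ev.simps(1))
  then have "hoare w D Q (\<lambda>s. s r1 = walk d A xx l0 i \<and> s r2 = walk d A xx l0 j \<and> same_outside {4, 15, r1, r2} s0 s)
     (char_com G K r1 r2) K (I K)"
    unfolding char_com_def by (rule hoare_Set_Seq) (use r in \<open>auto simp: I_def\<close>)
  then show ?thesis by (rule hoare_conseq) (auto simp: I_def)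
qed

text \<open>Each step prepends the character read, so reading \<open>R\<close> searches for
  \<open>rev R\<close>: reading backwards finds the pattern itself, reading forwards finds its
  reversal.\<close>

lemma search_com_correct:
  fixes Z R :: "nat list"
  assumes lev: "\<And>k. k < K \<Longrightarrow> M (base + k) = level_row b (lf_digit b K Z) (suffix_array Z) k" "base + K \<le> levels"
    and Z: "length Z \<le> n" and len: "\<And>s. ev w D Q s (sc len) = length Z"
    and adj: "\<And>c. c \<le> \<sigma> \<Longrightarrow> cell D adj c = last_adjust Z c"
    and R: "R \<in> lists {..<\<sigma>}" "length R < 2 ^ w"
    and idx: "\<And>s. s 3 < length R \<Longrightarrow> s m = length R \<Longrightarrow> cell Q q (ev w D Q s idx) = R ! s 3"
    and r: "lo \<noteq> hi" "lo \<notin> {3, 4, 5, 6, 15, 18}" "hi \<notin> {3, 4, 5, 6, 15, 18}"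
      "m \<notin> {3, 4, 5, 6, 15, 18, lo, hi}"
    and s0: "s0 m = length R"
  shows "hoare w D Q (same_outside {3, 4, 5, 6, 15, 18, lo, hi} s0) (search_com G K base q adj m idx len lo hi)
     (length R * Suc K)
     (\<lambda>s. s lo = sa_low Z (rev R) \<and> s hi = sa_high Z (rev R) \<and> s 6 = (if R = [] then 0 else 1) \<and>
        same_outside {3, 4, 5, 6, 15, 18, lo, hi} s0 s)"
proof -
  let ?fr = "same_outside {3, 4, 5, 6, 15, 18, lo, hi} s0"
  define I where "I t s \<longleftrightarrow> s 3 = t \<and> s lo = sa_low Z (rev (take t R)) \<and> s hi = sa_high Z (rev (take t R)) \<and>
    s 6 = (if t = 0 then 0 else 1) \<and> s 18 = base \<and> ?fr s" for t s
  have body: "hoare w D Q (I t) (Set 5 (Qu q idx) ;; char_com G K lo hi ;;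
      Set lo (Op Add (V lo) (St adj (Op Add (V 5) (V 6)))) ;;
      Set hi (Op Add (V hi) (St adj (Op Add (V 5) (N 1)))) ;;
      Set 6 (N 1) ;; inc 3) K (I (Suc t))" if t: "t < length R" for t
  proof -
    define c where "c = R ! t"
    define P where "P = rev (take t R)"
    have Pt: "rev (take (Suc t) R) = c # P" using t by (simp add: c_def P_def take_Suc_conv_app_nth)
    have Pn: "P = [] \<longleftrightarrow> t = 0" using t by (auto simp: P_def)
    have c: "c < \<sigma>" using R(1) t unfolding c_def by (auto simp: lists_eq_set dest: nth_mem)
    have cb: "c < b ^ K" using c sigma_b by simp
    define xx where "xx = (\<lambda>k. digit b K k c)"
    let ?W = "walk (lf_digit b K Z) (suffix_array Z) xx"
    have le: "sa_low Z P \<le> length Z" "sa_high Z P \<le> length Z" using sa_low_high order_trans by blast+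
    have lf: "lf_digit b K Z = (\<lambda>s a. digit b K s (bwt (b ^ K) Z a))" by (intro ext) (simp add: lf_digit_def)
    have low: "?W K (sa_low Z P) + last_adjust Z (c + (if t = 0 then 0 else 1)) = sa_low Z (c # P)"
      unfolding sa_low_Cons[OF cb] xx_def lf using walk_digits[OF b_pos K_pos cb, of "sa_low Z P" "suffix_array Z" "bwt (b ^ K) Z"] le Pn
      by simp
    have high: "?W K (sa_high Z P) + last_adjust Z (c + 1) = sa_high Z (c # P)"
      unfolding sa_high_Cons[OF cb] xx_def lf using walk_digits[OF b_pos K_pos cb, of "sa_high Z P" "suffix_array Z" "bwt (b ^ K) Z"] le
      by simp
    have le': "sa_low Z (c # P) \<le> n" "sa_high Z (c # P) \<le> n" using sa_low_high[of Z "c # P"] Z by auto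
    define R1 where "R1 s \<longleftrightarrow> I t s \<and> s 5 = c" for s
    define J where "J a e f s \<longleftrightarrow> s 3 = t \<and> s lo = a \<and> s hi = e \<and> s 6 = f \<and> s 5 = c \<and> s 18 = base \<and> ?fr s" for a e f s
    have 1: "R1 (s(5 := ev w D Q s (Qu q idx)))" if "I t s" for s
    proof -
      have "s m = length R" using that r s0 by (auto simp: I_def)
      then have "ev w D Q s (Qu q idx) = c" using idx[of s] that t by (auto simp: I_def c_def)
      then show ?thesis using that r by (auto simp: R1_def I_def simp del: ev.simps)
    qed
    have 2: "hoare w D Q R1 (char_com G K lo hi) K
       (J (?W K (sa_low Z P)) (?W K (sa_high Z P)) (if t = 0 then 0 else 1))"
      unfolding hoare_def
    proof (intro allI impI)
      fix s1 assume s1: "R1 s1"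
      have "hoare w D Q (\<lambda>s. s lo = walk (lf_digit b K Z) (suffix_array Z) xx 0 (sa_low Z P) \<and>
          s hi = walk (lf_digit b K Z) (suffix_array Z) xx 0 (sa_high Z P) \<and> same_outside {4, 15, lo, hi} s1 s)
        (char_com G K lo hi) K
        (\<lambda>s. s lo = walk (lf_digit b K Z) (suffix_array Z) xx (0 + K) (sa_low Z P) \<and>
          s hi = walk (lf_digit b K Z) (suffix_array Z) xx (0 + K) (sa_high Z P) \<and> same_outside {4, 15, lo, hi} s1 s)"
        by (rule char_com_correct[where base = base and c = c])
          (use lev Z le cb r s1 in \<open>auto simp: xx_def R1_def I_def\<close>)
      then obtain s' t' where s': "t' \<le> K" "big_step w D Q (char_com G K lo hi) s1 t' s'"
        "s' lo = ?W K (sa_low Z P)" "s' hi = ?W K (sa_high Z P)" "same_outside {4, 15, lo, hi} s1 s'"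
        unfolding hoare_def using s1 by (auto simp: R1_def I_def P_def)
      have "J (?W K (sa_low Z P)) (?W K (sa_high Z P)) (if t = 0 then 0 else 1) s'"
        using s' s1 r by (auto simp: J_def R1_def I_def)
      then show "\<exists>s' t'. t' \<le> K \<and> big_step w D Q (char_com G K lo hi) s1 t' s' \<and>
         J (?W K (sa_low Z P)) (?W K (sa_high Z P)) (if t = 0 then 0 else 1) s'" using s' by blast
    qed
    \<comment> \<open>The flag \<open>f\<close> is 0 for the first character only, as
      \<open>sa_low_Cons\<close> requires.\<close>
    have 3: "J (sa_low Z (c # P)) e f (s(lo := ev w D Q s (Op Add (V lo) (St adj (Op Add (V 5) (V 6))))))"
      if "J (?W K (sa_low Z P)) e f s" "f = (if t = 0 then 0 else 1)" for s e f
    proof -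
      have "ev w D Q s (Op Add (V 5) (V 6)) = c + f"
        by (rule ev_Add_eq) (use that c sigma_n in \<open>auto simp: J_def\<close>)
      then have "ev w D Q s (St adj (Op Add (V 5) (V 6))) = last_adjust Z (c + f)"
        using adj[of "c + f"] that(2) c by (auto simp del: ev.simps(3))
      then have "ev w D Q s (Op Add (V lo) (St adj (Op Add (V 5) (V 6)))) = ?W K (sa_low Z P) + last_adjust Z (c + f)"
        by (intro ev_Add_eq) (use that low le' in \<open>auto simp: J_def\<close>)
      then show ?thesis using that r low by (auto simp: J_def simp del: ev.simps)
    qed
    have 4: "J a (sa_high Z (c # P)) f (s(hi := ev w D Q s (Op Add (V hi) (St adj (Op Add (V 5) (N 1))))))"
      if "J a (?W K (sa_high Z P)) f s" for s a f
    proof -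
      have "ev w D Q s (Op Add (V 5) (N 1)) = c + 1"
        by (rule ev_Add_eq[OF _ ev_N1]) (use that c sigma_n in \<open>auto simp: J_def\<close>)
      then have "ev w D Q s (St adj (Op Add (V 5) (N 1))) = last_adjust Z (c + 1)"
        using adj[of "c + 1"] c by (auto simp del: ev.simps(3))
      then have "ev w D Q s (Op Add (V hi) (St adj (Op Add (V 5) (N 1)))) = ?W K (sa_high Z P) + last_adjust Z (c + 1)"
        by (intro ev_Add_eq) (use that high le' in \<open>auto simp: J_def\<close>)
      then show ?thesis using that r high by (auto simp: J_def simp del: ev.simps)
    qed
    have 5: "J a e 1 (s(6 := ev w D Q s (N 1)))" if "J a e f s" for s a e f
      unfolding ev_N1 using that r by (auto simp: J_def)
    have 6: "hoare w D Q (J (sa_low Z (c # P)) (sa_high Z (c # P)) 1) (inc 3) 0 (I (Suc t))"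
      by (rule hoare_inc) (use t R(2) r Pt in \<open>auto simp: J_def I_def\<close>)
    have 7: "hoare w D Q (J (?W K (sa_low Z P)) (?W K (sa_high Z P)) (if t = 0 then 0 else 1))
       (Set lo (Op Add (V lo) (St adj (Op Add (V 5) (V 6)))) ;;
        Set hi (Op Add (V hi) (St adj (Op Add (V 5) (N 1)))) ;; Set 6 (N 1) ;; inc 3) 0 (I (Suc t))"
      by (rule hoare_Set_Seq[OF hoare_Set_Seq[OF hoare_Set_Seq[OF 6]]]) (erule 3 4 5, (rule refl)?)+
    show ?thesis
      by (rule hoare_Set_Seq[where R = R1, OF hoare_Seq[OF 2 7]]) (use 1 in auto)
  qed
  have W: "hoare w D Q (I 0) (While (V 3) (V m) (Set 5 (Qu q idx) ;; char_com G K lo hi ;;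
      Set lo (Op Add (V lo) (St adj (Op Add (V 5) (V 6)))) ;;
      Set hi (Op Add (V hi) (St adj (Op Add (V 5) (N 1)))) ;;
      Set 6 (N 1) ;; inc 3)) (length R * Suc K) (I (length R))"
    by (rule hoare_While[where I = I, OF body]) (use r s0 in \<open>auto simp: I_def\<close>)
  have b: "ev w D Q s (N base) = base" for s
    using word_const[of base] lev(2) scalars_le(7) by simp
  define S where "S k s \<longleftrightarrow> ?fr s \<and> (k \<ge> 1 \<longrightarrow> s 18 = base) \<and> (k \<ge> 2 \<longrightarrow> s 3 = 0) \<and> (k \<ge> 3 \<longrightarrow> s 6 = 0) \<and> (k \<ge> 4 \<longrightarrow> s lo = 0)" for k :: nat and s
  have "hoare w D Q (S 0) (search_com G K base q adj m idx len lo hi) (length R * Suc K) (I (length R))"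
    unfolding search_com_def
    apply (rule hoare_Set_Seq[where R = "S 1"])
     apply (rule hoare_Set_Seq[where R = "S 2"])
      apply (rule hoare_Set_Seq[where R = "S 3"])
       apply (rule hoare_Set_Seq[where R = "S 4"])
        apply (rule hoare_Set_Seq[OF W])
    unfolding b len ev_N0 using r by (auto simp: S_def I_def)
  then show ?thesis by (rule hoare_conseq) (auto simp: I_def S_def)
qed

end

section \<open>Counting points: text digits for short patterns, rank digits for long ones\<close>

lemma length_filter_disj:
  "(\<And>a. a \<in> set A \<Longrightarrow> \<not> (P a \<and> R a)) \<Longrightarrow>
   length (filter (\<lambda>a. P a \<or> R a) A) = length (filter P A) + length (filter R A)"
  by (induction A) auto

lemma length_filter_take_mono: "i \<le> j \<Longrightarrow> length (filter P (take i A)) \<le> length (filter P (take j A))"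
  using filter_take_le[of i j P A] by simp

lemma hoare_pointwise:
  "(\<And>s0. P s0 \<Longrightarrow> hoare w D Q (\<lambda>s. s = s0) c t R) \<Longrightarrow> hoare w D Q P c t R"
  unfolding hoare_def by blast

lemma div_power_pred:
  fixes v b :: nat
  assumes "t < T"
  shows "v div b ^ (T - 1 - t) = b * (v div b ^ (T - t)) + v div b ^ (T - 1 - t) mod b"
proof -
  have "T - t = Suc (T - 1 - t)" using assms by simp
  then have "v div b ^ (T - t) = v div b ^ (T - 1 - t) div b"
    by (simp add: div_mult2_eq[symmetric] mult.commute)
  then show ?thesis by simp
qed

text \<open>The quotient by \<open>b ^ (T - t)\<close> is the number formed by the top
  \<open>t\<close> digits; the induction starts with both quotients 0.\<close>

lemma top_digits_same:
  fixes v z b :: nat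
  assumes "v < b ^ T" "z < b ^ T" "0 < b" "t \<le> T"
  shows "(\<forall>l<t. v div b ^ (T - 1 - l) mod b = z div b ^ (T - 1 - l) mod b) \<longleftrightarrow> v div b ^ (T - t) = z div b ^ (T - t)"
  using assms(4)
proof (induction t)
  case (Suc t)
  then have t: "t < T" by simp
  have "v div b ^ (T - 1 - t) = z div b ^ (T - 1 - t) \<longleftrightarrow>
      v div b ^ (T - t) = z div b ^ (T - t) \<and> v div b ^ (T - 1 - t) mod b = z div b ^ (T - 1 - t) mod b"
    using lex_pair_nat(2)[of "v div b ^ (T - 1 - t) mod b" b "z div b ^ (T - 1 - t) mod b" "v div b ^ (T - t)" "z div b ^ (T - t)"]
    unfolding div_power_pred[OF t, symmetric] using assms(3) by simp
  then show ?case using Suc by (auto simp: less_Suc_eq)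
qed (use assms in simp)

lemma top_digits_less:
  fixes v z b :: nat
  assumes "0 < b" "t < T"
  shows "v div b ^ (T - Suc t) < z div b ^ (T - Suc t) \<longleftrightarrow> v div b ^ (T - t) < z div b ^ (T - t) \<or>
      v div b ^ (T - t) = z div b ^ (T - t) \<and> v div b ^ (T - 1 - t) mod b < z div b ^ (T - 1 - t) mod b"
  using lex_pair_nat(1)[of "v div b ^ (T - 1 - t) mod b" b "z div b ^ (T - 1 - t) mod b" "v div b ^ (T - t)" "z div b ^ (T - t)"]
  unfolding div_power_pred[OF assms(2), symmetric] using assms(1) by simp

context index
begin

lemma point_rank_less: "point_rank n Y y < b ^ T"
  using n_T suffix_rank_le[of Y y] Y_len by (auto simp: point_rank_def)

lemma M_rank: "t < T \<Longrightarrow> M (2 * K + t) = level_row b (rank_digit b T n Y) pts t"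
  by (auto simp: index_matrix_def)

lemma M_text: "M (2 * K + T + l) = level_row b (text_digit b K Y) pts l"
  by (auto simp: index_matrix_def)

text \<open>Agreement of all digits is agreement of all characters, and as the sentinel equals no
  character of \<open>P\<close>, it also forces the suffix to be long enough.\<close>

lemma text_digits_same:
  assumes "P \<in> lists {..<\<sigma>}"
  shows "digits_same (text_digit b K Y) (\<lambda>l. digit b K (l mod K) (P ! (l div K))) (K * length P) y \<longleftrightarrow> is_prefix P (drop y Y)"
proof -
  let ?ch = "\<lambda>t. if y + t < length Y then Y ! (y + t) else b ^ K"
  have Pb: "P ! t < b ^ K" if "t < length P" for t
    using assms that sigma_b by (fastforce simp: lists_eq_set dest: nth_mem)
  have "digits_same (text_digit b K Y) (\<lambda>l. digit b K (l mod K) (P ! (l div K))) (K * length P) y \<longleftrightarrow>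
      (\<forall>t<length P. \<forall>s<K. digit b K s (?ch t) = digit b K s (P ! t))"
  proof
    assume L: "digits_same (text_digit b K Y) (\<lambda>l. digit b K (l mod K) (P ! (l div K))) (K * length P) y"
    show "\<forall>t<length P. \<forall>s<K. digit b K s (?ch t) = digit b K s (P ! t)"
    proof (intro allI impI)
      fix t s assume ts: "t < length P" "s < K"
      have "t * K + s < length P * K" using ts by (intro addr_less)
      then have "text_digit b K Y (t * K + s) y = digit b K ((t * K + s) mod K) (P ! ((t * K + s) div K))"
        using L unfolding digits_same_def by (simp add: mult.commute)
      moreover have "(t * K + s) div K = t" "(t * K + s) mod K = s" using ts by auto
      ultimately show "digit b K s (?ch t) = digit b K s (P ! t)" by (simp only: text_digit_def)
    qed
  next
    assume R: "\<forall>t<length P. \<forall>s<K. digit b K s (?ch t) = digit b K s (P ! t)"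
    show "digits_same (text_digit b K Y) (\<lambda>l. digit b K (l mod K) (P ! (l div K))) (K * length P) y"
      unfolding digits_same_def
    proof (intro allI impI)
      fix l assume "l < K * length P"
      then have "l div K < length P" "l mod K < K" using K_pos by (auto simp: div_less_iff_less_mult mult.commute)
      then show "text_digit b K Y l y = digit b K (l mod K) (P ! (l div K))" using R by (simp add: text_digit_def)
    qed
  qed
  also have "\<dots> \<longleftrightarrow> (\<forall>t<length P. ?ch t = P ! t)"
    using digits_same_digit[OF b_pos K_pos Pb] by auto
  also have "\<dots> \<longleftrightarrow> (\<forall>t<length P. y + t < length Y \<and> Y ! (y + t) = P ! t)"
    using Pb by (metis less_irrefl)
  also have "\<dots> \<longleftrightarrow> is_prefix P (drop y Y)"
  proof
    assume L: "\<forall>t<length P. y + t < length Y \<and> Y ! (y + t) = P ! t"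
    have "length P \<le> length (drop y Y)"
      using L by (cases P) (auto dest!: spec[of _ "length P - 1"])
    then show "is_prefix P (drop y Y)" unfolding is_prefix_def
      using L by (intro nth_equalityI) auto
  next
    assume R: "is_prefix P (drop y Y)"
    then have len: "length P \<le> length Y - y" unfolding is_prefix_def by (metis length_drop length_take min.cobounded1)
    show "\<forall>t<length P. y + t < length Y \<and> Y ! (y + t) = P ! t"
    proof (intro allI impI)
      fix t assume t: "t < length P"
      then have "P ! t = drop y Y ! t" using R unfolding is_prefix_def by (metis nth_take)
      then show "y + t < length Y \<and> Y ! (y + t) = P ! t" using t len by auto
    qed
  qed
  finally show ?thesis .
qed

text \<open>After the walk down the text levels, the two boundaries enclose as many elements as
  there are matching points, by \<open>walk_diff\<close>.\<close>

lemma short_com_correct: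
  assumes P: "P \<in> lists {..<\<sigma>}" "length P < T"
    and q: "\<And>t. t < length P \<Longrightarrow> cell Q q t = P ! t"
    and m: "m \<notin> {3, 4, 5, 11, 12, 15, 18}"
    and s0: "s0 m = length P" "s0 11 = u" "s0 12 = v" and uv: "u \<le> v" "v \<le> length pts"
  shows "hoare w D Q (\<lambda>s. s = s0) (short_com G K q m) (length P * Suc K)
     (\<lambda>s. s 0 = length (filter (\<lambda>y. is_prefix P (drop y Y)) (drop u (take v pts))))"
proof -
  define xx where "xx = (\<lambda>l. digit b K (l mod K) (P ! (l div K)))"
  let ?W = "walk (text_digit b K Y) pts xx"
  define I where "I t s \<longleftrightarrow> s 3 = t \<and> s 11 = ?W (K * t) u \<and> s 12 = ?W (K * t) v \<and>
    same_outside {3, 4, 5, 11, 12, 15, 18} s0 s" for t and s :: "nat \<Rightarrow> nat"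
  have body: "hoare w D Q (I t) (Set 5 (Qu q (V 3)) ;; Set 18 (Op Add (sc 11) (Op Mul (N K) (V 3))) ;;
      char_com G K 11 12 ;; inc 3) K (I (Suc t))" if t: "t < length P" for t
  proof -
    define c where "c = P ! t"
    have c: "c < b ^ K" using P(1) t sigma_b unfolding c_def by (fastforce simp: lists_eq_set dest: nth_mem)
    define base where "base = 2 * K + T + K * t"
    \<comment> \<open>\<open>t < T\<close> keeps the levels of this character within the
      \<open>K * T\<close> text levels.\<close>
    have "K * t + K \<le> K * T" using t P(2) mult_le_mono2[of "Suc t" T K] by simp
    then have base: "base + K \<le> levels" by (simp add: base_def levels_def)
    define R1 where "R1 s \<longleftrightarrow> I t s \<and> s 5 = c" for s
    define R2 where "R2 s \<longleftrightarrow> I t s \<and> s 5 = c \<and> s 18 = base" for s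
    define R3 where "R3 s \<longleftrightarrow> s 3 = t \<and> s 11 = ?W (K * t + K) u \<and> s 12 = ?W (K * t + K) v \<and>
      same_outside {3, 4, 5, 11, 12, 15, 18} s0 s" for s :: "nat \<Rightarrow> nat"
    have 1: "R1 (s(5 := ev w D Q s (Qu q (V 3))))" if "I t s" for s
      using that q[OF t] by (auto simp: R1_def I_def c_def)
    have 2: "R2 (s(18 := ev w D Q s (Op Add (sc 11) (Op Mul (N K) (V 3)))))" if "R1 s" for s
    proof -
      have "ev w D Q s (Op Mul (N K) (V 3)) = K * t"
        using ev_Mul[of Q s "N K" "V 3"] that base scalars_le(7) unfolding ev_N_K
        by (simp add: R1_def I_def base_def)
      then have "ev w D Q s (Op Add (sc 11) (Op Mul (N K) (V 3))) = base"
        unfolding base_def using base scalars_le(7) by (intro ev_Add_eq ev_sc) (auto simp: base_def)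
      then show ?thesis using that by (auto simp: R1_def R2_def I_def simp del: ev.simps)
    qed
    have 3: "hoare w D Q R2 (char_com G K 11 12) K R3"
    proof (rule hoare_pointwise)
      fix s1 assume s1: "R2 s1"
      have xc: "xx (K * t + k) = digit b K k c" if "k < K" for k
        using that by (simp add: xx_def c_def)
      have lv: "M (base + k) = level_row b (text_digit b K Y) pts (K * t + k)" for k
        using M_text[of "K * t + k"] by (simp add: base_def add.assoc)
      have "hoare w D Q (\<lambda>s. s 11 = ?W (K * t) u \<and> s 12 = ?W (K * t) v \<and> same_outside {4, 15, 11, 12} s1 s)
        (char_com G K 11 12) K
        (\<lambda>s. s 11 = ?W (K * t + K) u \<and> s 12 = ?W (K * t + K) v \<and> same_outside {4, 15, 11, 12} s1 s)"
        by (rule char_com_correct[where base = base and c = c])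
          (use base xc lv c uv pts_len s1 in \<open>auto simp: R2_def\<close>)
      then show "hoare w D Q (\<lambda>s. s = s1) (char_com G K 11 12) K R3"
        by (rule hoare_conseq) (use s1 in \<open>auto simp: R2_def R3_def I_def\<close>)
    qed
    have 4: "hoare w D Q R3 (inc 3) 0 (I (Suc t))"
      by (rule hoare_inc) (use t P(2) scalars_le(8) n_w in \<open>auto simp: R3_def I_def add.commute\<close>)
    show ?thesis
      by (rule hoare_Set_Seq[where R = R1, OF hoare_Set_Seq[where R = R2, OF hoare_Seq[OF 3 4]]])
        (use 1 2 in auto)
  qed
  have W: "hoare w D Q (I 0) (While (V 3) (V m) (Set 5 (Qu q (V 3)) ;; Set 18 (Op Add (sc 11) (Op Mul (N K) (V 3))) ;;
      char_com G K 11 12 ;; inc 3)) (length P * Suc K) (I (length P))"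
    by (rule hoare_While[where I = I, OF body]) (use m s0 in \<open>auto simp: I_def\<close>)
  have fin: "hoare w D Q (I (length P)) (Set 0 (Op Sub (V 12) (V 11))) 0
     (\<lambda>s. s 0 = length (filter (\<lambda>y. is_prefix P (drop y Y)) (drop u (take v pts))))"
  proof (rule hoare_Set)
    fix s assume I: "I (length P) s"
    have "?W (K * length P) u \<le> ?W (K * length P) v" using walk_mono[OF uv] .
    moreover have "?W (K * length P) v < 2 ^ w" using walk_le[OF uv(2)] pts_len n_w by (meson le_less_trans)
    ultimately have "ev w D Q s (Op Sub (V 12) (V 11)) = ?W (K * length P) v - ?W (K * length P) u"
      using ev_Sub[of Q s "V 11" "V 12"] I by (simp add: I_def)
    also have "\<dots> = length (filter (\<lambda>y. is_prefix P (drop y Y)) (drop u (take v pts)))"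
      unfolding walk_diff[OF uv] xx_def using text_digits_same[OF P(1)] by (auto intro!: arg_cong[where f = length] filter_cong)
    finally show "(s(0 := ev w D Q s (Op Sub (V 12) (V 11)))) 0 = length (filter (\<lambda>y. is_prefix P (drop y Y)) (drop u (take v pts)))"
      by simp
  qed
  show ?thesis unfolding short_com_def
    by (rule hoare_Set_Seq[OF hoare_Seq[OF W fin]]) (use s0 in \<open>auto simp: I_def\<close>)
qed

text \<open>After \<open>t\<close> levels the accumulator counts the points whose top
  \<open>t\<close> rank digits are below those of \<open>zv\<close>, and registers 16 and 17 enclose
  those that still agree. A smaller next digit moves points from the second group to the
  first.\<close>

lemma rank_com_correct:
  assumes z: "s0 z = zv" "zv \<le> n" "z \<notin> {3, 15, 16, 17, 18, acc}" and acc: "acc \<notin> {3, 11, 12, 15, 16, 17, 18}"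
    and s0: "s0 11 = u" "s0 12 = v" and uv: "u \<le> v" "v \<le> length pts"
  shows "hoare w D Q (\<lambda>s. s = s0) (rank_com G K z acc) T
     (\<lambda>s. s acc = length (filter (\<lambda>y. point_rank n Y y < zv) (drop u (take v pts))) \<and>
        same_outside {3, 15, 16, 17, 18, acc} s0 s)"
proof -
  define xx where "xx = (\<lambda>l. zv div b ^ (T - 1 - l) mod b)"
  let ?d = "rank_digit b T n Y"
  let ?W = "walk ?d pts xx"
  define sl where "sl = drop u (take v pts)"
  define cnt where "cnt t = length (filter (\<lambda>y. point_rank n Y y div b ^ (T - t) < zv div b ^ (T - t)) sl)" for t
  let ?fr = "same_outside {3, 15, 16, 17, 18, acc} s0"
  define I where "I t s \<longleftrightarrow> s 3 = t \<and> s 16 = ?W t u \<and> s 17 = ?W t v \<and> s acc = cnt t \<and> ?fr s" for t and s :: "nat \<Rightarrow> nat"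
  have zb: "zv < b ^ T" using z(2) n_T by simp
  have sl_len: "length sl \<le> n" using pts_len by (simp add: sl_def)
  have same: "digits_same ?d xx t y \<longleftrightarrow> point_rank n Y y div b ^ (T - t) = zv div b ^ (T - t)" if "t \<le> T" for t y
    using top_digits_same[OF point_rank_less[of y] zb b_pos that]
    unfolding digits_same_def rank_digit_def xx_def .
  have uv': "u \<le> length pts" using uv by simp
  have body: "hoare w D Q (I t) (Set 15 (Op Mod (Op Div (V z) (St 5 (V 3))) (sc 7)) ;;
      Set 18 (Op Add (N (2 * K)) (V 3)) ;;
      Set acc (Op Add (V acc) (Op Sub (less_expr G (V 18) (V 17) (V 15)) (less_expr G (V 18) (V 16) (V 15)))) ;;
      Set 16 (step_expr G (V 18) (V 16) (V 15)) ;;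
      Set 17 (step_expr G (V 18) (V 17) (V 15)) ;; inc 3) 0 (I (Suc t))" if t: "t < T" for t
  proof -
    have xb: "xx t < b" using b_pos by (simp add: xx_def)
    have lvl: "2 * K + t < levels" using t by (simp add: levels_def)
    have cntS: "cnt (Suc t) = cnt t + length (filter (\<lambda>y. digits_same ?d xx t y \<and> ?d t y < xx t) sl)"
    proof -
      have "cnt (Suc t) = length (filter (\<lambda>y. point_rank n Y y div b ^ (T - t) < zv div b ^ (T - t) \<or>
          digits_same ?d xx t y \<and> ?d t y < xx t) sl)"
        unfolding cnt_def top_digits_less[OF b_pos t] using same[of t] t
        by (auto simp: rank_digit_def xx_def intro!: arg_cong[where f = length] filter_cong)
      then show ?thesis unfolding cnt_def using same[of t] t by (subst (asm) length_filter_disj) auto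
    qed
    have cnt_le: "cnt (Suc t) \<le> n" unfolding cnt_def using sl_len length_filter_le order_trans by blast
    define J where "J x l a u' v' s \<longleftrightarrow> s 3 = t \<and> (x \<longrightarrow> s 15 = xx t) \<and> (l \<longrightarrow> s 18 = 2 * K + t) \<and> s acc = a \<and> s 16 = ?W u' u \<and> s 17 = ?W v' v \<and> ?fr s"
      for x l a u' v' and s :: "nat \<Rightarrow> nat"
    have 1: "J True False (cnt t) t t (s(15 := ev w D Q s (Op Mod (Op Div (V z) (St 5 (V 3))) (sc 7))))" if "I t s" for s
    proof -
      have "cell D 5 t = b ^ (T - 1 - t)" using cell_eq[of 5 D _ t] D_5 len_D t by simp
      moreover have "s 3 = t" "s z = zv" using that z by (auto simp: I_def)
      ultimately have "ev w D Q s (Op Mod (Op Div (V z) (St 5 (V 3))) (sc 7)) = xx t"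
        unfolding ev.simps(3)[of _ _ _ _ Mod] ev_sc by (simp add: xx_def)
      then show ?thesis using that acc by (auto simp: I_def J_def simp del: ev.simps)
    qed
    have 2: "J True True (cnt t) t t (s(18 := ev w D Q s (Op Add (N (2 * K)) (V 3))))" if "J True False (cnt t) t t s" for s
    proof -
      have "ev w D Q s (N (2 * K)) = 2 * K" using scalars_le(9) by (intro word_const) simp
      then have "ev w D Q s (Op Add (N (2 * K)) (V 3)) = 2 * K + t"
        using that lvl scalars_le(7) by (intro ev_Add_eq) (auto simp: J_def)
      then show ?thesis using that acc by (auto simp: J_def simp del: ev.simps)
    qed
    have 3: "J True True (cnt (Suc t)) t t (s(acc := ev w D Q s
        (Op Add (V acc) (Op Sub (less_expr G (V 18) (V 17) (V 15)) (less_expr G (V 18) (V 16) (V 15))))))"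
      if J: "J True True (cnt t) t t s" for s
    proof -
      let ?L = "\<lambda>i. length (filter (\<lambda>a. ?d t a < xx t) (take (?W t i) (wavelet_level ?d pts t)))"
      have e: "ev w D Q s (less_expr G (V 18) (V 17) (V 15)) = ?L v"
        by (rule ev_less_walk[where xx = xx, OF _ lvl M_rank[OF t] pts_len _ xb _ uv(2)]) (use J in \<open>auto simp: J_def\<close>)
      have f: "ev w D Q s (less_expr G (V 18) (V 16) (V 15)) = ?L u"
        by (rule ev_less_walk[where xx = xx, OF _ lvl M_rank[OF t] pts_len _ xb _ uv']) (use J in \<open>auto simp: J_def\<close>)
      have "?L u \<le> ?L v" using walk_mono[OF uv] by (rule length_filter_take_mono)
      moreover have "?L v \<le> n"
        by (rule order_trans[OF length_filter_le]) (use pts_len in simp)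
      ultimately have g: "ev w D Q s (Op Sub (less_expr G (V 18) (V 17) (V 15)) (less_expr G (V 18) (V 16) (V 15))) = ?L v - ?L u"
        using ev_Sub[of Q s "less_expr G (V 18) (V 16) (V 15)" "less_expr G (V 18) (V 17) (V 15)"] n_w unfolding e f by simp
      have h: "?L v - ?L u = length (filter (\<lambda>y. digits_same ?d xx t y \<and> ?d t y < xx t) sl)"
        unfolding sl_def by (rule walk_less_diff[OF uv])
      have "ev w D Q s (Op Add (V acc) (Op Sub (less_expr G (V 18) (V 17) (V 15)) (less_expr G (V 18) (V 16) (V 15)))) = cnt (Suc t)"
        unfolding cntS h[symmetric] by (rule ev_Add_eq[OF _ g]) (use J cnt_le cntS h in \<open>auto simp: J_def\<close>)
      then show ?thesis using J acc by (auto simp: J_def simp del: ev.simps)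
    qed
    have 4: "J True True a (Suc t) t (s(16 := ev w D Q s (step_expr G (V 18) (V 16) (V 15))))"
      if J: "J True True a t t s" for a s
    proof -
      have "ev w D Q s (step_expr G (V 18) (V 16) (V 15)) = ?W (Suc t) u"
        by (rule ev_step_walk[where xx = xx, OF _ lvl M_rank[OF t] pts_len _ xb _ uv']) (use J in \<open>auto simp: J_def\<close>)
      then show ?thesis using J acc by (auto simp: J_def simp del: ev.simps walk.simps)
    qed
    have 5: "J True True a u' (Suc t) (s(17 := ev w D Q s (step_expr G (V 18) (V 17) (V 15))))"
      if J: "J True True a u' t s" for a u' s
    proof -
      have "ev w D Q s (step_expr G (V 18) (V 17) (V 15)) = ?W (Suc t) v"
        by (rule ev_step_walk[where xx = xx, OF _ lvl M_rank[OF t] pts_len _ xb _ uv(2)]) (use J in \<open>auto simp: J_def\<close>)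
      then show ?thesis using J acc by (auto simp: J_def simp del: ev.simps walk.simps)
    qed
    have 6: "hoare w D Q (J True True (cnt (Suc t)) (Suc t) (Suc t)) (inc 3) 0 (I (Suc t))"
      by (rule hoare_inc) (use t scalars_le(8) n_w acc in \<open>auto simp: J_def I_def simp del: walk.simps\<close>)
    show ?thesis
      by (rule hoare_Set_Seq[OF hoare_Set_Seq[OF hoare_Set_Seq[OF hoare_Set_Seq[OF hoare_Set_Seq[OF 6]]]]])
        (erule 1 2 3 4 5)+
  qed
  have W: "hoare w D Q (I 0) (While (V 3) (sc 8) (Set 15 (Op Mod (Op Div (V z) (St 5 (V 3))) (sc 7)) ;;
      Set 18 (Op Add (N (2 * K)) (V 3)) ;;
      Set acc (Op Add (V acc) (Op Sub (less_expr G (V 18) (V 17) (V 15)) (less_expr G (V 18) (V 16) (V 15)))) ;;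
      Set 16 (step_expr G (V 18) (V 16) (V 15)) ;;
      Set 17 (step_expr G (V 18) (V 17) (V 15)) ;; inc 3)) T (I T)"
    by (rule hoare_While[where I = I, OF body]) (auto simp: I_def ev_sc simp del: ev.simps(4))
  \<comment> \<open>Before any digit is read, all quotients by \<open>b ^ T\<close> are 0.\<close>
  have "cnt 0 = 0" using zb point_rank_less by (auto simp: cnt_def filter_empty_conv)
  define S where "S k s \<longleftrightarrow> ?fr s \<and> (k \<ge> 1 \<longrightarrow> s 16 = u) \<and> (k \<ge> 2 \<longrightarrow> s 17 = v) \<and> (k \<ge> 3 \<longrightarrow> s acc = 0)" for k :: nat and s
  have "hoare w D Q (S 0) (rank_com G K z acc) T (I T)"
    unfolding rank_com_def
    apply (rule hoare_Set_Seq[where R = "S 1"])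
     apply (rule hoare_Set_Seq[where R = "S 2"])
      apply (rule hoare_Set_Seq[where R = "S 3"])
       apply (rule hoare_Set_Seq[OF W])
    using acc s0 \<open>cnt 0 = 0\<close> by (auto simp: S_def I_def)
  then show ?thesis
    by (rule hoare_conseq) (auto simp: I_def S_def cnt_def sl_def)
qed

text \<open>Ranks between the two bounds belong to suffixes that start with \<open>P\<close>. The
  empty suffix has rank \<open>n\<close> and is never counted, in accordance with
  \<open>P \<noteq> []\<close>.\<close>

lemma filter_point_rank:
  assumes "P \<noteq> []" "\<And>y. y \<in> set A \<Longrightarrow> y \<le> length Y"
  shows "length (filter (\<lambda>y. point_rank n Y y < sa_high Y P) A) - length (filter (\<lambda>y. point_rank n Y y < sa_low Y P) A) =
     length (filter (\<lambda>y. is_prefix P (drop y Y)) A)"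
proof -
  have nP: "\<not> is_prefix P []" using assms(1) by (cases P) auto
  have h: "point_rank n Y y < sa_high Y P \<longleftrightarrow> point_rank n Y y < sa_low Y P \<or> is_prefix P (drop y Y)"
    "\<not> (point_rank n Y y < sa_low Y P \<and> is_prefix P (drop y Y))" if "y \<in> set A" for y
  proof -
    have "(point_rank n Y y < sa_high Y P \<longleftrightarrow> point_rank n Y y < sa_low Y P \<or> is_prefix P (drop y Y)) \<and>
        \<not> (point_rank n Y y < sa_low Y P \<and> is_prefix P (drop y Y))"
    proof (cases "y < length Y")
      case True
      then show ?thesis using suffix_rank_high[OF True, of P] suffix_rank_low[OF True, of P] not_is_prefix_if_less
        by (auto simp: point_rank_def not_above_def)
    next
      case False
      then show ?thesis using sa_low_high[of Y P] Y_len nP by (simp add: point_rank_def)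
    qed
    then show "point_rank n Y y < sa_high Y P \<longleftrightarrow> point_rank n Y y < sa_low Y P \<or> is_prefix P (drop y Y)"
    "\<not> (point_rank n Y y < sa_low Y P \<and> is_prefix P (drop y Y))" by blast+
  qed
  have "filter (\<lambda>y. point_rank n Y y < sa_high Y P) A = filter (\<lambda>y. point_rank n Y y < sa_low Y P \<or> is_prefix P (drop y Y)) A"
    using h(1) by (intro filter_cong) auto
  then show ?thesis using length_filter_disj[of A "\<lambda>y. point_rank n Y y < sa_low Y P" "\<lambda>y. is_prefix P (drop y Y)"] h(2) by simp
qed

lemma count_com_correct:
  assumes P: "P \<in> lists {..<\<sigma>}"
    and q: "\<And>t. t < length P \<Longrightarrow> cell Q q t = P ! t"
    and m: "m \<notin> {3, 4, 5, 11, 12, 15, 18}"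
    and s0: "s0 m = length P" "s0 9 = sa_low Y P" "s0 10 = sa_high Y P" "s0 11 = u" "s0 12 = v"
    and uv: "u \<le> v" "v \<le> length pts"
  shows "hoare w D Q (\<lambda>s. s = s0) (count_com G K q m) (length P * (K + 3))
     (\<lambda>s. s 0 = length (filter (\<lambda>y. is_prefix P (drop y Y)) (drop u (take v pts))))"
proof (cases "length P < T")
  case True
  have "hoare w D Q (\<lambda>s. s = s0) (short_com G K q m) (length P * Suc K)
     (\<lambda>s. s 0 = length (filter (\<lambda>y. is_prefix P (drop y Y)) (drop u (take v pts))))"
    by (rule short_com_correct) (use assms True in auto)
  then show ?thesis unfolding count_com_def
    apply (intro hoare_If)
    subgoal by (erule hoare_conseq) (auto simp: algebra_simps)
    subgoal using True s0 by (auto simp: hoare_def ev_sc simp del: ev.simps(4))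
    done
next
  case False
  let ?sl = "drop u (take v pts)"
  have le: "sa_low Y P \<le> n" "sa_high Y P \<le> n" using sa_low_high[of Y P] Y_len by auto
  define J where "J s \<longleftrightarrow> s 13 = length (filter (\<lambda>y. point_rank n Y y < sa_low Y P) ?sl) \<and> same_outside {3, 15, 16, 17, 18, 13} s0 s" for s
  define J' where "J' s \<longleftrightarrow> s 13 = length (filter (\<lambda>y. point_rank n Y y < sa_low Y P) ?sl) \<and>
     s 14 = length (filter (\<lambda>y. point_rank n Y y < sa_high Y P) ?sl)" for s :: "nat \<Rightarrow> nat"
  have 1: "hoare w D Q (\<lambda>s. s = s0) (rank_com G K 9 13) T J"
    unfolding J_def by (rule rank_com_correct) (use s0 uv le in auto)
  have 2: "hoare w D Q J (rank_com G K 10 14) T J'"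
  proof (rule hoare_pointwise)
    fix s1 assume s1: "J s1"
    have "hoare w D Q (\<lambda>s. s = s1) (rank_com G K 10 14) T
      (\<lambda>s. s 14 = length (filter (\<lambda>y. point_rank n Y y < sa_high Y P) ?sl) \<and> same_outside {3, 15, 16, 17, 18, 14} s1 s)"
      by (rule rank_com_correct) (use s0 uv le s1 in \<open>auto simp: J_def\<close>)
    then show "hoare w D Q (\<lambda>s. s = s1) (rank_com G K 10 14) T J'"
      by (rule hoare_conseq) (use s1 in \<open>auto simp: J_def J'_def\<close>)
  qed
  \<comment> \<open>In this branch \<open>length P\<close> is at least \<open>T\<close>, and
    \<open>0 < T\<close>.\<close>
  have Pn: "P \<noteq> []" using False T_pos by auto
  have ptsl: "y \<le> length Y" if "y \<in> set ?sl" for y using that pts_le in_set_dropD in_set_takeD by metis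
  have 3: "hoare w D Q J' (Set 0 (Op Sub (V 14) (V 13))) 0
     (\<lambda>s. s 0 = length (filter (\<lambda>y. is_prefix P (drop y Y)) ?sl))"
  proof (rule hoare_Set)
    fix s assume J: "J' s"
    have "s 13 \<le> s 14"
    proof -
      have "length (filter (\<lambda>y. point_rank n Y y < sa_low Y P) A) \<le> length (filter (\<lambda>y. point_rank n Y y < sa_high Y P) A)" for A
        using sa_low_high(1)[of Y P] by (induction A) auto
      then show ?thesis using J by (simp add: J'_def)
    qed
    moreover have "s 14 < 2 ^ w"
    proof -
      have "s 14 \<le> length ?sl" using J length_filter_le unfolding J'_def by metis
      then show ?thesis using pts_len n_w by simp
    qed
    ultimately have "ev w D Q s (Op Sub (V 14) (V 13)) = s 14 - s 13" using ev_Sub[of Q s "V 13" "V 14"] by simp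
    also have "\<dots> = length (filter (\<lambda>y. is_prefix P (drop y Y)) ?sl)"
      using J filter_point_rank[OF Pn ptsl] by (simp add: J'_def)
    finally show "(s(0 := ev w D Q s (Op Sub (V 14) (V 13)))) 0 = length (filter (\<lambda>y. is_prefix P (drop y Y)) ?sl)" by simp
  qed
  \<comment> \<open>Two rank computations take \<open>T\<close> rounds each, and
    \<open>T \<le> length P\<close>.\<close>
  have "T + T \<le> length P * (K + 3)" using False by (simp add: algebra_simps)
  then have "hoare w D Q (\<lambda>s. s = s0) (rank_com G K 9 13 ;; rank_com G K 10 14 ;; Set 0 (Op Sub (V 14) (V 13))) (length P * (K + 3))
     (\<lambda>s. s 0 = length (filter (\<lambda>y. is_prefix P (drop y Y)) ?sl))"
    by (intro hoare_Seq[OF 1 hoare_Seq[OF 2 3 order_refl]]) simp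
  then show ?thesis unfolding count_com_def
    apply (intro hoare_If)
    subgoal using False s0 by (auto simp: hoare_def ev_sc simp del: ev.simps(4))
    subgoal by (erule hoare_conseq) auto
    done
qed

end

section \<open>The counting problems\<close>

definition backward :: "nat \<Rightarrow> expr" where
  "backward m = Op Sub (Op Sub (V m) (N 1)) (V 3)"

definition interval_com :: "nat \<Rightarrow> nat \<Rightarrow> com" where
  "interval_com G K =
    search_com G K K 0 7 0 (backward 0) 10 9 10 ;;
    Set 11 (St 8 (Op Sub (V 1) (N 1))) ;; Set 12 (St 8 (V 2)) ;;
    count_com G K 0 0"

definition aligned_com :: "nat \<Rightarrow> nat \<Rightarrow> com" where
  "aligned_com G K =
    (search_com G K 0 0 6 0 (backward 0) 9 7 8 ;; search_com G K K 1 7 1 (backward 1) 10 9 10) ;;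
    Set 11 (St 8 (V 7)) ;; Set 12 (St 8 (V 8)) ;;
    count_com G K 1 1"

text \<open>Occurrences of the first pattern are found by their ends, as suffixes of the reversed
  text. The empty pattern also ends in front of the first character, which is the empty suffix of
  the reversed text and has no row. In that case the answer is read off the interval of the second
  pattern, restricted to starts at offset \<open>d\<close> or later.
  \<open>Op Sub (N 1) (V 6)\<close> is 1 exactly if the second pattern is empty.\<close>

definition gap_com :: "nat \<Rightarrow> nat \<Rightarrow> com" where
  "gap_com G K =
    (search_com G K 0 0 6 0 (V 3) 9 7 8 ;; search_com G K K 1 7 1 (backward 1) 10 9 10) ;;
    If (V 0) (N 1)
      (Set 0 (Op Add (Op Sub (St 9 (V 10)) (St 9 (V 9))) (Op Mul (Op Sub (N 1) (V 6)) (sc 12))))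
      (Set 11 (St 8 (V 7)) ;; Set 12 (St 8 (V 8)) ;; count_com G K 1 1)"

lemma com_below_defs:
  "r1 < 20 \<Longrightarrow> r2 < 20 \<Longrightarrow> com_below 20 (char_com G K r1 r2)"
  "lo < 20 \<Longrightarrow> hi < 20 \<Longrightarrow> m < 20 \<Longrightarrow> expr_below 20 idx \<Longrightarrow> com_below 20 (search_com G K base q adj m idx len lo hi)"
  "m < 20 \<Longrightarrow> com_below 20 (count_com G K q m)"
  by (auto simp: char_com_def search_com_def count_com_def short_com_def rank_com_def inc_def
      intro!: expr_below_step_expr expr_below_less_expr)

lemma com_below_programs:
  "com_below 20 (interval_com G K)" "com_below 20 (aligned_com G K)" "com_below 20 (gap_com G K)"
  by (auto simp: interval_com_def aligned_com_def gap_com_def backward_def intro!: com_below_defs)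

context index
begin

lemma M_X: "k < K \<Longrightarrow> M (0 + k) = level_row b (lf_digit b K X) (suffix_array X) k"
  by (auto simp: index_matrix_def)

lemma M_Y: "k < K \<Longrightarrow> M (K + k) = level_row b (lf_digit b K Y) (suffix_array Y) k"
  by (auto simp: index_matrix_def)

lemma cell_adj: "c \<le> \<sigma> \<Longrightarrow> cell D 6 c = last_adjust X c" "c \<le> \<sigma> \<Longrightarrow> cell D 7 c = last_adjust Y c"
  using cell_eq[of 6 D _ c] cell_eq[of 7 D _ c] D_6 D_7 len_D by (auto simp: nth_append simp del: upt_Suc)

lemma ev_backward:
  assumes "s 3 < k" "s m = k" "k < 2 ^ w"
  shows "ev w D Q s (backward m) = k - 1 - s 3"
proof -
  have "ev w D Q s (Op Sub (V m) (N 1)) = k - 1"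
    using ev_Sub[of Q s "N 1" "V m"] assms unfolding ev_N1 by simp
  then show ?thesis using ev_Sub[of Q s "V 3" "Op Sub (V m) (N 1)"] assms unfolding backward_def by simp
qed

lemma backward_char:
  assumes "s 3 < length P" "s m = length P" "length P < 2 ^ w" "q < length Q" "Q ! q = P"
  shows "cell Q q (ev w D Q s (backward m)) = rev P ! s 3"
  using assms cell_eq[of q Q P] ev_backward[OF assms(1-3), of Q] by (simp add: rev_nth)

lemma search_Y:
  assumes P: "P \<in> lists {..<\<sigma>}" "length P < 2 ^ w" and q: "q < length Q" "Q ! q = P" and m: "m < 3" and s0: "s0 m = length P"
  shows "hoare w D Q (\<lambda>s. s = s0) (search_com G K K q 7 m (backward m) 10 9 10) (length P * Suc K)
     (\<lambda>s. s 9 = sa_low Y P \<and> s 10 = sa_high Y P \<and> s 6 = (if P = [] then 0 else 1) \<and>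
        same_outside {3, 4, 5, 6, 15, 18, 9, 10} s0 s)"
proof -
  have "hoare w D Q (same_outside {3, 4, 5, 6, 15, 18, 9, 10} s0) (search_com G K K q 7 m (backward m) 10 9 10)
     (length (rev P) * Suc K)
     (\<lambda>s. s 9 = sa_low Y (rev (rev P)) \<and> s 10 = sa_high Y (rev (rev P)) \<and> s 6 = (if rev P = [] then 0 else 1) \<and>
        same_outside {3, 4, 5, 6, 15, 18, 9, 10} s0 s)"
  proof (rule search_com_correct)
    show "\<And>k. k < K \<Longrightarrow> M (K + k) = level_row b (lf_digit b K Y) (suffix_array Y) k" by (rule M_Y)
    show "K + K \<le> levels" by (simp add: levels_def)
    show "ev w D Q s (sc 10) = length Y" for s by (rule ev_sc)
    show "cell Q q (ev w D Q s (backward m)) = rev P ! s 3" if "s 3 < length (rev P)" "s m = length (rev P)" for s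
      using that P q by (intro backward_char) auto
  qed (use P Y_len cell_adj m s0 in auto)
  then show ?thesis by (rule hoare_conseq) auto
qed

lemma search_XY:
  assumes P1: "P1 \<in> lists {..<\<sigma>}" "length P1 < 2 ^ w" and P2: "P2 \<in> lists {..<\<sigma>}" "length P2 < 2 ^ w"
    and R: "set R = set P1" "length R = length P1"
    and idx: "\<And>s. s 3 < length P1 \<Longrightarrow> s 0 = length P1 \<Longrightarrow> cell [P1, P2] 0 (ev w D [P1, P2] s idx) = R ! s 3"
  shows "hoare w D [P1, P2] (\<lambda>s. s = regs (init [length P1, length P2]))
     (search_com G K 0 0 6 0 idx 9 7 8 ;; search_com G K K 1 7 1 (backward 1) 10 9 10)
     ((length P1 + length P2) * Suc K)
     (\<lambda>s. s 0 = length P1 \<and> s 1 = length P2 \<and> s 6 = (if P2 = [] then 0 else 1) \<and>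
        s 7 = sa_low X (rev R) \<and> s 8 = sa_high X (rev R) \<and> s 9 = sa_low Y P2 \<and> s 10 = sa_high Y P2)"
proof -
  let ?s0 = "regs (init [length P1, length P2])"
  let ?J = "\<lambda>s :: nat \<Rightarrow> nat. s 0 = length P1 \<and> s 1 = length P2 \<and> s 7 = sa_low X (rev R) \<and> s 8 = sa_high X (rev R)"
  have Rl: "R \<in> lists {..<\<sigma>}" using P1(1) R(1) by (simp add: lists_eq_set)
  have "hoare w D [P1, P2] (same_outside {3, 4, 5, 6, 15, 18, 7, 8} ?s0) (search_com G K 0 0 6 0 idx 9 7 8)
     (length R * Suc K)
     (\<lambda>s. s 7 = sa_low X (rev R) \<and> s 8 = sa_high X (rev R) \<and> s 6 = (if R = [] then 0 else 1) \<and>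
        same_outside {3, 4, 5, 6, 15, 18, 7, 8} ?s0 s)"
  proof (rule search_com_correct)
    show "\<And>k. k < K \<Longrightarrow> M (0 + k) = level_row b (lf_digit b K X) (suffix_array X) k" by (rule M_X)
    show "0 + K \<le> levels" by (simp add: levels_def)
    show "ev w D [P1, P2] s (sc 9) = length X" for s by (rule ev_sc)
    show "cell [P1, P2] 0 (ev w D [P1, P2] s idx) = R ! s 3" if "s 3 < length R" "s 0 = length R" for s
      using that R idx by auto
  qed (use P1 R Rl X_len cell_adj in \<open>auto simp: init_def\<close>)
  then have 1: "hoare w D [P1, P2] (\<lambda>s. s = ?s0) (search_com G K 0 0 6 0 idx 9 7 8) (length P1 * Suc K) ?J"
    by (rule hoare_conseq) (use R in \<open>auto simp: init_def\<close>)
  have 2: "hoare w D [P1, P2] ?J (search_com G K K 1 7 1 (backward 1) 10 9 10) (length P2 * Suc K)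
     (\<lambda>s. s 0 = length P1 \<and> s 1 = length P2 \<and> s 6 = (if P2 = [] then 0 else 1) \<and>
        s 7 = sa_low X (rev R) \<and> s 8 = sa_high X (rev R) \<and> s 9 = sa_low Y P2 \<and> s 10 = sa_high Y P2)"
  proof (rule hoare_pointwise)
    fix s1 assume s1: "?J s1"
    have "hoare w D [P1, P2] (\<lambda>s. s = s1) (search_com G K K 1 7 1 (backward 1) 10 9 10) (length P2 * Suc K)
     (\<lambda>s. s 9 = sa_low Y P2 \<and> s 10 = sa_high Y P2 \<and> s 6 = (if P2 = [] then 0 else 1) \<and>
        same_outside {3, 4, 5, 6, 15, 18, 9, 10} s1 s)"
      by (rule search_Y) (use P2 s1 in auto)
    then show "hoare w D [P1, P2] (\<lambda>s. s = s1) (search_com G K K 1 7 1 (backward 1) 10 9 10) (length P2 * Suc K)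
     (\<lambda>s. s 0 = length P1 \<and> s 1 = length P2 \<and> s 6 = (if P2 = [] then 0 else 1) \<and>
        s 7 = sa_low X (rev R) \<and> s 8 = sa_high X (rev R) \<and> s 9 = sa_low Y P2 \<and> s 10 = sa_high Y P2)"
      by (rule hoare_conseq) (use s1 in auto)
  qed
  show ?thesis by (rule hoare_Seq[OF 1 2]) (simp add: algebra_simps)
qed

lemma cell_vm: "length vm = Suc n \<Longrightarrow> a \<le> n \<Longrightarrow> cell D 8 a = vm ! a"
  using cell_eq[of 8 D vm a] D_8 len_D by simp

lemma cell_wv: "length wv = Suc n \<Longrightarrow> a \<le> n \<Longrightarrow> cell D 9 a = wv ! a"
  using cell_eq[of 9 D wv a] D_9 len_D by simp

lemma interval_com_correct:
  assumes P: "P \<in> lists {..<\<sigma>}" "length P < 2 ^ w" and ij: "1 \<le> i" "i \<le> j" "j \<le> n"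
    and vm: "length vm = Suc n" "vm ! (i - 1) \<le> vm ! j" "vm ! j \<le> length pts"
  shows "computes w D [P] [length P, i, j] (interval_com G K) (length P * (2 * K + 4))
     (length (filter (\<lambda>y. is_prefix P (drop y Y)) (drop (vm ! (i - 1)) (take (vm ! j) pts))))"
proof -
  let ?s0 = "regs (init [length P, i, j])"
  define J where "J k s \<longleftrightarrow> s 0 = length P \<and> s 1 = i \<and> s 2 = j \<and> s 9 = sa_low Y P \<and> s 10 = sa_high Y P \<and>
    (k \<ge> 1 \<longrightarrow> s 11 = vm ! (i - 1)) \<and> (k \<ge> 2 \<longrightarrow> s 12 = vm ! j)" for k :: nat and s :: "nat \<Rightarrow> nat"
  have "hoare w D [P] (\<lambda>s. s = ?s0) (search_com G K K 0 7 0 (backward 0) 10 9 10) (length P * Suc K)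
     (\<lambda>s. s 9 = sa_low Y P \<and> s 10 = sa_high Y P \<and> s 6 = (if P = [] then 0 else 1) \<and>
        same_outside {3, 4, 5, 6, 15, 18, 9, 10} ?s0 s)"
    by (rule search_Y) (use P in \<open>auto simp: init_def\<close>)
  then have 1: "hoare w D [P] (\<lambda>s. s = ?s0) (search_com G K K 0 7 0 (backward 0) 10 9 10) (length P * Suc K) (J 0)"
    by (rule hoare_conseq) (auto simp: J_def init_def)
  have 2: "J 1 (s(11 := ev w D [P] s (St 8 (Op Sub (V 1) (N 1)))))" if "J 0 s" for s
  proof -
    have "ev w D [P] s (Op Sub (V 1) (N 1)) = i - 1"
      using ev_Sub[of "[P]" s "N 1" "V 1"] that ij n_w unfolding ev_N1 by (simp add: J_def)
    then have "ev w D [P] s (St 8 (Op Sub (V 1) (N 1))) = vm ! (i - 1)"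
      using cell_vm[OF vm(1), of "i - 1"] ij by (simp del: ev.simps(3))
    then show ?thesis using that by (auto simp: J_def simp del: ev.simps)
  qed
  have 3: "J 2 (s(12 := ev w D [P] s (St 8 (V 2))))" if "J 1 s" for s
    using that cell_vm[OF vm(1) ij(3)] by (auto simp: J_def)
  have 4: "hoare w D [P] (J 2) (count_com G K 0 0) (length P * (K + 3))
     (\<lambda>s. s 0 = length (filter (\<lambda>y. is_prefix P (drop y Y)) (drop (vm ! (i - 1)) (take (vm ! j) pts))))"
    by (rule hoare_pointwise, rule count_com_correct) (use P vm cell_eq[of 0 "[P]" P] in \<open>auto simp: J_def\<close>)
  show ?thesis unfolding interval_com_def
    by (rule hoare_Seq[OF 1 hoare_Set_Seq[where R = "J 1", OF hoare_Set_Seq[where R = "J 2", OF 4]]])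
      (use 2 3 in \<open>auto simp: algebra_simps simp del: ev.simps\<close>)
qed

lemma points_count_correct:
  assumes P2: "P2 \<in> lists {..<\<sigma>}"
    and vm: "length vm = Suc n" "vm ! lo \<le> vm ! hi" "vm ! hi \<le> length pts" and lh: "lo \<le> n" "hi \<le> n"
  shows "hoare w D [P1, P2] (\<lambda>s. s 1 = length P2 \<and> s 7 = lo \<and> s 8 = hi \<and> s 9 = sa_low Y P2 \<and> s 10 = sa_high Y P2)
     (Set 11 (St 8 (V 7)) ;; Set 12 (St 8 (V 8)) ;; count_com G K 1 1) (length P2 * (K + 3))
     (\<lambda>s. s 0 = length (filter (\<lambda>y. is_prefix P2 (drop y Y)) (drop (vm ! lo) (take (vm ! hi) pts))))"
proof -
  define J where "J k s \<longleftrightarrow> s 1 = length P2 \<and> s 7 = lo \<and> s 8 = hi \<and> s 9 = sa_low Y P2 \<and> s 10 = sa_high Y P2 \<and>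
    (k \<ge> 1 \<longrightarrow> s 11 = vm ! lo) \<and> (k \<ge> 2 \<longrightarrow> s 12 = vm ! hi)" for k :: nat and s :: "nat \<Rightarrow> nat"
  have 4: "hoare w D [P1, P2] (J 2) (count_com G K 1 1) (length P2 * (K + 3))
     (\<lambda>s. s 0 = length (filter (\<lambda>y. is_prefix P2 (drop y Y)) (drop (vm ! lo) (take (vm ! hi) pts))))"
    by (rule hoare_pointwise, rule count_com_correct) (use P2 vm cell_eq[of 1 "[P1, P2]" P2] in \<open>auto simp: J_def\<close>)
  show ?thesis
    by (rule hoare_Set_Seq[where R = "J 1", OF hoare_Set_Seq[where R = "J 2", OF 4]])
      (use cell_vm[OF vm(1)] lh in \<open>auto simp: J_def\<close>)
qed

lemma aligned_com_correct:
  assumes P1: "P1 \<in> lists {..<\<sigma>}" "length P1 < 2 ^ w" and P2: "P2 \<in> lists {..<\<sigma>}" "length P2 < 2 ^ w"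
    and vm: "length vm = Suc n" "vm ! sa_low X P1 \<le> vm ! sa_high X P1" "vm ! sa_high X P1 \<le> length pts"
  shows "computes w D [P1, P2] [length P1, length P2] (aligned_com G K) ((length P1 + length P2) * (2 * K + 4))
     (length (filter (\<lambda>y. is_prefix P2 (drop y Y)) (drop (vm ! sa_low X P1) (take (vm ! sa_high X P1) pts))))"
proof -
  have le: "sa_low X P1 \<le> n" "sa_high X P1 \<le> n" using sa_low_high[of X P1] X_len by auto
  have 1: "hoare w D [P1, P2] (\<lambda>s. s = regs (init [length P1, length P2]))
     (search_com G K 0 0 6 0 (backward 0) 9 7 8 ;; search_com G K K 1 7 1 (backward 1) 10 9 10)
     ((length P1 + length P2) * Suc K)
     (\<lambda>s. s 0 = length P1 \<and> s 1 = length P2 \<and> s 6 = (if P2 = [] then 0 else 1) \<and>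
        s 7 = sa_low X (rev (rev P1)) \<and> s 8 = sa_high X (rev (rev P1)) \<and> s 9 = sa_low Y P2 \<and> s 10 = sa_high Y P2)"
    by (rule search_XY[OF P1 P2]) (use P1 backward_char[where q = 0 and Q = "[P1, P2]"] in auto)
  then have 1: "hoare w D [P1, P2] (\<lambda>s. s = regs (init [length P1, length P2]))
     (search_com G K 0 0 6 0 (backward 0) 9 7 8 ;; search_com G K K 1 7 1 (backward 1) 10 9 10)
     ((length P1 + length P2) * Suc K)
     (\<lambda>s. s 1 = length P2 \<and> s 7 = sa_low X P1 \<and> s 8 = sa_high X P1 \<and> s 9 = sa_low Y P2 \<and> s 10 = sa_high Y P2)"
    by (rule hoare_conseq) auto
  show ?thesis unfolding aligned_com_def
    by (rule hoare_Seq[OF 1 points_count_correct[OF P2(1) vm le]]) (simp add: algebra_simps)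
qed

lemma gap_com_correct:
  assumes P1: "P1 \<in> lists {..<\<sigma>}" "length P1 < 2 ^ w" and P2: "P2 \<in> lists {..<\<sigma>}" "length P2 < 2 ^ w"
    and vm: "length vm = Suc n" "vm ! sa_low X (rev P1) \<le> vm ! sa_high X (rev P1)" "vm ! sa_high X (rev P1) \<le> length pts"
    and wv: "length wv = Suc n" "wv ! sa_low Y P2 \<le> wv ! sa_high Y P2"
      "wv ! sa_high Y P2 + \<delta> \<le> n"
  shows "hoare w D [P1, P2] (\<lambda>s. s = regs (init [length P1, length P2])) (gap_com G K) ((length P1 + length P2) * (2 * K + 4))
     (\<lambda>s. s 0 = (if P1 = [] then wv ! sa_high Y P2 - wv ! sa_low Y P2 + (if P2 = [] then \<delta> else 0)
        else length (filter (\<lambda>y. is_prefix P2 (drop y Y)) (drop (vm ! sa_low X (rev P1)) (take (vm ! sa_high X (rev P1)) pts)))))"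
    (is "hoare w D _ _ _ _ ?post")
proof -
  let ?J = "\<lambda>s :: nat \<Rightarrow> nat. s 0 = length P1 \<and> s 1 = length P2 \<and> s 6 = (if P2 = [] then 0 else 1) \<and>
        s 7 = sa_low X (rev P1) \<and> s 8 = sa_high X (rev P1) \<and> s 9 = sa_low Y P2 \<and> s 10 = sa_high Y P2"
  have le: "sa_low X (rev P1) \<le> n" "sa_high X (rev P1) \<le> n" "sa_low Y P2 \<le> n" "sa_high Y P2 \<le> n"
    using sa_low_high[of X "rev P1"] sa_low_high[of Y P2] X_len Y_len by auto
  have 1: "hoare w D [P1, P2] (\<lambda>s. s = regs (init [length P1, length P2]))
     (search_com G K 0 0 6 0 (V 3) 9 7 8 ;; search_com G K K 1 7 1 (backward 1) 10 9 10)
     ((length P1 + length P2) * Suc K) ?J"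
    by (rule search_XY[OF P1 P2]) (use cell_eq[of 0 "[P1, P2]" P1] in auto)
  have 2: "hoare w D [P1, P2] (\<lambda>s. ?J s \<and> ev w D [P1, P2] s (V 0) < ev w D [P1, P2] s (N 1))
     (Set 0 (Op Add (Op Sub (St 9 (V 10)) (St 9 (V 9))) (Op Mul (Op Sub (N 1) (V 6)) (sc 12))))
     (length P2 * (K + 3)) ?post"
  proof (rule hoare_Set)
    fix s assume s: "?J s \<and> ev w D [P1, P2] s (V 0) < ev w D [P1, P2] s (N 1)"
    then have P1e: "P1 = []" unfolding ev_N1 by auto
    have a: "ev w D [P1, P2] s (St 9 (V 10)) = wv ! sa_high Y P2" "ev w D [P1, P2] s (St 9 (V 9)) = wv ! sa_low Y P2"
      using s cell_wv[OF wv(1)] le by auto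
    have b: "ev w D [P1, P2] s (Op Sub (St 9 (V 10)) (St 9 (V 9))) = wv ! sa_high Y P2 - wv ! sa_low Y P2"
      using ev_Sub[of "[P1, P2]" s "St 9 (V 9)" "St 9 (V 10)"] wv n_w unfolding a by simp
    have "1 < (2::nat) ^ w" using n_big n_w by simp
    then have c: "ev w D [P1, P2] s (Op Sub (N 1) (V 6)) = (if P2 = [] then 1 else 0)"
      using ev_Sub[of "[P1, P2]" s "V 6" "N 1"] s unfolding ev_N1 by simp
    have d: "ev w D [P1, P2] s (Op Mul (Op Sub (N 1) (V 6)) (sc 12)) = (if P2 = [] then \<delta> else 0)"
      using ev_Mul[of "[P1, P2]" s "Op Sub (N 1) (V 6)" "sc 12"] wv(3) unfolding c ev_sc by simp
    have "ev w D [P1, P2] s (Op Add (Op Sub (St 9 (V 10)) (St 9 (V 9))) (Op Mul (Op Sub (N 1) (V 6)) (sc 12))) =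
        wv ! sa_high Y P2 - wv ! sa_low Y P2 + (if P2 = [] then \<delta> else 0)"
      by (rule ev_Add_eq[OF b d]) (use wv(3) in auto)
    then show "?post (s(0 := ev w D [P1, P2] s (Op Add (Op Sub (St 9 (V 10)) (St 9 (V 9))) (Op Mul (Op Sub (N 1) (V 6)) (sc 12)))))"
      using P1e by (simp del: ev.simps)
  qed
  have "hoare w D [P1, P2] (\<lambda>s. ?J s \<and> \<not> ev w D [P1, P2] s (V 0) < ev w D [P1, P2] s (N 1))
     (Set 11 (St 8 (V 7)) ;; Set 12 (St 8 (V 8)) ;; count_com G K 1 1) (length P2 * (K + 3)) ?post"
  proof (cases "P1 = []")
    case True
    then show ?thesis unfolding ev_N1 by (auto simp: hoare_def)
  next
    case False
    then show ?thesis
      by (intro hoare_conseq[OF points_count_correct[OF P2(1) vm le(1,2)]]) auto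
  qed
  then have 3: "hoare w D [P1, P2] ?J (If (V 0) (N 1)
      (Set 0 (Op Add (Op Sub (St 9 (V 10)) (St 9 (V 9))) (Op Mul (Op Sub (N 1) (V 6)) (sc 12))))
      (Set 11 (St 8 (V 7)) ;; Set 12 (St 8 (V 8)) ;; count_com G K 1 1)) (length P2 * (K + 3)) ?post"
    by (intro hoare_If 2)
  show ?thesis unfolding gap_com_def
    by (rule hoare_Seq[OF 1 3]) (simp add: algebra_simps)
qed

end

text \<open>The specification counts positions from 1, the index from 0. The case
  \<open>k = length S\<close> is included because an empty pattern occurs there.\<close>

lemma occurs_at_Suc: "k \<le> length S \<Longrightarrow> occurs_at P S (Suc k) \<longleftrightarrow> is_prefix P (drop k S)"
proof -
  assume "k \<le> length S"
  moreover have "length P \<le> length S - k" if "take (length P) (drop k S) = P"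
    using that by (metis length_drop length_take min.cobounded1)
  ultimately show ?thesis by (auto simp: occurs_at_def is_prefix_def)
qed

lemma occurs_at_long: "length S < length P \<Longrightarrow> \<not> occurs_at P S k"
  by (auto simp: occurs_at_def)

text \<open>Prefix counts of the retained elements: they translate an interval of \<open>A\<close>
  into the corresponding interval of the filtered list.\<close>

definition filter_counts :: "nat \<Rightarrow> (nat \<Rightarrow> bool) \<Rightarrow> nat list \<Rightarrow> nat list" where
  "filter_counts n R A = map (\<lambda>i. length (filter R (take i A))) [0..<Suc n]"

lemma length_filter_counts [simp]: "length (filter_counts n R A) = Suc n"
  by (simp add: filter_counts_def)

lemma filter_counts_nth: "i \<le> n \<Longrightarrow> filter_counts n R A ! i = length (filter R (take i A))"
  by (simp add: filter_counts_def del: upt_Suc)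

lemma filter_counts_slice:
  assumes "i \<le> j" "j \<le> n"
  shows "filter_counts n R A ! i \<le> filter_counts n R A ! j"
    "filter_counts n R A ! j \<le> length (filter R A)"
    "drop (filter_counts n R A ! i) (take (filter_counts n R A ! j) (filter R A)) = filter R (drop i (take j A))"
    "filter_counts n R A ! j - filter_counts n R A ! i = length (filter R (drop i (take j A)))"
proof -
  show 1: "filter_counts n R A ! i \<le> filter_counts n R A ! j"
    using assms by (simp add: filter_counts_nth length_filter_take_mono)
  show "filter_counts n R A ! j \<le> length (filter R A)"
    using assms by (simp add: filter_counts_nth) (metis take_filter_take length_take min.cobounded1)
  have "take (filter_counts n R A ! j) (filter R A) = filter R (take i A) @ filter R (drop i (take j A))"
    using assms by (simp add: filter_counts_nth take_filter_take filter_take_le[of i j, symmetric])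
  then show "drop (filter_counts n R A ! i) (take (filter_counts n R A ! j) (filter R A)) = filter R (drop i (take j A))"
    using assms by (simp add: filter_counts_nth)
  show "filter_counts n R A ! j - filter_counts n R A ! i = length (filter R (drop i (take j A)))"
    using assms by (simp add: filter_counts_nth filter_take_le[OF assms(1)])
qed

lemma length_filter_card: "distinct A \<Longrightarrow> length (filter P A) = card {a \<in> set A. P a}"
  by (metis distinct_card distinct_filter set_filter)

lemma interval_count:
  assumes "length S = n" "1 \<le> i" "i \<le> j" "j \<le> n"
  shows "length (filter (\<lambda>y. is_prefix P (drop y S)) (filter (\<lambda>y. U (Suc y)) (drop (i - 1) (take j [0..<n])))) =
    card {k \<in> {i..j}. occurs_at P S k \<and> U k}"
proof -
  have "drop (i - 1) (take j [0..<n]) = [i - 1..<j]" using assms by (simp add: take_upt)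
  then have "length (filter (\<lambda>y. is_prefix P (drop y S)) (filter (\<lambda>y. U (Suc y)) (drop (i - 1) (take j [0..<n])))) =
     card {y \<in> {i - 1..<j}. U (Suc y) \<and> is_prefix P (drop y S)}"
    by (simp add: length_filter_card)
  also have "\<dots> = card (Suc ` {y \<in> {i - 1..<j}. U (Suc y) \<and> is_prefix P (drop y S)})"
    by (simp add: card_image)
  also have "Suc ` {y \<in> {i - 1..<j}. U (Suc y) \<and> is_prefix P (drop y S)} = {k \<in> {i..j}. occurs_at P S k \<and> U k}"
  proof (intro equalityI subsetI)
    fix k assume k: "k \<in> {k \<in> {i..j}. occurs_at P S k \<and> U k}"
    then obtain y where y: "k = Suc y" using assms by (cases k) auto
    then show "k \<in> Suc ` {y \<in> {i - 1..<j}. U (Suc y) \<and> is_prefix P (drop y S)}"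
      using k assms occurs_at_Suc[of y S P] by auto
  qed (use assms occurs_at_Suc[of _ S P] in auto)
  finally show ?thesis .
qed

lemma aligned_count:
  "length (filter (\<lambda>y. is_prefix P2 (drop y S2)) (filter (\<lambda>y. y < length S2)
      (filter (\<lambda>k. is_prefix P1 (drop k S1)) (suffix_array S1)))) =
    card {k \<in> {1..min (length S1) (length S2)}. occurs_at P1 S1 k \<and> occurs_at P2 S2 k}"
proof -
  let ?A = "{y. y < length S1 \<and> y < length S2 \<and> is_prefix P1 (drop y S1) \<and> is_prefix P2 (drop y S2)}"
  have "length (filter (\<lambda>y. is_prefix P2 (drop y S2)) (filter (\<lambda>y. y < length S2)
      (filter (\<lambda>k. is_prefix P1 (drop k S1)) (suffix_array S1)))) = card ?A"
    by (subst length_filter_card) (auto simp: distinct_suffix_array intro!: arg_cong[where f = card])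
  also have "\<dots> = card (Suc ` ?A)" by (simp add: card_image)
  also have "Suc ` ?A = {k \<in> {1..min (length S1) (length S2)}. occurs_at P1 S1 k \<and> occurs_at P2 S2 k}"
  proof (intro equalityI subsetI)
    fix k assume k: "k \<in> {k \<in> {1..min (length S1) (length S2)}. occurs_at P1 S1 k \<and> occurs_at P2 S2 k}"
    then obtain y where y: "k = Suc y" by (cases k) auto
    then show "k \<in> Suc ` ?A" using k occurs_at_Suc[of y S1 P1] occurs_at_Suc[of y S2 P2] by auto
  qed (use occurs_at_Suc[of _ S1 P1] occurs_at_Suc[of _ S2 P2] in auto)
  finally show ?thesis .
qed

text \<open>An occurrence of \<open>P\<close> ending after \<open>e\<close> characters, read
  backwards from its end.\<close>

lemma is_prefix_rev:
  assumes "e \<le> length S"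
  shows "is_prefix (rev P) (rev (take e S)) \<longleftrightarrow> length P \<le> e \<and> occurs_at P S (Suc (e - length P))"
proof -
  have e: "is_prefix (rev P) (rev (take e S)) \<longleftrightarrow> drop (e - length P) (take e S) = P"
    unfolding is_prefix_def using assms by (simp add: take_rev min_def)
  show ?thesis
  proof (cases "length P \<le> e")
    case True
    then have "drop (e - length P) (take e S) = take (length P) (drop (e - length P) S)"
      by (simp add: drop_take)
    then show ?thesis using e True assms occurs_at_Suc[of "e - length P" S P] by (simp add: is_prefix_def)
  next
    case False
    then have "length (drop (e - length P) (take e S)) < length P" using assms by simp
    then show ?thesis using e False by auto
  qed
qed

text \<open>The first occurrence ends after \<open>n - t\<close> characters, which determines its
  start, and the second has to start at offset \<open>n - t + d\<close>. The condition
  \<open>d \<le> t\<close> keeps this offset at most \<open>n\<close>, the value \<open>n\<close>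
  being possible for an empty \<open>P2\<close>.\<close>

lemma gap_count:
  assumes "length S = n" "P1 \<noteq> []"
  shows "length (filter (\<lambda>y. is_prefix P2 (drop y S)) (map (\<lambda>t. n - t + d) (filter (\<lambda>t. d \<le> t)
      (filter (\<lambda>t. is_prefix (rev P1) (drop t (rev S))) (suffix_array (rev S)))))) =
    card {k \<in> {1..n}. occurs_at P1 S k \<and> occurs_at P2 S (k + length P1 + d)}"
proof -
  let ?A = "{t. t < n \<and> d \<le> t \<and> is_prefix (rev P1) (drop t (rev S)) \<and> is_prefix P2 (drop (n - t + d) S)}"
  let ?g = "\<lambda>t. Suc (n - t - length P1)"
  have "length (filter (\<lambda>y. is_prefix P2 (drop y S)) (map (\<lambda>t. n - t + d) (filter (\<lambda>t. d \<le> t)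
      (filter (\<lambda>t. is_prefix (rev P1) (drop t (rev S))) (suffix_array (rev S)))))) = card ?A"
    using assms unfolding filter_map length_map comp_def
    by (subst length_filter_card) (auto simp: distinct_suffix_array intro!: arg_cong[where f = card])
  also have pr: "is_prefix (rev P1) (drop t (rev S)) \<longleftrightarrow> length P1 \<le> n - t \<and> occurs_at P1 S (?g t)" for t
    using is_prefix_rev[of "n - t" S P1] assms by (simp add: drop_rev)
  have "inj_on ?g ?A" using pr by (intro inj_onI) auto
  then have "card ?A = card (?g ` ?A)" by (simp add: card_image)
  also have "?g ` ?A = {k \<in> {1..n}. occurs_at P1 S k \<and> occurs_at P2 S (k + length P1 + d)}"
  proof (intro equalityI subsetI)
    fix k assume "k \<in> ?g ` ?A"
    then obtain t where t: "t < n" "d \<le> t" "length P1 \<le> n - t" "occurs_at P1 S (?g t)" "is_prefix P2 (drop (n - t + d) S)" "k = ?g t"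
      using pr by auto
    have "k + length P1 + d = Suc (n - t + d)" using t by simp
    moreover have "n - t + d \<le> length S" using t assms by simp
    moreover have "k \<le> n" using t assms by (cases P1) auto
    ultimately show "k \<in> {k \<in> {1..n}. occurs_at P1 S k \<and> occurs_at P2 S (k + length P1 + d)}"
      using t occurs_at_Suc[of "n - t + d" S P2] by auto
  next
    fix k assume k: "k \<in> {k \<in> {1..n}. occurs_at P1 S k \<and> occurs_at P2 S (k + length P1 + d)}"
    define t where "t = n - (k - 1 + length P1)"
    have a: "k - 1 + length P1 \<le> n" "1 \<le> k" "k - 1 + length P1 + d \<le> n" "0 < length P1"
      using k assms by (auto simp: occurs_at_def)
    then have t: "n - t = k - 1 + length P1" "t < n" "d \<le> t" unfolding t_def by linarith+
    have g: "?g t = k" using a by (simp add: t(1))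
    have "k + length P1 + d = Suc (n - t + d)" using a by (simp add: t(1))
    then have "is_prefix P2 (drop (n - t + d) S)"
      using k occurs_at_Suc[of "n - t + d" S P2] a assms by (simp add: t(1))
    moreover have "length P1 \<le> n - t" unfolding t(1) by (rule le_add2)
    then have "is_prefix (rev P1) (drop t (rev S))" unfolding pr g using k by simp
    ultimately show "k \<in> ?g ` ?A" using t(2,3) g by (intro rev_image_eqI[of t]) auto
  qed
  finally show ?thesis .
qed

text \<open>The suffix array covers starts of \<open>P2\<close> at offsets \<open>d\<close> to
  \<open>n - 1\<close>. Only an empty \<open>P2\<close> can start at offset \<open>n\<close>, which
  belongs to \<open>k = n + 1 - d\<close>; this lies in the range 1 to \<open>n\<close> exactly for
  \<open>1 \<le> d \<le> n\<close>.\<close>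

lemma gap_count_Nil:
  assumes "length S = n"
  shows "length (filter (\<lambda>k. d \<le> k) (filter (\<lambda>k. is_prefix P2 (drop k S)) (suffix_array S))) +
      (if P2 = [] then (if 1 \<le> d \<and> d \<le> n then 1 else 0) else 0) =
    card {k \<in> {1..n}. occurs_at [] S k \<and> occurs_at P2 S (k + length [] + d)}"
proof -
  let ?A = "{q. q < n \<and> d \<le> q \<and> is_prefix P2 (drop q S)}"
  have L: "length (filter (\<lambda>k. d \<le> k) (filter (\<lambda>k. is_prefix P2 (drop k S)) (suffix_array S))) = card ?A"
    using assms by (subst length_filter_card) (auto simp: distinct_suffix_array intro!: arg_cong[where f = card])
  have E: "occurs_at [] S k" if "k \<in> {1..n}" for k using that assms by (auto simp: occurs_at_def)
  show ?thesis
  proof (cases "P2 = []")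
    case True
    have "?A = {d..<n}" using True by auto
    moreover have "{k \<in> {1..n}. occurs_at [] S k \<and> occurs_at P2 S (k + length [] + d)} = {1..min n (n + 1 - d)}"
      using True assms E by (auto simp: occurs_at_def)
    ultimately show ?thesis using True L by auto
  next
    case False
    let ?g = "\<lambda>q. Suc q - d"
    have "inj_on ?g ?A" by (auto simp: inj_on_def)
    then have "card ?A = card (?g ` ?A)" by (simp add: card_image)
    also have "?g ` ?A = {k \<in> {1..n}. occurs_at [] S k \<and> occurs_at P2 S (k + length [] + d)}"
    proof (intro equalityI subsetI)
      fix k assume "k \<in> ?g ` ?A"
      then obtain q where q: "q < n" "d \<le> q" "is_prefix P2 (drop q S)" "k = Suc q - d" by auto
      then have k: "k \<in> {1..n}" "k + d = Suc q" by auto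
      then show "k \<in> {k \<in> {1..n}. occurs_at [] S k \<and> occurs_at P2 S (k + length [] + d)}"
        using q E[OF k(1)] occurs_at_Suc[of q S P2] assms by auto
    next
      fix k assume k: "k \<in> {k \<in> {1..n}. occurs_at [] S k \<and> occurs_at P2 S (k + length [] + d)}"
      have "k + d + length P2 \<le> n + 1" using k assms by (auto simp: occurs_at_def)
      then have q: "k + d - 1 < n" using False k by (cases P2) auto
      have "is_prefix P2 (drop (k + d - 1) S)" using k occurs_at_Suc[of "k + d - 1" S P2] q assms by auto
      then show "k \<in> ?g ` ?A" using k q by (intro rev_image_eqI[of "k + d - 1"]) auto
    qed
    finally show ?thesis using False L by simp
  qed
qed

section \<open>Parameters for large inputs\<close>

text \<open>A piece has \<open>B = l div (8 * \<beta>)\<close> digits so that its packed contents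
  number at most \<open>2 ^ (2 * \<beta> * B)\<close>, which \<open>2 ^ (l / 4)\<close> bounds. Then
  \<open>T \<le> 16 * B\<close> bounds the number of levels by \<open>18 * (K + 1) * B\<close>, and
  \<open>72 = 4 * 18\<close> makes a block four times as long as that; the factor 4 absorbs the
  rounding in the numbers of blocks and superblocks.\<close>

lemma params_if_large_base:
  fixes n w \<sigma> b K T B G \<beta> l :: nat
  assumes l: "2 ^ l \<le> n" "n < 2 ^ (l + 1)" and w: "n < 2 ^ w"
    and b: "b = 2 ^ \<beta>" "b ^ 4 \<le> l" "l < 16 * b ^ 4" "1 \<le> \<beta>"
    and K: "0 < K" "K \<le> b" and \<sigma>: "\<sigma> \<le> b ^ K"
    and G: "G = 72 * (K + 1)" and pow: "(b + 1) * (G * (16 * b ^ 4)) + 1 \<le> 2 ^ b"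
    and T: "T = l div \<beta> + 1" and B: "B = l div (8 * \<beta>)"
  shows "params n w \<sigma> b K T B G (Suc b) (G * B) (n div (G * B) + 1) ((n div (G * B) + 1) div Suc b + 1)
     (Suc b * (G * B) + 1) (2 * K + T + K * T)"
proof -
  have \<beta>b: "\<beta> < b" using b(1) by simp
  have b2: "2 \<le> b" using b(1,4) power_increasing[of 1 \<beta> "2::nat"] by simp
  have b4: "8 * b \<le> b ^ 4"
  proof -
    have "(2::nat) ^ 3 \<le> b ^ 3" using b2 by (rule power_mono) simp
    then have "2 ^ 3 * b \<le> b ^ 3 * b" by (rule mult_le_mono1)
    then show ?thesis by (simp add: power_numeral_reduce mult_ac)
  qed
  have bsq: "b * b * 4 \<le> b ^ 4"
  proof -
    have "(2::nat) ^ 2 \<le> b ^ 2" using b2 by (rule power_mono) simp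
    then have "2 ^ 2 * (b * b) \<le> b ^ 2 * (b * b)" by (rule mult_le_mono1)
    then show ?thesis by (simp add: power_numeral_reduce mult_ac)
  qed
  have b1sq: "Suc b \<le> b * b" using mult_le_mono1[OF b2, of b] b2 by linarith
  have G0: "0 < G" by (simp add: G)
  have "8 * \<beta> \<le> l" using \<beta>b b4 b(2) by linarith
  then have B1: "1 \<le> B" using b(4) unfolding B by (simp add: less_eq_div_iff_mult_less_eq)
  have lb: "8 * \<beta> * B \<le> l" unfolding B by simp
  have l8: "l < 8 * \<beta> * (B + 1)"
    using dividend_less_times_div[of "8 * \<beta>" l] b(4) unfolding B by simp
  \<comment> \<open>Rounding down in \<open>B\<close> costs one unit, which \<open>1 \<le> B\<close>
    absorbs by doubling 8 to 16.\<close>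
  have T16: "T \<le> 16 * B"
  proof -
    have "l div \<beta> < 8 * (B + 1)" using l8 b(4) by (simp add: div_less_iff_less_mult mult_ac)
    then have "T \<le> 8 * (B + 1)" unfolding T by simp
    also have "\<dots> \<le> 16 * B" using B1 by simp
    finally show ?thesis .
  qed
  have lev: "4 * (2 * K + T + K * T) \<le> G * B"
  proof -
    have "2 * K \<le> 2 * K * B" using B1 by simp
    moreover have "K * T \<le> K * (16 * B)" using T16 by (rule mult_le_mono2)
    ultimately have "2 * K + T + K * T \<le> 2 * K * B + 16 * B + K * (16 * B)" using T16 by linarith
    also have "\<dots> \<le> 18 * (K + 1) * B" by (simp add: algebra_simps)
    finally show ?thesis unfolding G by (simp add: algebra_simps)
  qed
  have Bl: "B \<le> 16 * b ^ 4" using b(3) unfolding B by (meson div_le_dividend le_trans less_imp_le)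
  have q: "Suc b * (G * B) + 1 \<le> 2 ^ b"
  proof -
    have "Suc b * (G * B) \<le> Suc b * (G * (16 * b ^ 4))" using Bl by (intro mult_le_mono2)
    then show ?thesis using pow by simp
  qed
  then have q': "G * B * Suc b \<le> 2 ^ b" unfolding mult.commute[of "G * B" "Suc b"] by linarith
  have two_n: "2 ^ e \<le> n" if "e \<le> l" for e
    by (rule order_trans[OF power_increasing l(1)]) (use that in auto)
  have lev_b: "4 * (2 * K + T + K * T) * (b + 2) \<le> n"
  proof -
    have "b + 2 \<le> 2 * Suc b" by simp
    then have "4 * (2 * K + T + K * T) * (b + 2) \<le> G * B * (2 * Suc b)"
      by (rule mult_le_mono[OF lev])
    also have "\<dots> = 2 * (G * B * Suc b)" by (simp only: mult_ac)
    also have "\<dots> \<le> 2 * 2 ^ b" using q' by (rule mult_le_mono2)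
    also have "\<dots> = 2 ^ (b + 1)" by simp
    also have "\<dots> \<le> n" using b4 b(2) b2 by (intro two_n) linarith
    finally show ?thesis .
  qed
  let ?H = "G * B" and ?L = "2 * K + T + K * T"
  have Ldiv: "4 * (?L * (n div ?H)) \<le> n"
  proof -
    have "4 * ?L * (n div ?H) \<le> ?H * (n div ?H)" using lev by (rule mult_le_mono1)
    also have "\<dots> \<le> n" by simp
    finally show ?thesis by (simp only: mult.assoc)
  qed
  show ?thesis
  proof
    show "n < 2 ^ w" by fact
    show "16 \<le> n" using two_n[of 4] b4 b2 b(2) by simp
    show "2 \<le> b" "0 < K" "0 < T" "0 < B" "0 < G" using b2 K B1 G0 by (auto simp: T)
    show "\<sigma> \<le> b ^ K" by fact
    have bK: "b ^ K < 2 ^ l"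
    proof -
      have "\<beta> * K \<le> \<beta> * b" using K(2) by (rule mult_le_mono2)
      also have "\<dots> < b * b" using \<beta>b b2 by simp
      also have "\<dots> \<le> l" using bsq b(2) by linarith
      finally have "(2::nat) ^ (\<beta> * K) < 2 ^ l" by simp
      then show ?thesis by (simp add: b(1) power_mult)
    qed
    then show "\<sigma> < n" "b ^ K \<le> n" using \<sigma> l(1) by linarith+
    show "n < b ^ T"
    proof -
      have "l < \<beta> * T" using dividend_less_times_div[of \<beta> l] b(4) unfolding T by simp
      then have "(2::nat) ^ (l + 1) \<le> 2 ^ (\<beta> * T)" by (intro power_increasing) auto
      then show ?thesis using l(2) by (simp add: b(1) power_mult)
    qed
    show "b ^ (T - 1) \<le> n"
      using two_n[of "\<beta> * (l div \<beta>)"] by (simp add: T b(1) power_mult)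
    show "?L * (n div ?H + 1) \<le> n"
    proof -
      have "4 * ?L \<le> 4 * ?L * (b + 2)" by simp
      then have "4 * ?L \<le> n" using lev_b by linarith
      then show ?thesis using Ldiv by (simp add: algebra_simps)
    qed
    show "?L * ((n div ?H + 1) div Suc b + 1) * Suc b \<le> n"
    proof -
      have "((n div ?H + 1) div Suc b + 1) * Suc b \<le> (n div ?H + 1) + Suc b"
        using div_times_less_eq_dividend[of "n div ?H + 1" "Suc b"] by (simp add: algebra_simps)
      then have "?L * (((n div ?H + 1) div Suc b + 1) * Suc b) \<le> ?L * ((n div ?H + 1) + Suc b)"
        by (rule mult_le_mono2)
      also have "\<dots> = ?L * (n div ?H) + ?L * (b + 2)" by (simp add: algebra_simps)
      also have "\<dots> \<le> n" using Ldiv lev_b by linarith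
      finally show ?thesis by (simp only: mult.assoc)
    qed
    \<comment> \<open>The base is at most \<open>2 ^ b\<close>, so \<open>b + 1\<close> packed
      counts need at most \<open>b * (b + 1)\<close> bits, for which \<open>b ^ 4 \<le> l\<close>
      leaves room.\<close>
    show "(Suc b * ?H + 1) ^ Suc b \<le> n"
    proof -
      have "(Suc b * ?H + 1) ^ Suc b \<le> (2 ^ b) ^ Suc b" using q by (rule power_mono) simp
      also have "\<dots> = 2 ^ (b * Suc b)" by (rule power_mult[symmetric])
      also have "\<dots> \<le> n"
      proof (rule two_n)
        have "b * Suc b \<le> b * b * 4" using b2 by simp
        then show "b * Suc b \<le> l" using bsq b(2) by linarith
      qed
      finally show ?thesis .
    qed
    \<comment> \<open>As \<open>b + 1 \<le> b * b\<close>, the contents take at most a quarter of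
      the \<open>l\<close> bits; offset and digit together take \<open>b \<le> l / 8\<close>
      more.\<close>
    show "Suc b ^ B * ?H * Suc b \<le> n"
    proof -
      have "Suc b ^ B \<le> (b * b) ^ B" using b1sq by (rule power_mono) simp
      also have "\<dots> = 2 ^ (2 * \<beta> * B)" by (simp only: b(1) power_add[symmetric] power_mult[symmetric] mult_2[symmetric])
      finally have "Suc b ^ B * (?H * Suc b) \<le> 2 ^ (2 * \<beta> * B) * 2 ^ b"
        using q' by (rule mult_le_mono)
      also have "\<dots> = 2 ^ (2 * \<beta> * B + b)" by (simp add: power_add)
      also have "\<dots> \<le> n"
      proof (rule two_n)
        have "8 * b \<le> l" using b4 b(2) by linarith
        moreover have "4 * (2 * \<beta> * B) \<le> l" using lb by (simp add: mult_ac)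
        ultimately show "2 * \<beta> * B + b \<le> l" by linarith
      qed
      finally show ?thesis by (simp only: mult.assoc)
    qed
  qed (rule refl)+
qed

text \<open>The base case is \<open>30 ^ 6 \<le> 2 ^ 30\<close>; the step uses
  \<open>11 ^ 6 \<le> 2 * 10 ^ 6\<close>.\<close>

lemma power6_le_exp: "30 \<le> b \<Longrightarrow> b ^ 6 \<le> 2 ^ b" for b :: nat
proof (induction b rule: nat_induct_at_least)
  case (Suc b)
  have "(10 * Suc b) ^ 6 \<le> (11 * b) ^ 6" using Suc.hyps by (intro power_mono) auto
  then have "10 ^ 6 * Suc b ^ 6 \<le> 11 ^ 6 * b ^ 6" by (simp only: power_mult_distrib)
  then have "Suc b ^ 6 \<le> 2 * b ^ 6" by simp
  then show ?case using Suc.IH by simp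
qed simp

text \<open>The left side has degree 5 in \<open>b\<close>, and a sixth factor \<open>b\<close>
  beats its constant \<open>32 * G + 1\<close>.\<close>

lemma polynomial_le_power:
  "\<exists>b0. \<forall>b\<ge>b0. (b + 1) * (G * (16 * b ^ 4)) + 1 \<le> 2 ^ (b::nat)" for G :: nat
proof (intro exI allI impI)
  fix b assume b: "b \<ge> 30 + 33 * G"
  have "1 \<le> b ^ 5" using b by simp
  then have "(b + 1) * (G * (16 * b ^ 4)) + 1 \<le> (2 * b) * (G * (16 * b ^ 4)) + b ^ 5"
    using b by (intro add_mono mult_le_mono1) auto
  also have "\<dots> = (32 * G + 1) * b ^ 5" by (simp add: algebra_simps power_numeral_reduce)
  also have "\<dots> \<le> b * b ^ 5" using b by (intro mult_le_mono1) simp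
  also have "\<dots> = b ^ 6" by (simp add: power_numeral_reduce)
  also have "\<dots> \<le> 2 ^ b" using b by (intro power6_le_exp) simp
  finally show "(b + 1) * (G * (16 * b ^ 4)) + 1 \<le> 2 ^ b" .
qed

lemma polylog_bound:
  assumes "polylog \<sigma>"
  shows "\<exists>c C n0 :: nat. \<forall>n\<ge>n0. \<forall>l. n < 2 ^ (l + 1) \<longrightarrow> \<sigma> n \<le> C * (l + 1) ^ c"
proof -
  obtain c where "(\<lambda>n. real (\<sigma> n)) \<in> O(\<lambda>n. ln (real n) ^ c)" using assms by (auto simp: polylog_def)
  then obtain C where C: "0 < C" "eventually (\<lambda>n. norm (real (\<sigma> n)) \<le> C * norm (ln (real n) ^ c)) at_top"
    by (elim landau_o.bigE) auto
  then obtain n1 where n1: "\<And>n. n \<ge> n1 \<Longrightarrow> real (\<sigma> n) \<le> C * norm (ln (real n) ^ c)"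
    by (auto simp: eventually_at_top_linorder)
  have "\<sigma> n \<le> nat \<lceil>C\<rceil> * (l + 1) ^ c" if n: "n \<ge> max n1 1" "n < 2 ^ (l + 1)" for n l
  proof -
    have ln0: "0 \<le> ln (real n)" using n by simp
    have "real n \<le> real (2 ^ (l + 1))" using n(2) by (simp only: of_nat_le_iff)
    then have "ln (real n) \<le> ln (real (2 ^ (l + 1)))" using n(1) by (intro ln_mono) auto
    also have "\<dots> = ln (2 ^ (l + 1))" by simp
    also have "\<dots> = real (l + 1) * ln 2" by (rule ln_realpow)
    also have "\<dots> \<le> real (l + 1) * 1" using ln_2_less_1 by (intro mult_left_mono) auto
    finally have "ln (real n) ^ c \<le> real (l + 1) ^ c" using ln0 by (intro power_mono) auto
    then have "C * norm (ln (real n) ^ c) \<le> C * real (l + 1) ^ c" using C(1) ln0 by simp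
    also have "\<dots> \<le> real (nat \<lceil>C\<rceil>) * real (l + 1) ^ c"
      using C(1) by (intro mult_right_mono) (auto simp: real_nat_ceiling_ge)
    finally have "real (\<sigma> n) \<le> real (nat \<lceil>C\<rceil> * (l + 1) ^ c)" using n1[of n] n by simp
    then show ?thesis by (simp only: of_nat_le_iff)
  qed
  then show ?thesis by blast
qed

text \<open>\<open>K\<close> and \<open>G\<close> occur in the program and so must be fixed before
  \<open>n\<close>. From \<open>l < 16 * b ^ 4\<close> the alphabet size is at most
  \<open>C * 16 ^ c * b ^ (4 * c)\<close>, and one more factor \<open>b\<close> swallows the
  constant; whence \<open>K = 4 * c + 1\<close>.\<close>

lemma params_exist:
  assumes "polylog \<sigma>"
  shows "\<exists>K G n0. \<forall>n\<ge>n0. \<forall>w. n < 2 ^ w \<longrightarrow>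
     (\<exists>b T B b1 H nb nsb q0 levels. params n w (\<sigma> n) b K T B G b1 H nb nsb q0 levels)"
proof -
  obtain c C n1 :: nat where \<sigma>: "\<And>n l. n \<ge> n1 \<Longrightarrow> n < 2 ^ (l + 1) \<Longrightarrow> \<sigma> n \<le> C * (l + 1) ^ c"
    using polylog_bound[OF assms] by blast
  define K where "K = 4 * c + 1"
  define G where "G = 72 * (K + 1)"
  obtain b0 where b0: "\<And>b. b \<ge> b0 \<Longrightarrow> (b + 1) * (G * (16 * b ^ 4)) + 1 \<le> 2 ^ (b::nat)"
    using polynomial_le_power by blast
  \<comment> \<open>Because \<open>\<beta> < 2 ^ \<beta>\<close>, it suffices to bound the exponent
    below by all the constants that \<open>b\<close> has to exceed.\<close>
  define \<beta>0 where "\<beta>0 = Max {1, b0, K, C * 16 ^ c}"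
  have \<beta>0: "1 \<le> \<beta>0" "b0 \<le> \<beta>0" "K \<le> \<beta>0" "C * 16 ^ c \<le> \<beta>0" by (auto simp: \<beta>0_def)
  define n0 where "n0 = max n1 (2 ^ (16 ^ \<beta>0))"
  have "\<exists>b T B b1 H nb nsb q0 levels. params n w (\<sigma> n) b K T B G b1 H nb nsb q0 levels"
    if n: "n \<ge> n0" and w: "n < 2 ^ w" for n w
  proof -
    have n2: "2 ^ (16 ^ \<beta>0) \<le> n" using n by (simp add: n0_def)
    then have "1 \<le> n" by (meson one_le_numeral one_le_power order_trans)
    then obtain l where l: "2 ^ l \<le> n" "n < 2 ^ (l + 1)" using ex_power_ivl1[of 2 n] by auto
    have "(2::nat) ^ (16 ^ \<beta>0) < 2 ^ (l + 1)" using n2 l(2) by linarith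
    then have "16 ^ \<beta>0 < l + 1" by (rule power_less_imp_less_exp[rotated]) simp
    then have l16: "16 ^ \<beta>0 \<le> l" by simp
    then have "1 \<le> l" by (meson one_le_numeral one_le_power order_trans)
    \<comment> \<open>Rounding the logarithm of \<open>l\<close> to base 16 gives
      \<open>b ^ 4 = 16 ^ \<beta>\<close> with \<open>b\<close> a power of two.\<close>
    then obtain \<beta> where \<beta>: "16 ^ \<beta> \<le> l" "l < 16 ^ (\<beta> + 1)" using ex_power_ivl1[of 16 l] by auto
    have "(16::nat) ^ \<beta>0 < 16 ^ (\<beta> + 1)" using l16 \<beta>(2) by linarith
    then have "\<beta>0 < \<beta> + 1" by (rule power_less_imp_less_exp[rotated]) simp
    then have \<beta>\<beta>: "\<beta>0 \<le> \<beta>" by simp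
    define b :: nat where "b = 2 ^ \<beta>"
    have "b ^ 4 = 16 ^ \<beta>" by (simp add: b_def power_mult[symmetric] mult.commute[of \<beta>]) (simp add: power_mult)
    then have b4: "b ^ 4 \<le> l" "l < 16 * b ^ 4" using \<beta> by auto
    have "\<beta> < b" by (simp add: b_def)
    then have bge: "b0 \<le> b" "K \<le> b" "C * 16 ^ c \<le> b" using \<beta>0 \<beta>\<beta> by linarith+
    have "\<sigma> n \<le> C * (l + 1) ^ c" using \<sigma> n l by (simp add: n0_def)
    also have "\<dots> \<le> C * (16 * b ^ 4) ^ c" using b4(2) by (intro mult_le_mono2 power_mono) auto
    also have "\<dots> = (C * 16 ^ c) * b ^ (4 * c)" by (simp add: power_mult_distrib power_mult)
    also have "\<dots> \<le> b * b ^ (4 * c)" using bge by (intro mult_le_mono1)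
    also have "\<dots> = b ^ K" by (simp add: K_def)
    finally have "\<sigma> n \<le> b ^ K" .
    then show ?thesis
      using params_if_large_base[OF l w b_def b4 _ _ bge(2) _ G_def b0[OF bge(1)] refl refl] \<beta>0(1) \<beta>\<beta> K_def
      by fastforce
  qed
  then show ?thesis by blast
qed

section \<open>Stored data and the three problems for large inputs\<close>

lemma index_exists:
  assumes "params n w \<sigma> b K T B G b1 H nb nsb q0 levels"
    and "X \<in> lists {..<\<sigma>}" "Y \<in> lists {..<\<sigma>}" "length X \<le> n" "length Y \<le> n"
    and "length pts \<le> n" "\<And>y. y \<in> set pts \<Longrightarrow> y \<le> length Y"
    and vm: "length vm \<le> Suc n" "set vm \<subseteq> {..n}" and wv: "length wv \<le> Suc n" "set wv \<subseteq> {..n}" and \<delta>: "\<delta> \<le> n"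
  shows "\<exists>D. index n w \<sigma> b K T B G b1 H nb nsb q0 levels X Y pts D \<delta> vm wv \<and>
     data_structure w ((12 + 2 * G) * n) D \<and> cell D 0 0 = 0"
proof -
  interpret params n w \<sigma> b K T B G b1 H nb nsb q0 levels by fact
  interpret rank_matrix n w \<sigma> b K T B G b1 H nb nsb q0 levels "index_matrix b K T n X Y pts"
    by unfold_locales (use b_ge in \<open>simp add: index_matrix_le\<close>)
  define F where "F = [[0, H, nb, nsb, b1, q0, n, b, T, length X, length Y, 2 * K + T, \<delta>],
    sup_seg, rel_seg, pow_seg, map (\<lambda>s. b ^ s) [0..<K], map (\<lambda>t. b ^ (T - 1 - t)) [0..<T],
    map (last_adjust X) [0..<Suc \<sigma>], map (last_adjust Y) [0..<Suc \<sigma>], vm, wv]"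
  define D where "D = F @ map cont_seg [0..<G] @ map tab_seg [0..<G]"
  have lF: "length F = 10" by (simp add: F_def)
  have nth: "D ! k = F ! k" if "k < 10" for k using that lF by (simp add: D_def nth_append)
  have ix: "index n w \<sigma> b K T B G b1 H nb nsb q0 levels X Y pts D \<delta> vm wv"
  proof
    show "length D = 10 + 2 * G" by (simp add: D_def lF)
    show "D ! (10 + r) = cont_seg r" if "r < G" for r using that lF by (simp add: D_def nth_append)
    show "D ! (10 + G + r) = tab_seg r" if "r < G" for r using that lF by (simp add: D_def nth_append)
  qed (simp_all add: nth F_def assms del: upt_Suc)
  have nw: "x < 2 ^ w" if "x \<le> n" for x using that n_w by linarith
  have bp: "0 < b" using b_ge by simp
  have pK: "b ^ s \<le> n" if "s < K" for s
    by (rule order_trans[OF power_increasing b_K]) (use bp that in auto)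
  have pT: "b ^ (T - 1 - t) \<le> n" for t
    by (rule order_trans[OF power_increasing b_T]) (use bp in auto)
  have words: "set Z \<subseteq> {..<2 ^ w}" if "Z \<in> set D" for Z
  proof -
    have la: "last_adjust Z c \<le> n" for Z c using n_big by (simp add: last_adjust_def)
    from that consider "Z \<in> set F" | r where "Z = cont_seg r" | r where "Z = tab_seg r" by (auto simp: D_def)
    then show ?thesis
    proof cases
      case 1
      then show ?thesis using sup_seg_words rel_seg_words pow_seg_words scalars_le vm(2) wv(2) \<delta> assms(4,5) nw nw[OF pK] nw[OF pT] nw[OF la]
        unfolding F_def by (auto simp del: upt_Suc)
    next
      case 2 then show ?thesis using cont_seg_words by simp
    next
      case 3 then show ?thesis using tab_seg_words by simp
    qed
  qed
  have "sum_list (map length F) \<le> 12 * n"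
    using n_big sup_size rel_size scalars_le sigma_n vm(1) wv(1)
    by (simp add: F_def sup_seg_def rel_seg_def pow_seg_def)
  moreover have "sum_list (map length (map cont_seg [0..<G])) \<le> G * n"
  proof -
    have "sum_list (map (\<lambda>r. length (cont_seg r)) [0..<G]) \<le> sum_list (map (\<lambda>r. n) [0..<G])"
      by (rule sum_list_mono) (use rel_size in \<open>simp add: cont_seg_def\<close>)
    then show ?thesis by (simp add: comp_def sum_list_triv)
  qed
  moreover have "sum_list (map length (map tab_seg [0..<G])) \<le> G * n"
  proof -
    have "sum_list (map (\<lambda>r. length (tab_seg r)) [0..<G]) \<le> sum_list (map (\<lambda>r. n) [0..<G])"
      by (rule sum_list_mono) (use tab_size in \<open>simp add: tab_seg_def\<close>)
    then show ?thesis by (simp add: comp_def sum_list_triv)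
  qed
  ultimately have "sum_list (map length D) \<le> (12 + 2 * G) * n"
    by (simp add: D_def algebra_simps del: map_map)
  moreover have "cell D 0 0 = 0" by (simp add: cell_def D_def F_def)
  ultimately show ?thesis using ix words by (auto simp: data_structure_def)
qed

lemma set_filter_counts: "length A \<le> n \<Longrightarrow> set (filter_counts n R A) \<subseteq> {..n}"
  by (auto simp: filter_counts_def simp del: upt_Suc intro!: order_trans[OF length_filter_le])

text \<open>Stated for commands rather than machine code, because two commands still have to be
  joined into one program. The budget is \<open>t\<close> loop iterations per pattern
  character.\<close>

definition serves :: "nat \<Rightarrow> nat \<Rightarrow> com \<Rightarrow> nat \<Rightarrow> (nat list \<Rightarrow> nat list list \<Rightarrow> bool) \<Rightarrow>
    (nat list \<Rightarrow> nat list list \<Rightarrow> nat) \<Rightarrow> nat list list \<Rightarrow> bool" where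
  "serves w s c t valid ans D \<longleftrightarrow> data_structure w s D \<and>
    (\<forall>args Q. valid args Q \<longrightarrow> computes w D Q args c (sum_list (map length Q) * t) (ans args Q))"

definition interval_query :: "nat \<Rightarrow> nat \<Rightarrow> nat \<Rightarrow> nat list \<Rightarrow> nat list list \<Rightarrow> bool" where
  "interval_query \<sigma> n w args Q \<longleftrightarrow> (\<exists>P i j. args = [length P, i, j] \<and> Q = [P] \<and> P \<in> lists {..<\<sigma>} \<and>
    length P < 2 ^ w \<and> 1 \<le> i \<and> i \<le> j \<and> j \<le> n)"

definition pair_query :: "nat \<Rightarrow> nat \<Rightarrow> nat list \<Rightarrow> nat list list \<Rightarrow> bool" where
  "pair_query \<sigma> w args Q \<longleftrightarrow> (\<exists>P1 P2. args = [length P1, length P2] \<and> Q = [P1, P2] \<and>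
    P1 \<in> lists {..<\<sigma>} \<and> P2 \<in> lists {..<\<sigma>} \<and> length P1 < 2 ^ w \<and> length P2 < 2 ^ w)"

definition interval_answer :: "nat list \<Rightarrow> (nat \<Rightarrow> bool) \<Rightarrow> nat list \<Rightarrow> nat list list \<Rightarrow> nat" where
  "interval_answer S U args Q = card {k \<in> {args ! 1..args ! 2}. occurs_at (Q ! 0) S k \<and> U k}"

definition gap_answer :: "nat list \<Rightarrow> nat \<Rightarrow> nat list \<Rightarrow> nat list list \<Rightarrow> nat" where
  "gap_answer S d args Q =
    card {k \<in> {1..length S}. occurs_at (Q ! 0) S k \<and> occurs_at (Q ! 1) S (k + length (Q ! 0) + d)}"

definition aligned_answer :: "nat list \<Rightarrow> nat list \<Rightarrow> nat list \<Rightarrow> nat list list \<Rightarrow> nat" where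
  "aligned_answer S1 S2 args Q =
    card {k \<in> {1..min (length S1) (length S2)}. occurs_at (Q ! 0) S1 k \<and> occurs_at (Q ! 1) S2 k}"

lemma serves_intervalsI:
  assumes "data_structure w s D" "\<And>P i j. P \<in> lists {..<\<sigma>} \<Longrightarrow> length P < 2 ^ w \<Longrightarrow> 1 \<le> i \<Longrightarrow> i \<le> j \<Longrightarrow> j \<le> n \<Longrightarrow>
    computes w D [P] [length P, i, j] c (length P * t) (ans [length P, i, j] [P])"
  shows "serves w s c t (interval_query \<sigma> n w) ans D"
proof -
  have "computes w D Q args c (sum_list (map length Q) * t) (ans args Q)" if v: "interval_query \<sigma> n w args Q" for args Q
  proof -
    obtain P i j where *: "args = [length P, i, j]" "Q = [P]" and h: "P \<in> lists {..<\<sigma>}" "length P < 2 ^ w" "1 \<le> i" "i \<le> j" "j \<le> n"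
      using v unfolding interval_query_def by blast
    show ?thesis using assms(2)[OF h] by (simp add: *)
  qed
  then show ?thesis using assms(1) by (simp add: serves_def)
qed

lemma serves_pairsI:
  assumes "data_structure w s D" "\<And>P1 P2. P1 \<in> lists {..<\<sigma>} \<Longrightarrow> length P1 < 2 ^ w \<Longrightarrow> P2 \<in> lists {..<\<sigma>} \<Longrightarrow> length P2 < 2 ^ w \<Longrightarrow>
    computes w D [P1, P2] [length P1, length P2] c ((length P1 + length P2) * t) (ans [length P1, length P2] [P1, P2])"
  shows "serves w s c t (pair_query \<sigma> w) ans D"
proof -
  have "computes w D Q args c (sum_list (map length Q) * t) (ans args Q)" if v: "pair_query \<sigma> w args Q" for args Q
  proof -
    obtain P1 P2 where *: "args = [length P1, length P2]" "Q = [P1, P2]"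
      and h: "P1 \<in> lists {..<\<sigma>}" "length P1 < 2 ^ w" "P2 \<in> lists {..<\<sigma>}" "length P2 < 2 ^ w"
      using v unfolding pair_query_def by blast
    show ?thesis using assms(2)[OF h] by (simp add: *)
  qed
  then show ?thesis using assms(1) by (simp add: serves_def)
qed

context
  fixes n w \<sigma> b K T B G b1 H nb nsb q0 levels :: nat
  assumes par: "params n w \<sigma> b K T B G b1 H nb nsb q0 levels"
begin

text \<open>\<open>U\<close> is an arbitrary property of positions: constantly true for plain
  counting, membership in the union for a set of intervals. The points are the positions with
  \<open>U\<close> in text order.\<close>

lemma interval_large:
  assumes S: "S \<in> lists {..<\<sigma>}" "length S = n"
  shows "\<exists>D. serves w ((12 + 2 * G) * n) (interval_com G K) (2 * K + 4) (interval_query \<sigma> n w) (interval_answer S U) D \<and>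
    cell D 0 0 = 0"
proof -
  let ?A = "[0..<n]" and ?R = "\<lambda>y. U (Suc y)"
  let ?vm = "filter_counts n ?R ?A"
  obtain D where D: "index n w \<sigma> b K T B G b1 H nb nsb q0 levels [] S (filter ?R ?A) D 0 ?vm []"
    "data_structure w ((12 + 2 * G) * n) D" "cell D 0 0 = 0"
    using index_exists[OF par, of "[]" S "filter ?R ?A" ?vm "[]" 0] S set_filter_counts[of ?A n ?R] length_filter_le[of ?R ?A] by auto
  interpret index n w \<sigma> b K T B G b1 H nb nsb q0 levels "[]" S "filter ?R ?A" D 0 ?vm "[]" by (fact D(1))
  have "computes w D [P] [length P, i, j] (interval_com G K) (length P * (2 * K + 4)) (interval_answer S U [length P, i, j] [P])"
    if "P \<in> lists {..<\<sigma>}" "length P < 2 ^ w" and ij: "1 \<le> i" "i \<le> j" "j \<le> n" for P i j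
  proof -
    have ij': "i - 1 \<le> j" "j \<le> n" using ij by auto
    note fc = filter_counts_slice[OF ij', of ?R ?A]
    show ?thesis
      using interval_com_correct[OF that length_filter_counts fc(1,2)]
      unfolding fc(3) interval_count[OF S(2) ij] by (simp add: interval_answer_def)
  qed
  from serves_intervalsI[OF D(2) this] show ?thesis using D(3) by blast
qed

text \<open>Points are positions in the suffix array order of \<open>S1\<close>, which makes the
  matches of \<open>P1\<close> contiguous; positions beyond the end of \<open>S2\<close> are
  dropped.\<close>

lemma aligned_large:
  assumes S: "S1 \<in> lists {..<\<sigma>}" "S2 \<in> lists {..<\<sigma>}" "length S1 + length S2 = n"
  shows "\<exists>D. serves w ((12 + 2 * G) * n) (aligned_com G K) (2 * K + 4) (pair_query \<sigma> w) (aligned_answer S1 S2) D \<and>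
    cell D 0 0 = 0"
proof -
  let ?A = "suffix_array S1" and ?R = "\<lambda>y. y < length S2"
  let ?vm = "filter_counts n ?R ?A"
  obtain D where D: "index n w \<sigma> b K T B G b1 H nb nsb q0 levels S1 S2 (filter ?R ?A) D 0 ?vm []"
    "data_structure w ((12 + 2 * G) * n) D" "cell D 0 0 = 0"
    using index_exists[OF par, of S1 S2 "filter ?R ?A" ?vm "[]" 0] S set_filter_counts[of ?A n ?R] length_filter_le[of ?R ?A] by auto
  interpret index n w \<sigma> b K T B G b1 H nb nsb q0 levels S1 S2 "filter ?R ?A" D 0 ?vm "[]" by (fact D(1))
  have "computes w D [P1, P2] [length P1, length P2] (aligned_com G K) ((length P1 + length P2) * (2 * K + 4))
      (aligned_answer S1 S2 [length P1, length P2] [P1, P2])"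
    if "P1 \<in> lists {..<\<sigma>}" "length P1 < 2 ^ w" "P2 \<in> lists {..<\<sigma>}" "length P2 < 2 ^ w" for P1 P2
  proof -
    have lh: "sa_low S1 P1 \<le> sa_high S1 P1" "sa_high S1 P1 \<le> n" using sa_low_high[of S1 P1] S(3) by auto
    note fc = filter_counts_slice[OF lh, of ?R ?A]
    show ?thesis
      using aligned_com_correct[OF that length_filter_counts fc(1,2)]
      unfolding fc(3) suffix_array_slice aligned_count by (simp add: aligned_answer_def)
  qed
  from serves_pairsI[OF D(2) this] show ?thesis using D(3) by blast
qed

text \<open>A point is the offset at which \<open>P2\<close> has to start, listed in the suffix
  array order of the reversed text.\<close>

lemma gap_large:
  assumes S: "S \<in> lists {..<\<sigma>}" "length S = n"
  shows "\<exists>D. serves w ((12 + 2 * G) * n) (gap_com G K) (2 * K + 4) (pair_query \<sigma> w) (gap_answer S d) D \<and>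
    cell D 0 0 = 0"
proof -
  let ?A = "suffix_array (rev S)" and ?R = "\<lambda>t. d \<le> t" and ?A' = "suffix_array S"
  let ?vm = "filter_counts n ?R ?A" and ?wv = "filter_counts n ?R ?A'"
  let ?pts = "map (\<lambda>t. n - t + d) (filter ?R ?A)"
  let ?\<delta> = "if 1 \<le> d \<and> d \<le> n then 1 else 0 :: nat"
  have n1: "1 \<le> n" using par params.n_big by force
  have pts: "y \<le> length S" if "y \<in> set ?pts" for y using that S(2) by auto
  have rS: "rev S \<in> lists {..<\<sigma>}" using S(1) by (simp add: lists_eq_set)
  have "\<exists>D. index n w \<sigma> b K T B G b1 H nb nsb q0 levels (rev S) S ?pts D ?\<delta> ?vm ?wv \<and>
    data_structure w ((12 + 2 * G) * n) D \<and> cell D 0 0 = 0"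
  proof (rule index_exists[OF par rS S(1)])
    show "length ?pts \<le> n" using length_filter_le[of ?R ?A] S(2) by simp
    show "set ?vm \<subseteq> {..n}" "set ?wv \<subseteq> {..n}" using S(2) by (intro set_filter_counts; simp)+
    show "?\<delta> \<le> n" using n1 by simp
  qed (use S(2) pts in auto)
  then obtain D where D: "index n w \<sigma> b K T B G b1 H nb nsb q0 levels (rev S) S ?pts D ?\<delta> ?vm ?wv"
    "data_structure w ((12 + 2 * G) * n) D" "cell D 0 0 = 0" by blast
  interpret index n w \<sigma> b K T B G b1 H nb nsb q0 levels "rev S" S ?pts D ?\<delta> ?vm ?wv by (fact D(1))
  have "computes w D [P1, P2] [length P1, length P2] (gap_com G K) ((length P1 + length P2) * (2 * K + 4))
      (gap_answer S d [length P1, length P2] [P1, P2])"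
    if P: "P1 \<in> lists {..<\<sigma>}" "length P1 < 2 ^ w" "P2 \<in> lists {..<\<sigma>}" "length P2 < 2 ^ w" for P1 P2
  proof -
    let ?lo = "sa_low (rev S) (rev P1)" and ?hi = "sa_high (rev S) (rev P1)"
    have lh: "?lo \<le> ?hi" "?hi \<le> n" using sa_low_high[of "rev S" "rev P1"] S(2) by auto
    have lh': "sa_low S P2 \<le> sa_high S P2" "sa_high S P2 \<le> n" using sa_low_high[of S P2] S(2) by auto
    note fc = filter_counts_slice[OF lh, of ?R ?A]
    note fc' = filter_counts_slice[OF lh', of ?R ?A']
    \<comment> \<open>The correction is 1 only for \<open>1 \<le> d \<le> n\<close>, so after adding
      it to a count of at most \<open>n - d\<close> the total is still at most
      \<open>n\<close>.\<close>
    have "length (filter ?R ?A') = n - d"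
    proof -
      have "{a \<in> set ?A'. d \<le> a} = {d..<n}" using S(2) by auto
      then show ?thesis by (simp add: length_filter_card distinct_suffix_array)
    qed
    then have "?wv ! sa_high S P2 \<le> n - d" using fc'(2) by (simp only:)
    moreover have "x + ?\<delta> \<le> n" if "x \<le> n - d" for x using that by auto
    ultimately have wd: "?wv ! sa_high S P2 + ?\<delta> \<le> n" by blast
    have sl: "drop (?vm ! ?lo) (take (?vm ! ?hi) ?pts) = map (\<lambda>t. n - t + d) (filter ?R (filter (\<lambda>t. is_prefix (rev P1) (drop t (rev S))) ?A))"
      unfolding take_map drop_map fc(3) suffix_array_slice ..
    have v: "?vm ! ?hi \<le> length ?pts" using fc(2) by simp
    note main = gap_com_correct[OF P length_filter_counts fc(1) v length_filter_counts fc'(1) wd]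
    show ?thesis
    proof (rule hoare_conseq[OF main])
      fix s :: "nat \<Rightarrow> nat"
      assume s: "s 0 = (if P1 = [] then ?wv ! sa_high S P2 - ?wv ! sa_low S P2 + (if P2 = [] then ?\<delta> else 0)
         else length (filter (\<lambda>y. is_prefix P2 (drop y S)) (drop (?vm ! ?lo) (take (?vm ! ?hi) ?pts))))"
      show "s 0 = gap_answer S d [length P1, length P2] [P1, P2]"
      proof (cases "P1 = []")
        case True
        then show ?thesis using s gap_count_Nil[OF S(2), of d P2] unfolding fc'(4) suffix_array_slice by (simp add: gap_answer_def S(2))
      next
        case False
        then show ?thesis using s gap_count[OF S(2) False, of P2 d] unfolding sl by (simp add: gap_answer_def S(2))
      qed
    qed auto
  qed
  from serves_pairsI[OF D(2) this] show ?thesis using D(3) by blast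
qed

end

section \<open>Small inputs and the theorem\<close>

lemma xor_eq_0_iff_nat: "xor a b = 0 \<longleftrightarrow> a = b" for a b :: nat
  by (auto simp: bit_eq_iff bit_xor_iff)

lemma or_eq_0_iff_nat: "or a b = 0 \<longleftrightarrow> a = 0 \<and> b = 0" for a b :: nat
  by (auto simp: bit_eq_iff bit_or_iff)

text \<open>With \<open>BitXor\<close> terms this tests all components of a key at once: the result
  is 0 exactly if they all agree.\<close>

fun or_expr :: "nat \<Rightarrow> (nat \<Rightarrow> expr) \<Rightarrow> expr" where
  "or_expr 0 f = N 0"
| "or_expr (Suc g) f = Op BitOr (or_expr g f) (f g)"

lemma ev_or_expr: "ev w D Q s (or_expr g f) = 0 \<longleftrightarrow> (\<forall>i<g. ev w D Q s (f i) = 0)"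
  by (induction g) (auto simp: less_Suc_eq or_eq_0_iff_nat)

lemma expr_below_or_expr: "(\<And>r. r < g \<Longrightarrow> expr_below k (f r)) \<Longrightarrow> expr_below k (or_expr g f)"
  by (induction g) auto

text \<open>For \<open>n < n0\<close> there are boundedly many relevant queries, and all answers are tabulated. Since
  \<open>2 ^ w\<close> may be tiny, every table entry gets a segment of its own, and constants occurring in
  queries are compared with stored words rather than with literals, which would be reduced
  modulo \<open>2 ^ w\<close>. The leading \<open>1\<close> of the key distinguishes entries from absent ones.\<close>

definition key_expr :: "nat \<Rightarrow> nat \<Rightarrow> expr" where
  "key_expr n0 i =
    (if i = 0 then N 1 else if i < 4 then V (i - 1)
     else if i < 4 + n0 then Qu 0 (N (i - 4)) else Qu 1 (N (i - 4 - n0)))"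

text \<open>The leading 1, three scalar arguments, and \<open>n0\<close> characters of each of two
  patterns.\<close>

definition key_len :: "nat \<Rightarrow> nat" where
  "key_len n0 = 4 + 2 * n0"

definition key :: "nat \<Rightarrow> nat \<Rightarrow> nat list \<Rightarrow> nat list list \<Rightarrow> nat \<Rightarrow> nat" where
  "key n0 w args Q i = ev w [] Q (regs (init args)) (key_expr n0 i)"

text \<open>Component \<open>key_len n0\<close> of an entry holds its answer. Segment 0 stays free
  for the tag.\<close>

definition entry_seg :: "nat \<Rightarrow> nat \<Rightarrow> nat \<Rightarrow> nat" where
  "entry_seg n0 t i = 1 + (t * Suc (key_len n0) + i)"

fun lookup_com :: "nat \<Rightarrow> nat \<Rightarrow> com" where
  "lookup_com n0 0 = Skip"
| "lookup_com n0 (Suc t) = lookup_com n0 t ;;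
    If (or_expr (key_len n0) (\<lambda>i. Op BitXor (key_expr n0 i) (St (entry_seg n0 t i) (N 0)))) (N 1)
      (Set 3 (St (entry_seg n0 t (key_len n0)) (N 0))) Skip"

lemma com_below_lookup: "com_below 20 (lookup_com n0 t)"
  by (induction t) (auto simp: key_expr_def intro!: expr_below_or_expr)

fun lookup :: "(nat \<Rightarrow> nat \<Rightarrow> nat) \<Rightarrow> nat \<Rightarrow> (nat \<Rightarrow> nat) \<Rightarrow> nat \<Rightarrow> nat" where
  "lookup E W k 0 = 0"
| "lookup E W k (Suc t) = (if \<forall>i<W. k i = E t i then E t W else lookup E W k t)"

lemma lookup_eq:
  assumes "\<And>t. t < m \<Longrightarrow> \<forall>i<W. k i = E t i \<Longrightarrow> E t W = v"
    "(\<exists>t<m. \<forall>i<W. k i = E t i) \<or> v = 0"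
  shows "lookup E W k m = v"
  using assms
proof (induction m)
  case (Suc m)
  show ?case
  proof (cases "\<forall>i<W. k i = E m i")
    case True
    then show ?thesis using Suc.prems(1)[of m] by simp
  next
    case False
    then have "(\<exists>t<m. \<forall>i<W. k i = E t i) \<or> v = 0" using Suc.prems(2) less_Suc_eq by metis
    then have "lookup E W k m = v" using Suc.prems(1) by (intro Suc.IH) auto
    then show ?thesis using False by auto
  qed
qed simp

lemma lookup_com_correct:
  assumes E: "\<And>t i. t < m \<Longrightarrow> i \<le> key_len n0 \<Longrightarrow> cell D (entry_seg n0 t i) 0 = E t i"
    and w: "0 < w" and args: "length args \<le> 3"
  shows "hoare w D Q (\<lambda>s. s = regs (init args)) (lookup_com n0 m) 0
     (\<lambda>s. s 3 = lookup E (key_len n0) (key n0 w args Q) m \<and> (\<forall>r<3. s r = regs (init args) r))"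
  using E
proof (induction m)
  case 0
  show ?case using args by (auto simp: init_def intro!: hoare_Skip)
next
  case (Suc m)
  let ?W = "key_len n0" and ?k = "key n0 w args Q"
  let ?c = "or_expr ?W (\<lambda>i. Op BitXor (key_expr n0 i) (St (entry_seg n0 m i) (N 0)))"
  let ?J = "\<lambda>s. s 3 = lookup E ?W ?k m \<and> (\<forall>r<3. s r = regs (init args) r)"
  have IH: "hoare w D Q (\<lambda>s. s = regs (init args)) (lookup_com n0 m) 0 ?J"
    using Suc by auto
  have key: "ev w D Q s (key_expr n0 i) = ?k i" if "?J s" for s i
    using that unfolding key_def key_expr_def by auto
  have c: "ev w D Q s ?c < ev w D Q s (N 1) \<longleftrightarrow> (\<forall>i<?W. ?k i = E m i)" if "?J s" for s
  proof -
    have "ev w D Q s (N 1) = 1" using w by simp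
    then have "ev w D Q s ?c < ev w D Q s (N 1) \<longleftrightarrow> ev w D Q s ?c = 0" by simp
    also have "\<dots> \<longleftrightarrow> (\<forall>i<?W. ?k i = E m i)"
      unfolding ev_or_expr ev.simps(3) key[OF that] using Suc.prems[of m] by (simp add: xor_eq_0_iff_nat)
    finally show ?thesis .
  qed
  have "hoare w D Q ?J (If ?c (N 1) (Set 3 (St (entry_seg n0 m ?W) (N 0))) Skip) 0
     (\<lambda>s. s 3 = lookup E ?W ?k (Suc m) \<and> (\<forall>r<3. s r = regs (init args) r))"
  proof (rule hoare_If)
    show "hoare w D Q (\<lambda>s. ?J s \<and> ev w D Q s ?c < ev w D Q s (N 1)) (Set 3 (St (entry_seg n0 m ?W) (N 0))) 0
     (\<lambda>s. s 3 = lookup E ?W ?k (Suc m) \<and> (\<forall>r<3. s r = regs (init args) r))"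
    proof (rule hoare_Set)
      fix s assume s: "?J s \<and> ev w D Q s ?c < ev w D Q s (N 1)"
      then have m: "\<forall>i<?W. ?k i = E m i" using c by blast
      have "ev w D Q s (St (entry_seg n0 m ?W) (N 0)) = E m ?W" using Suc.prems[of m ?W] by simp
      then show "(s(3 := ev w D Q s (St (entry_seg n0 m ?W) (N 0)))) 3 = lookup E ?W ?k (Suc m) \<and>
        (\<forall>r<3. (s(3 := ev w D Q s (St (entry_seg n0 m ?W) (N 0)))) r = regs (init args) r)"
        using m s by (simp del: ev.simps)
    qed
    show "hoare w D Q (\<lambda>s. ?J s \<and> \<not> ev w D Q s ?c < ev w D Q s (N 1)) Skip 0
     (\<lambda>s. s 3 = lookup E ?W ?k (Suc m) \<and> (\<forall>r<3. s r = regs (init args) r))"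
    proof (rule hoare_Skip)
      fix s assume s: "?J s \<and> \<not> ev w D Q s ?c < ev w D Q s (N 1)"
      then have "\<not> (\<forall>i<?W. ?k i = E m i)" using c by blast
      then show "s 3 = lookup E ?W ?k (Suc m) \<and> (\<forall>r<3. s r = regs (init args) r)"
        using s by auto
    qed
  qed
  then show ?case unfolding lookup_com.simps by (rule hoare_Seq[OF IH]) simp
qed

definition query_shape :: "nat \<Rightarrow> nat \<Rightarrow> nat list \<Rightarrow> nat list list \<Rightarrow> bool" where
  "query_shape nq na args Q \<longleftrightarrow> length Q = nq \<and> length args = na \<and> take nq args = map length Q"

text \<open>The arguments contain the pattern lengths, so equal keys force equal lengths, and only
  characters at addresses below \<open>n\<close> matter. For these the literal addresses survive
  reduction modulo \<open>2 ^ w\<close>.\<close>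

lemma key_inj:
  assumes sh: "query_shape nq na args Q" "query_shape nq na args' Q'" and l: "nq \<le> 2" "na \<le> 3"
    and keys: "\<forall>i<key_len n0. key n0 w args Q i = key n0 w args' Q' i"
    and len: "\<And>P. P \<in> set Q' \<Longrightarrow> length P \<le> n" and n: "n < n0" "n < 2 ^ w"
  shows "args = args' \<and> Q = Q'"
proof -
  have "args = args'"
  proof (rule nth_equalityI)
    fix r assume r: "r < length args"
    then have "key n0 w args Q (r + 1) = key n0 w args' Q' (r + 1)" using keys l(2) sh by (auto simp: key_len_def query_shape_def)
    then show "args ! r = args' ! r" using r l(2) sh by (auto simp: key_def key_expr_def init_def query_shape_def)
  qed (use sh in \<open>simp add: query_shape_def\<close>)
  moreover have "Q = Q'"
  proof (rule nth_equalityI)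
    fix q assume q: "q < length Q"
    have ml: "map length Q = map length Q'" using sh \<open>args = args'\<close> by (simp add: query_shape_def)
    then have lq: "length (Q ! q) = length (Q' ! q)" using q by (metis length_map nth_map)
    have q': "q < length Q'" using q ml by (metis length_map)
    then have ln: "length (Q' ! q) \<le> n" using len by simp
    show "Q ! q = Q' ! q"
    proof (rule nth_equalityI[OF lq])
      fix a assume a: "a < length (Q ! q)"
      then have an: "a < n0" "a < 2 ^ w" using ln lq n by linarith+
      have "q = 0 \<or> q = 1" using q l(1) sh by (auto simp: query_shape_def)
      then show "Q ! q ! a = Q' ! q ! a"
      proof
        assume "q = 0"
        have "key n0 w args Q (4 + a) = key n0 w args' Q' (4 + a)" using keys an by (auto simp: key_len_def)
        then show ?thesis using a an lq q q' \<open>q = 0\<close> by (simp add: key_def key_expr_def cell_def)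
      next
        assume "q = 1"
        have "key n0 w args Q (4 + n0 + a) = key n0 w args' Q' (4 + n0 + a)" using keys an by (auto simp: key_len_def)
        then show ?thesis using a an lq q q' \<open>q = 1\<close> by (simp add: key_def key_expr_def cell_def)
      qed
    qed
  qed (use sh in \<open>simp add: query_shape_def\<close>)
  ultimately show ?thesis by blast
qed

lemma key_less:
  assumes "0 < w" "set args \<subseteq> {..<2 ^ w}" "\<And>P. P \<in> set Q \<Longrightarrow> set P \<subseteq> {..<2 ^ w}"
  shows "key n0 w args Q i < 2 ^ w"
proof -
  have "1 < (2::nat) ^ w" using assms(1) by (intro one_less_power) auto
  moreover have "regs (init args) r < 2 ^ w" for r using assms(2) by (auto simp: init_def dest!: nth_mem)
  moreover have "cell Q k a < 2 ^ w" for k a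
    using assms(3)[of "Q ! k"] by (force simp: cell_def dest: nth_mem)
  ultimately show ?thesis by (auto simp: key_def key_expr_def)
qed

text \<open>What makes a finite table sufficient: a pattern longer than \<open>n\<close> has answer
  0, so such queries may fall through to a default.\<close>

definition bounded_queries :: "nat \<Rightarrow> nat \<Rightarrow> nat \<Rightarrow> nat \<Rightarrow> nat \<Rightarrow> (nat list \<Rightarrow> nat list list \<Rightarrow> bool) \<Rightarrow>
    (nat list \<Rightarrow> nat list list \<Rightarrow> nat) \<Rightarrow> bool" where
  "bounded_queries nq na \<sigma> n w valid ans \<longleftrightarrow> (\<forall>args Q. valid args Q \<longrightarrow>
     query_shape nq na args Q \<and> set (drop nq args) \<subseteq> {..n} \<and> (\<forall>P\<in>set Q. P \<in> lists {..<\<sigma>}) \<and>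
     ans args Q \<le> n \<and> ((\<exists>P\<in>set Q. n < length P) \<longrightarrow> ans args Q = 0))"

text \<open>The program must not depend on the instance, so \<open>ql\<close> runs through all
  conceivable queries for lengths below \<open>n0\<close> and alphabets up to
  \<open>\<sigma>m\<close>; the stored data decide which entries are active.\<close>

lemma table_exists:
  fixes n0 \<sigma>m nq na :: nat
  assumes l: "nq \<le> 2" "na \<le> 3"
  shows "\<exists>c C. com_below 20 c \<and> (\<forall>n w \<sigma> valid ans. n < n0 \<longrightarrow> n < 2 ^ w \<longrightarrow> 0 < w \<longrightarrow> \<sigma> \<le> 2 ^ w \<longrightarrow> \<sigma> \<le> \<sigma>m \<longrightarrow>
    bounded_queries nq na \<sigma> n w valid ans \<longrightarrow> (\<exists>D. serves w C c 0 valid ans D \<and> cell D 0 0 = 1))"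
proof -
  let ?W = "key_len n0"
  have "finite {P. set P \<subseteq> {..<\<sigma>m} \<and> length P \<le> n0}" by (rule finite_lists_length_le) simp
  then have fin: "finite ({args. set args \<subseteq> {..n0} \<and> length args = na} \<times>
      {Q. set Q \<subseteq> {P. set P \<subseteq> {..<\<sigma>m} \<and> length P \<le> n0} \<and> length Q = nq})"
    by (intro finite_cartesian_product finite_lists_length_eq) auto
  obtain ql where ql: "set ql = {args. set args \<subseteq> {..n0} \<and> length args = na} \<times>
      {Q. set Q \<subseteq> {P. set P \<subseteq> {..<\<sigma>m} \<and> length P \<le> n0} \<and> length Q = nq}"
    using finite_list[OF fin] ..
  define m where "m = length ql"
  define c where "c = lookup_com n0 m ;; Set 0 (V 3)"
  define C where "C = 1 + m * Suc ?W"
  have "\<exists>D. serves w C c 0 valid ans D \<and> cell D 0 0 = 1"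
    if n: "n < n0" "n < 2 ^ w" "0 < w" and \<sigma>: "\<sigma> \<le> 2 ^ w" "\<sigma> \<le> \<sigma>m" and bq: "bounded_queries nq na \<sigma> n w valid ans"
    for n w \<sigma> valid ans
  proof -
    have v: "query_shape nq na args Q \<and> set (drop nq args) \<subseteq> {..n} \<and>
       (\<forall>P\<in>set Q. set P \<subseteq> {..<\<sigma>m} \<and> set P \<subseteq> {..<2 ^ w}) \<and> ans args Q \<le> n \<and>
       ((\<exists>P\<in>set Q. n < length P) \<longrightarrow> ans args Q = 0)" if "valid args Q" for args Q
      using bq that \<sigma> unfolding bounded_queries_def by (fastforce simp: lists_eq_set)
    \<comment> \<open>An entry that is not \<open>ok\<close> has 0 in place of the leading 1 and
      therefore matches no query.\<close>
    define ok where "ok t \<longleftrightarrow> valid (fst (ql ! t)) (snd (ql ! t)) \<and> (\<forall>P\<in>set (snd (ql ! t)). length P \<le> n)" for t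
    define E where "E t i = (if ok t then if i < ?W then key n0 w (fst (ql ! t)) (snd (ql ! t)) i
      else ans (fst (ql ! t)) (snd (ql ! t)) else 0)" for t i
    define D where "D = map (\<lambda>k. if k = 0 then [1] else [E ((k - 1) div Suc ?W) ((k - 1) mod Suc ?W)]) [0..<C]"
    have one: "1 < (2::nat) ^ w" using n(3) by (intro one_less_power) auto
    have args_le: "set args \<subseteq> {..n}" if "valid args Q" "\<forall>P\<in>set Q. length P \<le> n" for args Q
    proof -
      have "set args = set (take nq args) \<union> set (drop nq args)" by (metis append_take_drop_id set_append)
      moreover have "take nq args = map length Q" "set (drop nq args) \<subseteq> {..n}" using v[OF that(1)] by (auto simp: query_shape_def)
      ultimately show ?thesis using that(2) by auto
    qed
    have E_less: "E t i < 2 ^ w" for t i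
    proof (cases "ok t")
      case True
      then have val: "valid (fst (ql ! t)) (snd (ql ! t))" by (simp add: ok_def)
      have "set (fst (ql ! t)) \<subseteq> {..n}" using args_le[OF val] True by (simp add: ok_def)
      then have "set (fst (ql ! t)) \<subseteq> {..<2 ^ w}" using n(2) by auto
      then have "key n0 w (fst (ql ! t)) (snd (ql ! t)) i < 2 ^ w" using v[OF val] n(3) by (intro key_less) auto
      moreover have "ans (fst (ql ! t)) (snd (ql ! t)) < 2 ^ w" using v[OF val] n(2) by auto
      ultimately show ?thesis by (simp add: E_def)
    qed (simp add: E_def)
    have "data_structure w C D"
    proof -
      have "sum_list (map length D) = C"
      proof -
        have "map length D = map (\<lambda>_. 1) [0..<C]" unfolding D_def by (auto simp del: upt_Suc)
        then show ?thesis by (simp add: sum_list_triv)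
      qed
      moreover have "set X \<subseteq> {..<2 ^ w}" if "X \<in> set D" for X
        using that E_less one unfolding D_def by (auto split: if_splits simp del: upt_Suc)
      ultimately show ?thesis by (simp add: data_structure_def)
    qed
    moreover have "cell D 0 0 = 1" by (simp add: cell_def D_def C_def del: upt_Suc)
    moreover have "computes w D Q args c 0 (ans args Q)" if val: "valid args Q" for args Q
    proof -
      have cells: "cell D (entry_seg n0 t i) 0 = E t i" if ti: "t < m" "i \<le> ?W" for t i
      proof -
        have "t * Suc ?W + i < m * Suc ?W" using ti mult_le_mono1[of "Suc t" m "Suc ?W"] by simp
        then have "entry_seg n0 t i < C" by (simp add: entry_seg_def C_def)
        moreover have "(t * Suc ?W + i) div Suc ?W = t" "(t * Suc ?W + i) mod Suc ?W = i"
          using ti(2) by (simp_all only: div_mult_self3 mod_mult_self3 nat.distinct div_less mod_less less_Suc_eq_le add_0_right not_False_eq_True)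
        ultimately show ?thesis by (simp add: cell_def D_def entry_seg_def del: upt_Suc mult_Suc_right)
      qed
      have la: "length args \<le> 3" using v[OF val] l(2) by (auto simp: query_shape_def)
      have k0: "key n0 w args Q 0 = 1" using n(3) by (simp add: key_def key_expr_def)
      have match: "E t ?W = ans args Q" if t: "t < m" "\<forall>i<?W. key n0 w args Q i = E t i" for t
      proof -
        have "0 < ?W" by (simp add: key_len_def)
        then have "E t 0 = 1" using t(2) k0 by metis
        then have ok: "ok t" by (auto simp: E_def split: if_splits)
        then have val': "valid (fst (ql ! t)) (snd (ql ! t))" by (simp add: ok_def)
        have "args = fst (ql ! t) \<and> Q = snd (ql ! t)"
        proof (rule key_inj[OF _ _ l _ _ n(1,2)])
          show "query_shape nq na args Q" "query_shape nq na (fst (ql ! t)) (snd (ql ! t))" using v val val' by auto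
          show "\<forall>i<?W. key n0 w args Q i = key n0 w (fst (ql ! t)) (snd (ql ! t)) i" using t(2) ok by (auto simp: E_def)
          show "\<And>P. P \<in> set (snd (ql ! t)) \<Longrightarrow> length P \<le> n" using ok by (simp add: ok_def)
        qed
        then show ?thesis using ok by (simp add: E_def)
      qed
      \<comment> \<open>A query with a pattern longer than \<open>n\<close> relies on 0, the default
        value of \<open>lookup\<close>.\<close>
      have ex: "(\<exists>t<m. \<forall>i<?W. key n0 w args Q i = E t i) \<or> ans args Q = 0"
      proof (cases "\<forall>P\<in>set Q. length P \<le> n")
        case True
        have "set args \<subseteq> {..n0}" using args_le[OF val True] n(1) by auto
        moreover have "set Q \<subseteq> {P. set P \<subseteq> {..<\<sigma>m} \<and> length P \<le> n0}" using v[OF val] True n(1) by fastforce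
        ultimately have "(args, Q) \<in> set ql" using v[OF val] unfolding ql by (auto simp: query_shape_def)
        then obtain t where t: "t < m" "ql ! t = (args, Q)" by (auto simp: in_set_conv_nth m_def)
        then have "ok t" using val True by (simp add: ok_def)
        then have "\<forall>i<?W. key n0 w args Q i = E t i" using t(2) by (simp add: E_def)
        then show ?thesis using t(1) by blast
      next
        case False
        then show ?thesis using v[OF val] by (auto simp: not_le)
      qed
      have "lookup E ?W (key n0 w args Q) m = ans args Q" using match ex by (rule lookup_eq)
      then have 1: "hoare w D Q (\<lambda>s. s = regs (init args)) (lookup_com n0 m) 0 (\<lambda>s. s 3 = ans args Q)"
        using lookup_com_correct[of m n0 D E w args Q, OF cells n(3) la] by (auto elim: hoare_conseq)
      have "hoare w D Q (\<lambda>s. s 3 = ans args Q) (Set 0 (V 3)) 0 (\<lambda>s. s 0 = ans args Q)" by (rule hoare_Set) simp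
      then show ?thesis unfolding c_def by (rule hoare_Seq[OF 1]) simp
    qed
    ultimately show ?thesis by (auto simp: serves_def)
  qed
  moreover have "com_below 20 c" by (simp add: c_def com_below_lookup)
  ultimately show ?thesis by (intro exI[of _ c] exI[of _ C]) blast
qed

text \<open>Program and constant precede \<open>n\<close>, \<open>w\<close> and the instance
  \<open>z\<close>. The \<open>max 1\<close> grants constant time to queries whose patterns are all
  empty.\<close>

definition solvable :: "(nat \<Rightarrow> nat \<Rightarrow> 'z \<Rightarrow> bool) \<Rightarrow> (nat \<Rightarrow> nat \<Rightarrow> nat list \<Rightarrow> nat list list \<Rightarrow> bool) \<Rightarrow>
    ('z \<Rightarrow> nat list \<Rightarrow> nat list list \<Rightarrow> nat) \<Rightarrow> bool" where
  "solvable inst valid ans \<longleftrightarrow> (\<exists>p C. \<forall>n\<ge>1. \<forall>w z. inst n w z \<longrightarrow> (\<exists>D. data_structure w (C * n) D \<and>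
     (\<forall>args Q. valid n w args Q \<longrightarrow> answers p w D args Q (C * max 1 (sum_list (map length Q))) (ans z args Q))))"

text \<open>\<open>K\<close>, \<open>G\<close>, \<open>n0\<close> and the alphabet bound for small
  inputs depend on \<open>\<sigma>\<close> alone, so both regimes have fixed programs, which a test
  of the tag joins into one.\<close>

lemma solvable_if_serves:
  assumes \<sigma>: "polylog \<sigma>" and l: "nq \<le> 2" "na \<le> 3" and below: "\<And>G K. com_below 20 (main G K)"
    and inst: "\<And>n w z. inst n w z \<Longrightarrow> word_size n (\<sigma> n) w"
    and large: "\<And>n w z b K T B G b1 H nb nsb q0 levels.
      params n w (\<sigma> n) b K T B G b1 H nb nsb q0 levels \<Longrightarrow> inst n w z \<Longrightarrow>
      \<exists>D. serves w ((12 + 2 * G) * n) (main G K) (2 * K + 4) (valid n w) (ans z) D \<and> cell D 0 0 = 0"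
    and bq: "\<And>n w z. inst n w z \<Longrightarrow> bounded_queries nq na (\<sigma> n) n w (valid n w) (ans z)"
  shows "solvable inst valid ans"
proof -
  obtain K G n0 where par: "\<And>n w. n \<ge> n0 \<Longrightarrow> n < 2 ^ w \<Longrightarrow>
     \<exists>b T B b1 H nb nsb q0 levels. params n w (\<sigma> n) b K T B G b1 H nb nsb q0 levels"
    using params_exist[OF \<sigma>] by blast
  \<comment> \<open>A common alphabet bound for the finitely many \<open>n < n0\<close>.\<close>
  define \<sigma>m where "\<sigma>m = (\<Sum>n<n0. \<sigma> n)"
  have \<sigma>m: "\<sigma> n \<le> \<sigma>m" if "n < n0" for n
    unfolding \<sigma>m_def using that by (intro member_le_sum) auto
  obtain c C1 where c: "com_below 20 c" and small: "\<And>n w \<sigma> valid ans. n < n0 \<Longrightarrow> n < 2 ^ w \<Longrightarrow> 0 < w \<Longrightarrow>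
    \<sigma> \<le> 2 ^ w \<Longrightarrow> \<sigma> \<le> \<sigma>m \<Longrightarrow> bounded_queries nq na \<sigma> n w valid ans \<Longrightarrow> \<exists>D. serves w C1 c 0 valid ans D \<and> cell D 0 0 = 1"
    using table_exists[OF l, of n0 \<sigma>m] by blast
  define f where "f = If (sc 0) (N 1) (main G K) c"
  define C where "C = (12 + 2 * G) + C1 + com_len f * (2 * K + 5)"
  have f: "com_below 20 f" using below c by (simp add: f_def)
  have ans: "answers (compile 20 0 f) w D args Q (C * max 1 m) v"
    if "computes w D Q args f (m * t) v" "t \<le> 2 * K + 4" for w D args Q m t v
  proof (rule answers_if_computes[OF that(1) f])
    \<comment> \<open>The summand 1 from the compilation bound is covered by an additional
      \<open>max 1 m\<close>.\<close>
    have "m * t + 1 \<le> max 1 m * (2 * K + 4) + max 1 m" using that(2) by (intro add_mono mult_le_mono) auto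
    also have "\<dots> = (2 * K + 5) * max 1 m" by (simp add: algebra_simps)
    finally have "com_len f * (m * t + 1) \<le> com_len f * ((2 * K + 5) * max 1 m)" by (rule mult_le_mono2)
    also have "\<dots> \<le> C * max 1 m" unfolding C_def by (simp only: mult.assoc[symmetric]) (intro mult_le_mono1, simp)
    finally show "com_len f * (m * t + 1) \<le> C * max 1 m" .
  qed simp
  have "\<exists>D. data_structure w (C * n) D \<and>
     (\<forall>args Q. valid n w args Q \<longrightarrow> answers (compile 20 0 f) w D args Q (C * max 1 (sum_list (map length Q))) (ans z args Q))"
    if n: "1 \<le> n" and i: "inst n w z" for n w z
  proof -
    have ws: "n < 2 ^ w" "\<sigma> n \<le> 2 ^ w" using inst[OF i] by (auto simp: word_size_def)
    have w: "0 < w" using ws n by (cases w) auto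
    have "\<exists>D c' s t. serves w s c' t (valid n w) (ans z) D \<and> s \<le> C * n \<and> t \<le> 2 * K + 4 \<and>
      (cell D 0 0 = 0 \<and> c' = main G K \<or> cell D 0 0 = 1 \<and> c' = c)"
    proof (cases "n0 \<le> n")
      case True
      have "(12 + 2 * G) * n \<le> C * n" by (intro mult_le_mono1) (simp add: C_def)
      then show ?thesis using par[OF True ws(1)] large[OF _ i] by blast
    next
      case False
      then have n0: "n < n0" by simp
      obtain D where D: "serves w C1 c 0 (valid n w) (ans z) D" "cell D 0 0 = 1"
        using small[OF n0 ws(1) w ws(2) \<sigma>m[OF n0] bq[OF i]] by blast
      have "C1 \<le> C1 * n" using n by simp
      also have "\<dots> \<le> C * n" unfolding C_def by (intro mult_le_mono1) simp
      finally show ?thesis using D by (intro exI[of _ D] exI[of _ c] exI[of _ C1] exI[of _ 0]) simp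
    qed
    then obtain D c' s t where D: "data_structure w s D" "s \<le> C * n" "t \<le> 2 * K + 4"
      "cell D 0 0 = 0 \<and> c' = main G K \<or> cell D 0 0 = 1 \<and> c' = c"
      and h: "\<And>args Q. valid n w args Q \<Longrightarrow> computes w D Q args c' (sum_list (map length Q) * t) (ans z args Q)"
      by (auto simp: serves_def)
    have "computes w D Q args f t' v" if "computes w D Q args c' t' v" for args Q t' v
      unfolding f_def using D(4) w that by (intro hoare_If) (auto simp: hoare_def)
    then show ?thesis using ans[OF _ D(3)] h D(1,2) by (intro exI[of _ D]) (auto simp: data_structure_def)
  qed
  then show ?thesis unfolding solvable_def by blast
qed

lemma card_Collect_le: "card {k \<in> {i..j}. R k} \<le> n" if "1 \<le> i" "j \<le> n" for i j n :: nat
proof -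
  have "card {k \<in> {i..j}. R k} \<le> card {1..n}" using that by (intro card_mono) auto
  then show ?thesis by simp
qed

abbreviation text_inst :: "(nat \<Rightarrow> nat) \<Rightarrow> nat \<Rightarrow> nat \<Rightarrow> nat list \<times> 'a \<Rightarrow> bool" where
  "text_inst \<sigma> n w z \<equiv> word_size n (\<sigma> n) w \<and> fst z \<in> lists {..<\<sigma> n} \<and> length (fst z) = n"

lemma interval_solvable:
  assumes "polylog \<sigma>"
  shows "solvable (text_inst \<sigma>) (\<lambda>n w. interval_query (\<sigma> n) n w) (\<lambda>z. interval_answer (fst z) (snd z))"
proof (rule solvable_if_serves[OF assms _ _ com_below_programs(1)])
  show "bounded_queries 1 3 (\<sigma> n) n w (interval_query (\<sigma> n) n w) (interval_answer (fst z) (snd z))"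
    if "text_inst \<sigma> n w z" for n w and z :: "nat list \<times> (nat \<Rightarrow> bool)"
    unfolding bounded_queries_def
  proof (intro allI impI)
    fix args Q assume "interval_query (\<sigma> n) n w args Q"
    then obtain P i j where *: "args = [length P, i, j]" "Q = [P]" "P \<in> lists {..<\<sigma> n}" "1 \<le> i" "i \<le> j" "j \<le> n"
      unfolding interval_query_def by blast
    have "interval_answer (fst z) (snd z) args Q = 0" if "n < length P"
      using occurs_at_long[of "fst z" P] that * \<open>text_inst \<sigma> n w z\<close> by (simp add: interval_answer_def)
    moreover have "interval_answer (fst z) (snd z) args Q \<le> n"
      unfolding interval_answer_def by (rule card_Collect_le) (use * in auto)
    ultimately show "query_shape 1 3 args Q \<and> set (drop 1 args) \<subseteq> {..n} \<and> (\<forall>P\<in>set Q. P \<in> lists {..<\<sigma> n}) \<and>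
      interval_answer (fst z) (snd z) args Q \<le> n \<and> ((\<exists>P\<in>set Q. n < length P) \<longrightarrow> interval_answer (fst z) (snd z) args Q = 0)"
      using * by (auto simp: query_shape_def)
  qed
qed (blast intro: interval_large | simp)+

lemma bounded_pair_queries:
  assumes "\<And>Q. ans [length (Q ! 0), length (Q ! 1)] Q \<le> n"
    "\<And>P1 P2. n < length P1 \<or> n < length P2 \<Longrightarrow> ans [length P1, length P2] [P1, P2] = 0"
  shows "bounded_queries 2 2 \<sigma> n w (pair_query \<sigma> w) ans"
  unfolding bounded_queries_def
proof (intro allI impI)
  fix args Q assume "pair_query \<sigma> w args Q"
  then obtain P1 P2 where "args = [length P1, length P2]" "Q = [P1, P2]" "P1 \<in> lists {..<\<sigma>}" "P2 \<in> lists {..<\<sigma>}"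
    unfolding pair_query_def by blast
  then show "query_shape 2 2 args Q \<and> set (drop 2 args) \<subseteq> {..n} \<and> (\<forall>P\<in>set Q. P \<in> lists {..<\<sigma>}) \<and>
      ans args Q \<le> n \<and> ((\<exists>P\<in>set Q. n < length P) \<longrightarrow> ans args Q = 0)"
    using assms(1)[of Q] assms(2)[of P1 P2] by (auto simp: query_shape_def)
qed

lemma gap_solvable:
  assumes "polylog \<sigma>"
  shows "solvable (text_inst \<sigma>) (\<lambda>n w. pair_query (\<sigma> n) w) (\<lambda>z. gap_answer (fst z) (snd z))"
proof (rule solvable_if_serves[OF assms _ _ com_below_programs(3)])
  show "bounded_queries 2 2 (\<sigma> n) n w (pair_query (\<sigma> n) w) (gap_answer (fst z) (snd z))"
    if z: "text_inst \<sigma> n w z" for n w and z :: "nat list \<times> nat"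
  proof (rule bounded_pair_queries)
    show "gap_answer (fst z) (snd z) [length (Q ! 0), length (Q ! 1)] Q \<le> n" for Q
      unfolding gap_answer_def by (rule card_Collect_le) (use z in auto)
    show "gap_answer (fst z) (snd z) [length P1, length P2] [P1, P2] = 0" if "n < length P1 \<or> n < length P2" for P1 P2
      using that z occurs_at_long[of "fst z"] by (auto simp: gap_answer_def)
  qed
qed (blast intro: gap_large | simp)+

lemma aligned_solvable:
  assumes "polylog \<sigma>"
  shows "solvable (\<lambda>n w z. word_size n (\<sigma> n) w \<and> fst z \<in> lists {..<\<sigma> n} \<and> snd z \<in> lists {..<\<sigma> n} \<and>
    length (fst z) + length (snd z) = n) (\<lambda>n w. pair_query (\<sigma> n) w) (\<lambda>z. aligned_answer (fst z) (snd z))"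
    (is "solvable ?inst _ _")
proof (rule solvable_if_serves[OF assms _ _ com_below_programs(2)])
  show "bounded_queries 2 2 (\<sigma> n) n w (pair_query (\<sigma> n) w) (aligned_answer (fst z) (snd z))"
    if z: "?inst n w z" for n w and z :: "nat list \<times> nat list"
  proof (rule bounded_pair_queries)
    show "aligned_answer (fst z) (snd z) [length (Q ! 0), length (Q ! 1)] Q \<le> n" for Q
      unfolding aligned_answer_def by (rule card_Collect_le) (use z in auto)
    show "aligned_answer (fst z) (snd z) [length P1, length P2] [P1, P2] = 0" if "n < length P1 \<or> n < length P2" for P1 P2
      using that z occurs_at_long[of "fst z" P1] occurs_at_long[of "snd z" P2] by (auto simp: aligned_answer_def)
  qed
qed (blast intro: aligned_large | simp)+

lemma solvable_pairs:
  assumes "solvable inst (\<lambda>n w. pair_query (\<sigma> n) w) ans"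
  shows "\<exists>p C. \<forall>n\<ge>1. \<forall>w z. inst n w z \<longrightarrow> (\<exists>D. data_structure w (C * n) D \<and>
     (\<forall>P1 P2. P1 \<in> lists {..<\<sigma> n} \<longrightarrow> P2 \<in> lists {..<\<sigma> n} \<longrightarrow> length P1 < 2 ^ w \<longrightarrow> length P2 < 2 ^ w \<longrightarrow>
       answers p w D [length P1, length P2] [P1, P2] (C * max 1 (length P1 + length P2)) (ans z [length P1, length P2] [P1, P2])))"
  using assms unfolding solvable_def
  apply (elim exE)
  subgoal for p C
    apply (intro exI[of _ p] exI[of _ C] allI impI)
    subgoal premises h for n w z
      using h(1)[THEN spec[of _ n], THEN mp, OF h(2), THEN spec[of _ w], THEN spec[of _ z], THEN mp, OF h(3)]
      apply (elim exE conjE)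
      subgoal for D
        apply (intro exI[of _ D] conjI allI impI, assumption)
        subgoal premises g for P1 P2
          using g(2)[THEN spec[of _ "[length P1, length P2]"], THEN spec[of _ "[P1, P2]"]] g(3-)
          by (simp add: pair_query_def del: in_lists_conv_set)
        done
      done
    done
  done

lemma solvable_intervals:
  assumes "solvable inst (\<lambda>n w. interval_query (\<sigma> n) n w) ans"
  shows "\<exists>p C. \<forall>n\<ge>1. \<forall>w z. inst n w z \<longrightarrow> (\<exists>D. data_structure w (C * n) D \<and>
     (\<forall>P i j. P \<in> lists {..<\<sigma> n} \<longrightarrow> length P < 2 ^ w \<longrightarrow> 1 \<le> i \<longrightarrow> i \<le> j \<longrightarrow> j \<le> n \<longrightarrow>
       answers p w D [length P, i, j] [P] (C * max 1 (length P)) (ans z [length P, i, j] [P])))"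
  using assms unfolding solvable_def
  apply (elim exE)
  subgoal for p C
    apply (intro exI[of _ p] exI[of _ C] allI impI)
    subgoal premises h for n w z
      using h(1)[THEN spec[of _ n], THEN mp, OF h(2), THEN spec[of _ w], THEN spec[of _ z], THEN mp, OF h(3)]
      apply (elim exE conjE)
      subgoal for D
        apply (intro exI[of _ D] conjI allI impI, assumption)
        subgoal premises g for P i j
          using g(2)[THEN spec[of _ "[length P, i, j]"], THEN spec[of _ "[P]"]] g(3-)
          by (simp add: interval_query_def del: in_lists_conv_set)
        done
      done
    done
  done

theorem theorem6:
  fixes \<sigma> :: "nat \<Rightarrow> nat"
  assumes "polylog \<sigma>"
  shows
   "(\<exists>p C. \<forall>n\<ge>1. \<forall>w S. word_size n (\<sigma> n) w \<longrightarrow> S \<in> lists {..<\<sigma> n} \<longrightarrow> length S = n \<longrightarrow>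
       (\<exists>D. data_structure w (C * n) D \<and>
         (\<forall>P i j. P \<in> lists {..<\<sigma> n} \<longrightarrow> length P < 2 ^ w \<longrightarrow> 1 \<le> i \<longrightarrow> i \<le> j \<longrightarrow> j \<le> n \<longrightarrow>
            answers p w D [length P, i, j] [P] (C * max 1 (length P))
              (card {k \<in> {i..j}. occurs_at P S k}))))
    \<and>
    (\<exists>p C. \<forall>n\<ge>1. \<forall>w S \<pi>. word_size n (\<sigma> n) w \<longrightarrow> S \<in> lists {..<\<sigma> n} \<longrightarrow> length S = n \<longrightarrow>
       (\<forall>(a, b)\<in>\<pi>. 1 \<le> a \<and> a \<le> b \<and> b \<le> n) \<longrightarrow>
       (\<exists>D. data_structure w (C * n) D \<and>
         (\<forall>P i j. P \<in> lists {..<\<sigma> n} \<longrightarrow> length P < 2 ^ w \<longrightarrow> 1 \<le> i \<longrightarrow> i \<le> j \<longrightarrow> j \<le> n \<longrightarrow>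
            answers p w D [length P, i, j] [P] (C * max 1 (length P))
              (card {k \<in> {i..j}. occurs_at P S k \<and> (\<exists>(a, b)\<in>\<pi>. k \<in> {a..b})}))))
    \<and>
    (\<exists>p C. \<forall>n\<ge>1. \<forall>w S (d::nat). word_size n (\<sigma> n) w \<longrightarrow> S \<in> lists {..<\<sigma> n} \<longrightarrow> length S = n \<longrightarrow>
       (\<exists>D. data_structure w (C * n) D \<and>
         (\<forall>P1 P2. P1 \<in> lists {..<\<sigma> n} \<longrightarrow> P2 \<in> lists {..<\<sigma> n} \<longrightarrow>
            length P1 < 2 ^ w \<longrightarrow> length P2 < 2 ^ w \<longrightarrow>
            answers p w D [length P1, length P2] [P1, P2] (C * max 1 (length P1 + length P2))
              (card {k \<in> {1..n}. occurs_at P1 S k \<and> occurs_at P2 S (k + length P1 + d)}))))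
    \<and>
    (\<exists>p C. \<forall>n\<ge>1. \<forall>w S1 S2. word_size n (\<sigma> n) w \<longrightarrow>
       S1 \<in> lists {..<\<sigma> n} \<longrightarrow> S2 \<in> lists {..<\<sigma> n} \<longrightarrow> length S1 + length S2 = n \<longrightarrow>
       (\<exists>D. data_structure w (C * n) D \<and>
         (\<forall>P1 P2. P1 \<in> lists {..<\<sigma> n} \<longrightarrow> P2 \<in> lists {..<\<sigma> n} \<longrightarrow>
            length P1 < 2 ^ w \<longrightarrow> length P2 < 2 ^ w \<longrightarrow>
            answers p w D [length P1, length P2] [P1, P2] (C * max 1 (length P1 + length P2))
              (card {k \<in> {1..min (length S1) (length S2)}. occurs_at P1 S1 k \<and> occurs_at P2 S2 k}))))"
proof (intro conjI, goal_cases)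
  case 1
  from solvable_intervals[OF interval_solvable[OF assms]] show ?case
    apply (elim exE)
    subgoal for p C
      apply (intro exI[of _ p] exI[of _ C] allI impI)
      subgoal premises h for n w S
        using h(1)[THEN spec[of _ n], THEN mp, OF h(2), THEN spec[of _ w], THEN spec[of _ "(S, \<lambda>_. True)"]] h(3-)
        by (simp add: interval_answer_def del: in_lists_conv_set)
      done
    done
next
  case 2
  from solvable_intervals[OF interval_solvable[OF assms]] show ?case
    apply (elim exE)
    subgoal for p C
      apply (intro exI[of _ p] exI[of _ C] allI impI)
      subgoal premises h for n w S \<pi>
        \<comment> \<open>The set \<open>\<pi>\<close> enters through its union, as a property of
          positions.\<close>
        using h(1)[THEN spec[of _ n], THEN mp, OF h(2), THEN spec[of _ w], THEN spec[of _ "(S, \<lambda>k. \<exists>(a, b)\<in>\<pi>. k \<in> {a..b})"]] h(3-)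
        by (simp add: interval_answer_def del: in_lists_conv_set)
      done
    done
next
  case 3
  from solvable_pairs[OF gap_solvable[OF assms]] show ?case
    apply (elim exE)
    subgoal for p C
      apply (intro exI[of _ p] exI[of _ C] allI impI)
      subgoal premises h for n w S d
        using h(1)[THEN spec[of _ n], THEN mp, OF h(2), THEN spec[of _ w], THEN spec[of _ "(S, d)"]] h(3-)
        by (simp add: gap_answer_def del: in_lists_conv_set)
      done
    done
next
  case 4
  from solvable_pairs[OF aligned_solvable[OF assms]] show ?case
    apply (elim exE)
    subgoal for p C
      apply (intro exI[of _ p] exI[of _ C] allI impI)
      subgoal premises h for n w S1 S2
        using h(1)[THEN spec[of _ n], THEN mp, OF h(2), THEN spec[of _ w], THEN spec[of _ "(S1, S2)"]] h(3-)
        by (simp add: aligned_answer_def del: in_lists_conv_set)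
      done
    done
qed

end
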